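(* Let $\mathbb{C}^i,\mathbb{C}^e$ be constant isotropic elastic tensors with Lamé moduli satisfying $\mu^s\ge\alpha_0>0$, $2\mu^s+3\lambda^s\ge\gamma_0>0$ and $0\le\nu^s=\frac{\lambda^s}{2(\lambda^s+\mu^s)}<\frac12$ for $s\in\{i,e\}$, and let $\Gamma^R$ be the Rongved (biphase) fundamental matrix. There exists a constant $C>0$, depending only on $\mu^e,\mu^i,\lambda^e$, such that for every $r>0$, with $y_r=(0,0,r)$, $$\frac{\partial\Gamma^R_{33}(x;y_r)}{\partial x_3}\ge\frac{C}{r^2}\qquad\text{for every }x=(x_1,x_2,0)\text{ with }\sqrt{x_1^2+x_2^2}\le\frac{r}{\sqrt2}.$$
   Context: $\mathbb{C}^sA=2\mu^s\widehat A+\lambda^s(\mathrm{tr}A)I_3$, $\widehat A=\frac12(A+A^T)$, $s\in\{i,e\}$. The Rongved fundamental matrix $\Gamma^R(x,y)$ is defined by $u^R(x,y;l)=\Gamma^R(x,y)l$, where for $y\in\mathbb{R}^3$ and $|l|=1$, $u^R(\cdot,y;l)\in L^1_{loc}(\mathbb{R}^3,\mathbb{R}^3)$ is the solution of $$\mathrm{div}_x\big((\mathbb{C}^e+(\mathbb{C}^i-\mathbb{C}^e)\chi_{\{x_3<0\}})\nabla_xu^R(x,y;l)\big)=-l\,\delta(x-y)\ \text{in }\mathbb{R}^3,$$ with $u^R$ and the traction continuous across $\{x_3=0\}$, i.e. $u^R((x_1,x_2,0^+),y;l)=u^R((x_1,x_2,0^-),y;l)$ and $(\mathbb{C}^e\nabla_xu^R((x_1,x_2,0^+),y;l))e_3=(\mathbb{C}^i\nabla_xu^R((x_1,x_2,0^-),y;l))e_3$,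 and $\lim_{|x|\to\infty}u^R(x,y;l)=0$. $\Gamma^R_{33}=\Gamma^Re_3\cdot e_3$. The derivative on $\{x_3=0\}$ is the trace from the side $x_3>0$ (where the tensor is $\mathbb{C}^e$). *)

theory Defs
  imports "HOL-Analysis.Analysis"
begin

definition sym_part :: "real^3^3 \<Rightarrow> real^3^3" where
  "sym_part A = (1/2) *\<^sub>R (A + transpose A)"

definition elastic :: "real \<Rightarrow> real \<Rightarrow> real^3^3 \<Rightarrow> real^3^3" where
  "elastic mu lam A = (2 * mu) *\<^sub>R sym_part A + (lam * trace A) *\<^sub>R mat 1"

definition poisson_ratio :: "real \<Rightarrow> real \<Rightarrow> real" where
  "poisson_ratio mu lam = lam / (2 * (lam + mu))"

definition admissible_lame :: "real \<Rightarrow> real \<Rightarrow> real \<Rightarrow> real \<Rightarrow> bool" where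
  "admissible_lame \<alpha> \<gamma> mu lam \<longleftrightarrow>
     \<alpha> \<le> mu \<and> \<gamma> \<le> 2 * mu + 3 * lam \<and> 0 \<le> poisson_ratio mu lam \<and> poisson_ratio mu lam < 1/2"

definition biphase :: "real \<Rightarrow> real \<Rightarrow> real \<Rightarrow> real \<Rightarrow> real^3 \<Rightarrow> real^3^3 \<Rightarrow> real^3^3" where
  "biphase mu_i lam_i mu_e lam_e x A =
     elastic mu_e lam_e A + indicator {z. z $ 3 < 0} x *\<^sub>R (elastic mu_i lam_i A - elastic mu_e lam_e A)"

primrec Ck_on_space :: "nat \<Rightarrow> ('a::euclidean_space \<Rightarrow> 'b::euclidean_space) \<Rightarrow> bool" where
  "Ck_on_space 0 f \<longleftrightarrow> continuous_on UNIV f"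
| "Ck_on_space (Suc k) f \<longleftrightarrow>
     (\<forall>x. f differentiable (at x)) \<and> (\<forall>v. Ck_on_space k (\<lambda>x. frechet_derivative f (at x) v))"

definition test_function :: "('a::euclidean_space \<Rightarrow> 'b::euclidean_space) \<Rightarrow> bool" where
  "test_function \<phi> \<longleftrightarrow> (\<forall>k. Ck_on_space k \<phi>) \<and> compact (closure {x. \<phi> x \<noteq> 0})"

definition locally_L1 :: "('a::euclidean_space \<Rightarrow> 'b::euclidean_space) \<Rightarrow> bool" where
  "locally_L1 f \<longleftrightarrow> (\<forall>K. compact K \<longrightarrow> f absolutely_integrable_on K)"

text \<open>Entry \<open>(i, j)\<close> of \<open>grad u x\<close> is the classical derivative of \<open>u\<^sub>i\<close> in direction \<open>j\<close>.\<close>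

definition grad :: "(real^3 \<Rightarrow> real^3) \<Rightarrow> real^3 \<Rightarrow> real^3^3" where
  "grad u x = matrix (frechet_derivative u (at x))"

definition weak_gradient :: "(real^3 \<Rightarrow> real^3) \<Rightarrow> (real^3 \<Rightarrow> real^3^3) \<Rightarrow> bool" where
  "weak_gradient u G \<longleftrightarrow> locally_L1 G \<and>
     (\<forall>\<phi> :: real^3 \<Rightarrow> real. test_function \<phi> \<longrightarrow>
       (\<forall>i j. integral\<^sup>L lebesgue (\<lambda>x. u x $ i * frechet_derivative \<phi> (at x) (axis j 1))
            = - integral\<^sup>L lebesgue (\<lambda>x. G x $ i $ j * \<phi> x)))"

text \<open>The equation is understood in the sense of distributions: testing
  \<open>div (C \<nabla>u) = - l \<delta>(\<cdot> - y)\<close> against \<open>\<phi>\<close> gives \<open>\<integral> C \<nabla>u : \<nabla>\<phi> = l \<cdot> \<phi>(y)\<close>, where \<open>:\<close> is the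
  Frobenius product, i.e. the inner product of type \<open>real^3^3\<close>. The boundary values on
  \<open>x\<^sub>3 = 0\<close> are pointwise, so \<open>u\<close> is the representative that is differentiable off the
  interface and the pole; its classical gradient is required to be the weak one. At an interface
  point the value of \<open>u\<close> is the common value of the two one-sided limits; if the pole
  lies on the interface, the transmission conditions are imposed away from it.\<close>

definition rongved_solution ::
  "real \<Rightarrow> real \<Rightarrow> real \<Rightarrow> real \<Rightarrow> real^3 \<Rightarrow> real^3 \<Rightarrow> (real^3 \<Rightarrow> real^3) \<Rightarrow> bool" where
  "rongved_solution mu_i lam_i mu_e lam_e y l u \<longleftrightarrow>
     locally_L1 u \<and>
     (\<forall>x. x $ 3 \<noteq> 0 \<and> x \<noteq> y \<longrightarrow> u differentiable (at x)) \<and>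
     weak_gradient u (grad u) \<and>
     (\<forall>\<phi> :: real^3 \<Rightarrow> real^3. test_function \<phi> \<longrightarrow>
        integral\<^sup>L lebesgue (\<lambda>x. biphase mu_i lam_i mu_e lam_e x (grad u x) \<bullet> grad \<phi> x) = l \<bullet> \<phi> y) \<and>
     (\<forall>x1 x2. vector [x1, x2, 0] \<noteq> y \<longrightarrow>
        ((\<lambda>t. u (vector [x1, x2, t])) \<longlongrightarrow> u (vector [x1, x2, 0])) (at_right 0) \<and>
        ((\<lambda>t. u (vector [x1, x2, t])) \<longlongrightarrow> u (vector [x1, x2, 0])) (at_left 0) \<and>
        (\<exists>Ge Gi.
          ((\<lambda>t. grad u (vector [x1, x2, t])) \<longlongrightarrow> Ge) (at_right 0) \<and>
          ((\<lambda>t. grad u (vector [x1, x2, t])) \<longlongrightarrow> Gi) (at_left 0) \<and>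
          elastic mu_e lam_e Ge *v axis 3 1 = elastic mu_i lam_i Gi *v axis 3 1)) \<and>
     (u \<longlongrightarrow> 0) at_infinity"

text \<open>\<open>\<Gamma> x y\<close> stands for \<open>\<Gamma>\<^sup>R(x, y)\<close>; its value on the diagonal is irrelevant.\<close>

definition rongved_fundamental_matrix ::
  "real \<Rightarrow> real \<Rightarrow> real \<Rightarrow> real \<Rightarrow> (real^3 \<Rightarrow> real^3 \<Rightarrow> real^3^3) \<Rightarrow> bool" where
  "rongved_fundamental_matrix mu_i lam_i mu_e lam_e \<Gamma> \<longleftrightarrow>
     (\<forall>y l. norm l = 1 \<longrightarrow> rongved_solution mu_i lam_i mu_e lam_e y l (\<lambda>x. \<Gamma> x y *v l))"

text \<open>Partial derivative in \<open>x\<^sub>3\<close> on the plane \<open>x\<^sub>3 = 0\<close>, as the trace from the side \<open>x\<^sub>3 > 0\<close>.\<close>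

definition has_upper_normal_derivative :: "(real^3 \<Rightarrow> real) \<Rightarrow> real \<Rightarrow> real \<Rightarrow> real \<Rightarrow> bool" where
  "has_upper_normal_derivative f x1 x2 D \<longleftrightarrow>
     (\<forall>\<^sub>F t in at_right 0. (\<lambda>s. f (vector [x1, x2, s])) field_differentiable (at t)) \<and>
     ((\<lambda>t. deriv (\<lambda>s. f (vector [x1, x2, s])) t) \<longlongrightarrow> D) (at_right 0)"

end

theory Submission
  imports Defs
begin

text \<open>
  By duality, a solution \<open>u\<close> with pole \<open>y = (0, 0, r)\<close> and force \<open>e\<^sub>3\<close> is tested against the
  explicit field \<open>v\<close> of a vertical force at \<open>x\<^sub>0 = (p, q, a)\<close>, \<open>a > 0\<close>, which is built from
  Papkovich--Neuber potentials (the pole \<open>1 / |x - x\<^sub>0|\<close> and images of it) so that \<open>v\<close> and its traction are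
  continuous across the interface. The pole is smoothed inside a small ball, which turns the body force
  into an approximate identity, and \<open>v\<close> is cut off at radius \<open>R\<close>. Since \<open>|v| = O(1 / |x|)\<close>, \<open>|\<nabla>v| = O(1 / |x|\<^sup>2)\<close>
  and \<open>u \<rightarrow> 0\<close>, the cutoff error is at most a constant times \<open>sup {|u(x)| : |x| \<ge> R}\<close>; the derivatives of \<open>u\<close>,
  for which no decay is assumed, are removed by integrating by parts on each side of the interface. Hence
  \<open>u\<^sub>3(x\<^sub>0)\<close> is a positive multiple of \<open>v\<^sub>3(y)\<close>, an explicit function of \<open>a\<close> and \<open>p\<^sup>2 + q\<^sup>2\<close>.
  Its derivative at \<open>a = 0\<close> is \<open>r / |x - y|\<^sup>3\<close> times a bracket which, for \<open>p\<^sup>2 + q\<^sup>2 \<le> r\<^sup>2 / 2\<close>, is smallest at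
  \<open>p\<^sup>2 + q\<^sup>2 = r\<^sup>2 / 2\<close>; the dependence on \<open>\<lambda>\<^sup>i\<close> enters only through a term that is monotone in \<open>\<nu>\<^sup>i\<close>, and the extreme
  value \<open>\<nu>\<^sup>i = 0\<close> still leaves a positive bracket.
\<close>

section \<open>Smooth functions\<close>

text \<open>No formula for the fundamental matrix is assumed: the bound is derived for an arbitrary
  solution \<open>u\<close>, and its representation comes out of the duality. Two obstacles shape
  the work. The dual field is smooth only up to the interface from either side, while test functions
  must be smooth everywhere; so each half is extended a little across the plane and multiplied by a
  smooth step of width \<delta>, and the surface terms of size 1/\<delta> produced by the two steps
  cancel in the limit because the traces match. Secondly, the gradient of \<open>u\<close> paired
  with the derivative of the cutoff cannot be estimated directly; the same steps trade it for
  \<open>u\<close> itself and a slab average of \<open>u\<close>, both controlled by the supremum of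
  |u| on the shell. Volume R^3, field 1/R, cutoff derivative 1/R and one further derivative 1/R
  balance, so that \<open>u\<close> tending to 0 is enough. The image system needs a logarithmic
  potential besides 1/|x|, because matching calls for a primitive in x3 of the image pole; it grows,
  so only its derivatives appear in the decay estimates.\<close>

primrec Ck_on :: "nat \<Rightarrow> 'a set \<Rightarrow> ('a::euclidean_space \<Rightarrow> 'b::euclidean_space) \<Rightarrow> bool" where
  "Ck_on 0 S f \<longleftrightarrow> continuous_on S f"
| "Ck_on (Suc k) S f \<longleftrightarrow>
     (\<forall>x\<in>S. f differentiable (at x)) \<and> (\<forall>v. Ck_on k S (\<lambda>x. frechet_derivative f (at x) v))"

text \<open>\<open>Ck_on\<close> localises \<open>Ck_on_space\<close>, because the potentials are
  smooth only away from their poles. Derivatives are still those of the whole space, so the sets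
  used with it are open.\<close>

definition smooth_on :: "'a set \<Rightarrow> ('a::euclidean_space \<Rightarrow> 'b::euclidean_space) \<Rightarrow> bool" where
  "smooth_on S f \<longleftrightarrow> (\<forall>k. Ck_on k S f)"

lemma Ck_on_UNIV: "Ck_on_space k f \<longleftrightarrow> Ck_on k UNIV f"
  by (induction k arbitrary: f) auto

lemma test_function_iff: "test_function \<phi> \<longleftrightarrow> smooth_on UNIV \<phi> \<and> compact (closure {x. \<phi> x \<noteq> 0})"
  unfolding test_function_def smooth_on_def Ck_on_UNIV ..

lemma frechet_derivative_worksI:
  "f differentiable (at x) \<Longrightarrow> (f has_derivative frechet_derivative f (at x)) (at x)"
  by (rule iffD1[OF frechet_derivative_works])

lemma frechet_derivative_eqI: "(f has_derivative f') (at x) \<Longrightarrow> frechet_derivative f (at x) v = f' v"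
  by (drule frechet_derivative_at) simp

lemma Ck_on_cong:
  assumes "open S" "\<And>x. x \<in> S \<Longrightarrow> f x = g x" "Ck_on k S f"
  shows "Ck_on k S g"
  using assms(2,3)
proof (induction k arbitrary: f g)
  case 0
  then have "continuous_on S f" by simp
  moreover have "continuous_on S f \<longleftrightarrow> continuous_on S g"
    by (rule continuous_on_cong) (simp_all add: 0(1))
  ultimately show ?case by simp
next
  case (Suc k)
  have d: "g differentiable (at x)" if "x \<in> S" for x
  proof -
    have "f differentiable (at x)" using Suc.prems(2) that by simp
    then obtain f' where "(f has_derivative f') (at x)"
      unfolding differentiable_def by (elim exE)
    then have "(g has_derivative f') (at x)"
      by (rule has_derivative_transform_within_open[OF _ assms(1) that]) (simp add: Suc.prems(1))
    then show ?thesis by (rule differentiableI)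
  qed
  have eq: "frechet_derivative f (at x) v = frechet_derivative g (at x) v" if "x \<in> S" for x v
  proof -
    have "f differentiable (at x)" using Suc.prems(2) that by simp
    then show ?thesis
      by (rule frechet_derivative_transform_within_open[OF _ assms(1) that, THEN fun_cong]) (simp add: Suc.prems(1))
  qed
  have "Ck_on k S (\<lambda>x. frechet_derivative g (at x) v)" for v
    by (rule Suc.IH[of "\<lambda>x. frechet_derivative f (at x) v"]) (use eq Suc.prems(2) in simp_all)
  then show ?case using d by simp
qed

lemma Ck_on_SucI:
  assumes "open S" "\<And>x. x \<in> S \<Longrightarrow> (f has_derivative f' x) (at x)" "\<And>v. Ck_on k S (\<lambda>x. f' x v)"
  shows "Ck_on (Suc k) S f"
proof -
  have "Ck_on k S (\<lambda>x. frechet_derivative f (at x) v)" for v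
    by (rule Ck_on_cong[OF assms(1) _ assms(3)]) (simp add: frechet_derivative_eqI[OF assms(2)])
  then show ?thesis using assms(2) by (auto simp: differentiable_def)
qed

lemma Ck_on_SucD: "Ck_on (Suc k) S f \<Longrightarrow> Ck_on k S f"
proof (induction k arbitrary: f)
  case 0
  then have "\<forall>x\<in>S. isCont f x" by (simp add: differentiable_imp_continuous_within)
  then show ?case by (simp add: continuous_at_imp_continuous_on)
next
  case (Suc k)
  then show ?case by simp
qed

lemma Ck_on_subset: "Ck_on k S f \<Longrightarrow> T \<subseteq> S \<Longrightarrow> Ck_on k T f"
  by (induction k arbitrary: f) (auto intro: continuous_on_subset)

lemma Ck_on_Un: "open S \<Longrightarrow> open T \<Longrightarrow> Ck_on k S f \<Longrightarrow> Ck_on k T f \<Longrightarrow> Ck_on k (S \<union> T) f"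
  by (induction k arbitrary: f) (auto intro: continuous_on_open_Un)

lemma Ck_on_const: "Ck_on k S (\<lambda>x. c)"
  by (induction k arbitrary: c) auto

lemma Ck_on_linear: "open S \<Longrightarrow> bounded_linear f \<Longrightarrow> Ck_on k S f"
proof (cases k)
  case (Suc m)
  assume "open S" "bounded_linear f"
  then show ?thesis unfolding Suc
    by (intro Ck_on_SucI[where f' = "\<lambda>x. f"]) (auto intro: bounded_linear_imp_has_derivative Ck_on_const)
qed (auto simp: linear_continuous_on)

lemma Ck_on_add:
  assumes "open S" "Ck_on k S f" "Ck_on k S g" shows "Ck_on k S (\<lambda>x. f x + g x)"
  using assms(2,3)
proof (induction k arbitrary: f g)
  case (Suc k)
  show ?case
    by (rule Ck_on_SucI[OF assms(1), where f' = "\<lambda>x v. frechet_derivative f (at x) v + frechet_derivative g (at x) v"])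
       (use Suc in \<open>auto intro!: has_derivative_add frechet_derivative_worksI\<close>)
qed (auto intro: continuous_intros)

lemma Ck_on_bilinear:
  assumes "bounded_bilinear P" "open S" "Ck_on k S f" "Ck_on k S g" shows "Ck_on k S (\<lambda>x. P (f x) (g x))"
  using assms(3,4)
proof (induction k arbitrary: f g)
  case 0
  then show ?case using bounded_bilinear.continuous_on[OF assms(1)] by auto
next
  case (Suc k)
  show ?case
  proof (rule Ck_on_SucI[OF assms(2), where f' = "\<lambda>x v. P (f x) (frechet_derivative g (at x) v) + P (frechet_derivative f (at x) v) (g x)"])
    fix x assume "x \<in> S"
    then show "((\<lambda>x. P (f x) (g x)) has_derivative
            (\<lambda>v. P (f x) (frechet_derivative g (at x) v) + P (frechet_derivative f (at x) v) (g x))) (at x)"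
      using Suc.prems by (intro bounded_bilinear.FDERIV[OF assms(1)] frechet_derivative_worksI) auto
  next
    fix v
    show "Ck_on k S (\<lambda>x. P (f x) (frechet_derivative g (at x) v) + P (frechet_derivative f (at x) v) (g x))"
      using Suc.prems Ck_on_SucD[OF Suc.prems(1)] Ck_on_SucD[OF Suc.prems(2)]
      by (intro Ck_on_add assms(2) Suc.IH) simp_all
  qed
qed

text \<open>The derivative of h o f is h' o f times the derivative of \<open>f\<close>, a scalar
  factor because \<open>h\<close> acts on the reals. All orders of \<open>h\<close> are carried
  along so that the induction hypothesis applies to h'.\<close>

lemma Ck_on_compose:
  fixes h :: "real \<Rightarrow> real"
  assumes "open S" "\<And>x. x \<in> S \<Longrightarrow> f x \<in> T" "\<And>k. Ck_on k T h" "Ck_on k S f"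
  shows "Ck_on k S (\<lambda>x. h (f x))"
  using assms(3,4)
proof (induction k arbitrary: h)
  case 0
  have "continuous_on T h" using 0(1)[of 0] by simp
  moreover have "continuous_on S f" using 0(2) by simp
  ultimately show ?case using assms(2)
    by (simp add: continuous_on_compose2 image_subset_iff)
next
  case (Suc k)
  let ?h' = "\<lambda>t. frechet_derivative h (at t) 1"
  show ?case
  proof (rule Ck_on_SucI[OF assms(1), where f' = "\<lambda>x v. ?h' (f x) * frechet_derivative f (at x) v"])
    fix x assume x: "x \<in> S"
    have "(h has_derivative frechet_derivative h (at (f x))) (at (f x))"
      using Suc.prems(1)[of "Suc 0"] assms(2)[OF x] by (auto intro!: frechet_derivative_worksI)
    moreover have "(f has_derivative frechet_derivative f (at x)) (at x)"
      using Suc.prems(2) x by (auto intro!: frechet_derivative_worksI)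
    ultimately have d: "((\<lambda>x. h (f x)) has_derivative (\<lambda>v. frechet_derivative h (at (f x)) (frechet_derivative f (at x) v))) (at x)"
      using has_derivative_compose by blast
    have lin: "frechet_derivative h (at (f x)) w = ?h' (f x) * w" for w
    proof -
      have "linear (frechet_derivative h (at (f x)))"
        using Suc.prems(1)[of "Suc 0"] assms(2)[OF x] by (auto intro: linear_frechet_derivative)
      then show ?thesis using linear_cmul[of "frechet_derivative h (at (f x))" w 1] by simp
    qed
    then have "(\<lambda>v. frechet_derivative h (at (f x)) (frechet_derivative f (at x) v)) = (\<lambda>v. ?h' (f x) * frechet_derivative f (at x) v)"
      by (intro ext)
    then show "((\<lambda>x. h (f x)) has_derivative (\<lambda>v. ?h' (f x) * frechet_derivative f (at x) v)) (at x)"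
      using d by simp
  next
    fix v
    have "\<And>k. Ck_on k T ?h'" using Suc.prems(1) by (metis Ck_on.simps(2))
    then have "Ck_on k S (\<lambda>x. ?h' (f x))"
      using Suc.IH[of ?h'] Suc.prems(2) Ck_on_SucD by blast
    then show "Ck_on k S (\<lambda>x. ?h' (f x) * frechet_derivative f (at x) v)"
      using Suc.prems(2) by (intro Ck_on_bilinear[OF bounded_bilinear_mult] assms(1)) auto
  qed
qed

lemma smooth_onD: "smooth_on S f \<Longrightarrow> Ck_on k S f" by (simp add: smooth_on_def)

lemma smooth_on_cong: "open S \<Longrightarrow> smooth_on S f \<Longrightarrow> (\<And>x. x \<in> S \<Longrightarrow> f x = g x) \<Longrightarrow> smooth_on S g"
  using Ck_on_cong unfolding smooth_on_def by blast

lemma smooth_on_subset: "smooth_on S f \<Longrightarrow> T \<subseteq> S \<Longrightarrow> smooth_on T f"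
  using Ck_on_subset unfolding smooth_on_def by blast

lemma smooth_on_Un: "open S \<Longrightarrow> open T \<Longrightarrow> smooth_on S f \<Longrightarrow> smooth_on T f \<Longrightarrow> smooth_on (S \<union> T) f"
  using Ck_on_Un unfolding smooth_on_def by blast

lemma smooth_on_const [intro, simp]: "smooth_on S (\<lambda>x. c)"
  by (simp add: smooth_on_def Ck_on_const)

lemma smooth_on_linear: "open S \<Longrightarrow> bounded_linear f \<Longrightarrow> smooth_on S f"
  by (simp add: smooth_on_def Ck_on_linear)

lemma smooth_on_nth: "open S \<Longrightarrow> smooth_on S (\<lambda>x::real^'n. x $ i)"
  by (intro smooth_on_linear bounded_linear_vec_nth)

lemma smooth_on_add: "open S \<Longrightarrow> smooth_on S f \<Longrightarrow> smooth_on S g \<Longrightarrow> smooth_on S (\<lambda>x. f x + g x)"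
  by (simp add: smooth_on_def Ck_on_add)

lemma smooth_on_mult:
  fixes f g :: "_ \<Rightarrow> real"
  shows "open S \<Longrightarrow> smooth_on S f \<Longrightarrow> smooth_on S g \<Longrightarrow> smooth_on S (\<lambda>x. f x * g x)"
  by (simp add: smooth_on_def Ck_on_bilinear[OF bounded_bilinear_mult])

lemma smooth_on_scaleR: "open S \<Longrightarrow> smooth_on S f \<Longrightarrow> smooth_on S g \<Longrightarrow> smooth_on S (\<lambda>x. f x *\<^sub>R g x)"
  by (simp add: smooth_on_def Ck_on_bilinear[OF bounded_bilinear_scaleR])

lemma smooth_on_minus:
  fixes f :: "_ \<Rightarrow> real"
  shows "open S \<Longrightarrow> smooth_on S f \<Longrightarrow> smooth_on S (\<lambda>x. - f x)"
  using smooth_on_mult[of S "\<lambda>x. -1" f] by simp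

lemma smooth_on_diff:
  fixes f g :: "_ \<Rightarrow> real"
  shows "open S \<Longrightarrow> smooth_on S f \<Longrightarrow> smooth_on S g \<Longrightarrow> smooth_on S (\<lambda>x. f x - g x)"
  using smooth_on_add[of S f "\<lambda>x. - g x"] smooth_on_minus[of S g] by simp

lemma smooth_on_divide_const:
  fixes f :: "_ \<Rightarrow> real"
  shows "open S \<Longrightarrow> smooth_on S f \<Longrightarrow> smooth_on S (\<lambda>x. f x / c)"
  using smooth_on_mult[of S f "\<lambda>x. inverse c"] by (simp add: field_class.field_divide_inverse)

lemma smooth_on_power:
  fixes f :: "_ \<Rightarrow> real"
  shows "open S \<Longrightarrow> smooth_on S f \<Longrightarrow> smooth_on S (\<lambda>x. f x ^ n)"
  by (induction n) (auto intro: smooth_on_mult)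

lemma smooth_on_sum:
  fixes f :: "'i \<Rightarrow> _ \<Rightarrow> real"
  assumes "open S" "\<And>i. i \<in> I \<Longrightarrow> smooth_on S (f i)" shows "smooth_on S (\<lambda>x. \<Sum>i\<in>I. f i x)"
  using assms(2) by (induction I rule: infinite_finite_induct) (auto intro!: smooth_on_add assms(1))

lemma smooth_on_compose:
  fixes h :: "real \<Rightarrow> real"
  shows "open S \<Longrightarrow> smooth_on T h \<Longrightarrow> smooth_on S f \<Longrightarrow> (\<And>x. x \<in> S \<Longrightarrow> f x \<in> T) \<Longrightarrow> smooth_on S (\<lambda>x. h (f x))"
  unfolding smooth_on_def using Ck_on_compose[of S f T h] by blast

lemmas smooth_on_intros = smooth_on_nth smooth_on_add smooth_on_mult smooth_on_minus smooth_on_diff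
  smooth_on_divide_const smooth_on_power smooth_on_sum

lemma smooth_on_differentiable: "smooth_on S f \<Longrightarrow> x \<in> S \<Longrightarrow> f differentiable (at x)"
  unfolding smooth_on_def by (metis Ck_on.simps(2))

lemma smooth_on_frechet: "smooth_on S f \<Longrightarrow> smooth_on S (\<lambda>x. frechet_derivative f (at x) v)"
  unfolding smooth_on_def by (metis Ck_on.simps(2))

lemma smooth_on_continuous: "smooth_on S f \<Longrightarrow> continuous_on S f"
  unfolding smooth_on_def by (metis Ck_on.simps(1))

text \<open>For functions whose derivative is expressed through the function itself, such as \<open>inverse\<close>.\<close>

lemma smooth_on_bootstrap:
  assumes "open S" "\<And>x. x \<in> S \<Longrightarrow> (f has_derivative f' x) (at x)"
    and "\<And>k v. Ck_on k S f \<Longrightarrow> Ck_on k S (\<lambda>x. f' x v)"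
  shows "smooth_on S f"
proof -
  have "Ck_on k S f" for k
  proof (induction k)
    case 0
    have "\<forall>x\<in>S. isCont f x" using assms(2) has_derivative_continuous by blast
    then show ?case by (simp add: continuous_at_imp_continuous_on)
  next
    case (Suc k)
    then show ?case using Ck_on_SucI[OF assms(1,2)] assms(3) by blast
  qed
  then show ?thesis by (simp add: smooth_on_def)
qed

lemma DERIV_along_line:
  fixes f :: "'a::euclidean_space \<Rightarrow> real"
  assumes "f differentiable (at (p + s *\<^sub>R w))"
  shows "((\<lambda>s. f (p + s *\<^sub>R w)) has_real_derivative frechet_derivative f (at (p + s *\<^sub>R w)) w) (at s)"
proof -
  have "((\<lambda>s. p + s *\<^sub>R w) has_derivative (\<lambda>t. 0 + t *\<^sub>R w)) (at s)"
    by (intro has_derivative_add has_derivative_const has_derivative_scaleR_left has_derivative_ident)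
  from has_derivative_compose[OF this frechet_derivative_worksI[OF assms]]
  show ?thesis unfolding has_field_derivative_def
    by (simp add: linear_cmul[OF linear_frechet_derivative[OF assms]] mult.commute[of _ "frechet_derivative f (at (p + s *\<^sub>R w)) w"])
qed

text \<open>Schwarz's theorem. The second difference of \<open>f\<close> over the parallelogram
  spanned by h u and h v is symmetric in \<open>u\<close> and \<open>v\<close>; the mean value
  theorem, applied twice in either order, equates it with h^2 times either mixed derivative at a
  nearby point, and continuity of both closes the gap.\<close>

lemma frechet_derivative_commute:
  fixes f :: "'a::euclidean_space \<Rightarrow> real"
  assumes "open S" "x \<in> S" "smooth_on S f"
  shows "frechet_derivative (\<lambda>x. frechet_derivative f (at x) u) (at x) v
       = frechet_derivative (\<lambda>x. frechet_derivative f (at x) v) (at x) u"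
proof -
  define A where "A u v x = frechet_derivative (\<lambda>x. frechet_derivative f (at x) u) (at x) v" for u v x
  obtain e where e: "e > 0" "ball x e \<subseteq> S" using openE[OF assms(1,2)] .
  have key: "\<exists>s t. 0 < s \<and> s < h \<and> 0 < t \<and> t < h \<and>
      f (x + h *\<^sub>R u + h *\<^sub>R v) - f (x + h *\<^sub>R u) - f (x + h *\<^sub>R v) + f x = h * h * A u v (x + s *\<^sub>R u + t *\<^sub>R v)"
    if h: "0 < h" "h * (norm u + norm v) < e" for h u v
  proof -
    have inS: "x + s *\<^sub>R u + t *\<^sub>R v \<in> S" if "0 \<le> s" "s \<le> h" "0 \<le> t" "t \<le> h" for s t
    proof -
      have "norm (s *\<^sub>R u + t *\<^sub>R v) \<le> s * norm u + t * norm v"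
        using norm_triangle_ineq[of "s *\<^sub>R u" "t *\<^sub>R v"] that by simp
      also have "\<dots> \<le> h * norm u + h * norm v"
        using that by (intro add_mono mult_right_mono) auto
      finally have "norm (s *\<^sub>R u + t *\<^sub>R v) < e" using h by (simp add: algebra_simps)
      then have "x + (s *\<^sub>R u + t *\<^sub>R v) \<in> ball x e" by (simp only: mem_ball dist_norm norm_minus_commute[of x]) simp
      then show ?thesis using e by (auto simp: add.assoc)
    qed
    let ?g = "\<lambda>s. f ((x + h *\<^sub>R v) + s *\<^sub>R u) - f (x + s *\<^sub>R u)"
    have "\<exists>s. 0 < s \<and> s < h \<and> ?g h - ?g 0 = (h - 0) * (frechet_derivative f (at ((x + h *\<^sub>R v) + s *\<^sub>R u)) u - frechet_derivative f (at (x + s *\<^sub>R u)) u)"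
    proof (rule MVT2[OF h(1)])
      fix s assume "0 \<le> s" "s \<le> h"
      then show "(?g has_real_derivative frechet_derivative f (at ((x + h *\<^sub>R v) + s *\<^sub>R u)) u - frechet_derivative f (at (x + s *\<^sub>R u)) u) (at s)"
        using inS[of s h] inS[of s 0] h by (intro DERIV_diff DERIV_along_line smooth_on_differentiable[OF assms(3)]) (auto simp: algebra_simps)
    qed
    then obtain s where s: "0 < s" "s < h" "?g h - ?g 0 = h * (frechet_derivative f (at ((x + h *\<^sub>R v) + s *\<^sub>R u)) u - frechet_derivative f (at (x + s *\<^sub>R u)) u)"
      by auto
    let ?k = "\<lambda>t. frechet_derivative f (at ((x + s *\<^sub>R u) + t *\<^sub>R v)) u"
    have "\<exists>t. 0 < t \<and> t < h \<and> ?k h - ?k 0 = (h - 0) * A u v ((x + s *\<^sub>R u) + t *\<^sub>R v)"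
    proof (rule MVT2[OF h(1)])
      fix t assume "0 \<le> t" "t \<le> h"
      then show "(?k has_real_derivative A u v ((x + s *\<^sub>R u) + t *\<^sub>R v)) (at t)"
        unfolding A_def
        using inS[of s t] s by (intro DERIV_along_line smooth_on_differentiable[OF smooth_on_frechet[OF assms(3)]]) auto
    qed
    then obtain t where t: "0 < t" "t < h" "?k h - ?k 0 = h * A u v ((x + s *\<^sub>R u) + t *\<^sub>R v)" by auto
    have "?g h - ?g 0 = h * (h * A u v ((x + s *\<^sub>R u) + t *\<^sub>R v))"
      using s(3) t(3) by (simp add: add_ac)
    then show ?thesis using s t by (intro exI[of _ s] exI[of _ t]) (simp add: algebra_simps)
  qed
  have contA: "isCont (A u v) x" for u v
    unfolding A_def
    using smooth_on_continuous[OF smooth_on_frechet[OF smooth_on_frechet[OF assms(3)]]] assms(1,2)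
    by (simp add: continuous_on_eq_continuous_at)
  have "A u v x = A v u x"
  proof (rule ccontr)
    assume ne: "A u v x \<noteq> A v u x"
    define d where "d = \<bar>A u v x - A v u x\<bar> / 2"
    have d: "d > 0" using ne by (simp add: d_def)
    obtain r1 where r1: "r1 > 0" "\<And>y. dist y x < r1 \<Longrightarrow> dist (A u v y) (A u v x) < d"
      using contA[of u v] d unfolding continuous_at_eps_delta by blast
    obtain r2 where r2: "r2 > 0" "\<And>y. dist y x < r2 \<Longrightarrow> dist (A v u y) (A v u x) < d"
      using contA[of v u] d unfolding continuous_at_eps_delta by blast
    \<comment> \<open>The 1 keeps \<open>N\<close> positive when both directions vanish; the factor
      2 in \<open>h\<close> makes the bound strict.\<close>
    define N where "N = norm u + norm v + 1"
    define h where "h = min e (min r1 r2) / (2 * N)"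
    have N: "N > 0" unfolding N_def by (smt (verit) norm_ge_zero)
    have hpos: "h > 0" using e r1 r2 N by (simp add: h_def)
    have "h * N = min e (min r1 r2) / 2" using N by (simp add: h_def)
    moreover have "0 < min e (min r1 r2)" using e r1 r2 by simp
    ultimately have hN: "h * N < min e (min r1 r2)" by linarith
    have hb: "h * (norm u + norm v) < min e (min r1 r2)"
      using hN hpos by (simp add: N_def algebra_simps)
    obtain s t where st: "0 < s" "s < h" "0 < t" "t < h"
      "f (x + h *\<^sub>R u + h *\<^sub>R v) - f (x + h *\<^sub>R u) - f (x + h *\<^sub>R v) + f x = h * h * A u v (x + s *\<^sub>R u + t *\<^sub>R v)"
      using key[OF hpos, of u v] hb by auto
    obtain s' t' where st': "0 < s'" "s' < h" "0 < t'" "t' < h"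
      "f (x + h *\<^sub>R v + h *\<^sub>R u) - f (x + h *\<^sub>R v) - f (x + h *\<^sub>R u) + f x = h * h * A v u (x + s' *\<^sub>R v + t' *\<^sub>R u)"
      using key[OF hpos, of v u] hb by (auto simp: add.commute)
    have "x + h *\<^sub>R v + h *\<^sub>R u = x + h *\<^sub>R u + h *\<^sub>R v" by simp
    then have "h * h * A u v (x + s *\<^sub>R u + t *\<^sub>R v) = h * h * A v u (x + s' *\<^sub>R v + t' *\<^sub>R u)"
      using st(5) st'(5) by (smt (verit))
    then have eq: "A u v (x + s *\<^sub>R u + t *\<^sub>R v) = A v u (x + s' *\<^sub>R v + t' *\<^sub>R u)"
      using hpos by simp
    have b: "norm (s *\<^sub>R u + t *\<^sub>R v) < min r1 r2" if "0 < s" "s < h" "0 < t" "t < h" for s t :: real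
    proof -
      have "norm (s *\<^sub>R u + t *\<^sub>R v) \<le> s * norm u + t * norm v"
        using norm_triangle_ineq[of "s *\<^sub>R u" "t *\<^sub>R v"] that by simp
      also have "\<dots> \<le> h * norm u + h * norm v"
        using that by (intro add_mono mult_right_mono) auto
      finally show ?thesis using hb by (simp add: algebra_simps)
    qed
    have "dist (A u v (x + s *\<^sub>R u + t *\<^sub>R v)) (A u v x) < d"
      by (rule r1(2)) (use b[of s t] st in \<open>simp add: dist_norm add.assoc\<close>)
    moreover have "dist (A v u (x + s' *\<^sub>R v + t' *\<^sub>R u)) (A v u x) < d"
      by (rule r2(2)) (use b[of t' s'] st' in \<open>simp add: dist_norm add.assoc add.commute\<close>)
    ultimately show False using eq by (auto simp: d_def dist_real_def abs_if split: if_splits)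
  qed
  then show ?thesis by (simp add: A_def)
qed

section \<open>A smooth step and partial derivatives\<close>

lemma poly_times_exp_minus_tendsto_0:
  fixes p :: "real poly"
  shows "((\<lambda>x. poly p x * exp (- x)) \<longlongrightarrow> 0) at_top"
proof -
  have "((\<lambda>x. \<Sum>i\<le>degree p. coeff p i * (x ^ i / exp x)) \<longlongrightarrow> (\<Sum>i\<le>degree p. coeff p i * 0)) at_top"
    by (intro tendsto_sum tendsto_mult tendsto_const tendsto_power_div_exp_0)
  moreover have "(\<lambda>x. \<Sum>i\<le>degree p. coeff p i * (x ^ i / exp x)) = (\<lambda>x. poly p x * exp (- x))"
    by (rule ext) (simp add: poly_altdef sum_distrib_right exp_minus divide_simps)
  ultimately show ?thesis by simp
qed

text \<open>Carrying the polynomial \<open>p\<close> makes the family p(1/t) exp(-1/t), continued by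
  0, closed under differentiation. Smoothness of exp(-1/t) at 0 then is an induction on the order,
  uniform in \<open>p\<close>.\<close>

definition flat :: "real poly \<Rightarrow> real \<Rightarrow> real" where
  "flat p t = (if t \<le> 0 then 0 else poly p (inverse t) * exp (- inverse t))"

text \<open>For t > 0 the derivative is (p - p')(1/t) t^(-2) exp(-1/t), the family member with
  polynomial X^2 (p - p').\<close>

lemma flat_has_derivative:
  "(flat p has_real_derivative flat (monom 1 2 * (p - pderiv p)) t) (at t)"
proof -
  consider "t > 0" | "t < 0" | "t = 0" by linarith
  then show ?thesis
  proof cases
    case 1
    have "((\<lambda>t. poly p (inverse t) * exp (- inverse t)) has_real_derivative flat (monom 1 2 * (p - pderiv p)) t) (at t)"
      using 1 unfolding flat_def
      by (auto intro!: derivative_eq_intros simp: poly_monom algebra_simps power2_eq_square)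
    then show ?thesis
      by (rule has_field_derivative_transform_within_open[of _ _ _ "{0<..}"]) (use 1 in \<open>auto simp: flat_def\<close>)
  next
    case 2
    have "((\<lambda>t. 0) has_real_derivative 0) (at t)" by simp
    then have "(flat p has_real_derivative 0) (at t)"
      by (rule has_field_derivative_transform_within_open[of _ _ _ "{..<0}"]) (use 2 in \<open>auto simp: flat_def\<close>)
    then show ?thesis using 2 by (simp add: flat_def)
  next
    case 3
    have r: "((\<lambda>h. (flat p (0 + h) - flat p 0) / h) \<longlongrightarrow> 0) (at_right 0)"
    proof -
      \<comment> \<open>The difference quotient at 0 is p(1/h) exp(-1/h) / h;
        \<open>pCons 0 p\<close> absorbs the extra factor 1/h.\<close>
      have "((\<lambda>h::real. poly (pCons 0 p) (inverse h) * exp (- inverse h)) \<longlongrightarrow> 0) (at_right 0)"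
        by (rule filterlim_compose[OF poly_times_exp_minus_tendsto_0 filterlim_inverse_at_top_right])
      then show ?thesis
        by (rule Lim_transform_eventually)
           (auto simp: eventually_at_filter flat_def divide_simps intro!: always_eventually)
    qed
    have l: "((\<lambda>h. (flat p (0 + h) - flat p 0) / h) \<longlongrightarrow> 0) (at_left 0)"
      by (rule Lim_transform_eventually[OF tendsto_const])
         (auto simp: eventually_at_filter flat_def intro!: always_eventually)
    show ?thesis
      using filterlim_split_at[OF l r] 3 by (simp add: DERIV_def flat_def)
  qed
qed

lemma smooth_on_flat: "smooth_on UNIV (flat p)"
proof -
  have "Ck_on k UNIV (flat p)" for k
  proof (induction k arbitrary: p)
    case 0
    have "continuous_on UNIV (flat p)"
      using flat_has_derivative[THEN DERIV_isCont] by (simp add: continuous_at_imp_continuous_on)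
    then show ?case by simp
  next
    case (Suc k)
    show ?case
      by (rule Ck_on_SucI[where f' = "\<lambda>x v. flat (monom 1 2 * (p - pderiv p)) x * v"])
         (use flat_has_derivative in \<open>simp_all add: has_field_derivative_def Ck_on_bilinear[OF bounded_bilinear_mult] Suc Ck_on_const\<close>)
  qed
  then show ?thesis by (simp add: smooth_on_def)
qed

lemma smooth_on_inverse: "smooth_on {0<..} (inverse :: real \<Rightarrow> real)"
proof (rule smooth_on_bootstrap[where f' = "\<lambda>x v. - (inverse x * inverse x) * v"])
  fix x :: real assume "x \<in> {0<..}"
  then have "x \<noteq> 0" by simp
  from DERIV_inverse[OF this, of UNIV]
  show "(inverse has_derivative (\<lambda>v. - (inverse x * inverse x) * v)) (at x)"
    unfolding has_field_derivative_def by (simp only: power_Suc power_0 mult_1_right)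
next
  fix k and v :: real assume "Ck_on k {0<..} (inverse :: real \<Rightarrow> real)"
  then have "Ck_on k {0<..} (\<lambda>x::real. (inverse x * inverse x) * (- v))"
    by (intro Ck_on_bilinear[OF bounded_bilinear_mult] Ck_on_const) simp_all
  then show "Ck_on k {0<..} (\<lambda>x::real. - (inverse x * inverse x) * v)" by simp
qed simp

text \<open>The quotient form makes the step symmetric (\<open>sstep_symm\<close>). Through this
  symmetry the steps seen from the two sides of the plane have the same derivative up to
  sign.\<close>

definition sstep :: "real \<Rightarrow> real" where
  "sstep t = flat 1 t / (flat 1 t + flat 1 (1 - t))"

lemma flat1_nonneg: "0 \<le> flat 1 t"
  by (simp add: flat_def)

lemma flat1_pos: "0 < flat 1 t \<longleftrightarrow> 0 < t"
  by (simp add: flat_def)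

lemma flat1_mono: "s \<le> t \<Longrightarrow> flat 1 s \<le> flat 1 t"
  by (auto simp: flat_def intro: le_imp_inverse_le)

lemma flat1_denom: "0 < flat 1 t + flat 1 (1 - t)"
  using flat1_pos[of t] flat1_pos[of "1 - t"] flat1_nonneg[of t] flat1_nonneg[of "1 - t"] by linarith

lemma smooth_on_sstep: "smooth_on UNIV sstep"
proof -
  have 1: "smooth_on UNIV (\<lambda>t. flat 1 (1 - t))"
    by (intro smooth_on_compose[OF open_UNIV smooth_on_flat] smooth_on_diff smooth_on_const
        smooth_on_linear bounded_linear_ident open_UNIV UNIV_I)
  have "smooth_on UNIV (\<lambda>t. flat 1 t * inverse (flat 1 t + flat 1 (1 - t)))"
    by (intro smooth_on_mult open_UNIV smooth_on_flat smooth_on_compose[OF open_UNIV smooth_on_inverse] smooth_on_add 1)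
       (simp add: flat1_denom)
  then show ?thesis
    by (simp add: sstep_def[abs_def] field_class.field_divide_inverse)
qed

lemma sstep_eq_0: "t \<le> 0 \<Longrightarrow> sstep t = 0"
  by (simp add: sstep_def flat_def)

lemma sstep_eq_1: "1 \<le> t \<Longrightarrow> sstep t = 1"
  using flat1_pos[of t] by (simp add: sstep_def flat_def)

lemma sstep_symm: "sstep t + sstep (1 - t) = 1"
  using flat1_denom[of t] by (simp add: sstep_def add_divide_distrib[symmetric] add.commute)

lemma sstep_bounds: "0 \<le> sstep t" "sstep t \<le> 1"
  using flat1_denom[of t] flat1_nonneg[of t] flat1_nonneg[of "1 - t"] by (simp_all add: sstep_def)

lemma sstep_mono: "s \<le> t \<Longrightarrow> sstep s \<le> sstep t"
proof -
  assume st: "s \<le> t"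
  have "flat 1 s * flat 1 (1 - t) \<le> flat 1 t * flat 1 (1 - s)"
    using st by (intro mult_mono flat1_mono flat1_nonneg) auto
  then show ?thesis
    using flat1_denom[of t] flat1_denom[of s] by (simp add: sstep_def divide_simps algebra_simps)
qed

lemma smooth_on_real_DERIV:
  fixes h :: "real \<Rightarrow> real"
  assumes "smooth_on T h" "t \<in> T"
  shows "(h has_real_derivative deriv h t) (at t)"
proof -
  have "h differentiable (at t)" using assms by (rule smooth_on_differentiable)
  then show ?thesis by (simp add: DERIV_deriv_iff_real_differentiable)
qed

lemma smooth_on_deriv:
  fixes h :: "real \<Rightarrow> real"
  assumes "open T" "smooth_on T h"
  shows "smooth_on T (deriv h)"
proof (rule smooth_on_cong[OF assms(1) smooth_on_frechet[OF assms(2), of 1]])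
  fix t assume "t \<in> T"
  then have "(h has_derivative (\<lambda>v. deriv h t * v)) (at t)"
    using smooth_on_real_DERIV[OF assms(2)] by (simp add: has_field_derivative_def)
  then show "frechet_derivative h (at t) 1 = deriv h t" by (simp add: frechet_derivative_eqI)
qed


lemma deriv_sstep_nonneg: "0 \<le> deriv sstep t"
  using smooth_on_real_DERIV[OF smooth_on_sstep, of t]
  by (intro mono_on_imp_deriv_nonneg[of UNIV sstep "deriv sstep t" t]) (simp_all add: mono_onI sstep_mono)

section \<open>Partial derivatives and their calculus\<close>

definition pd :: "'n::finite \<Rightarrow> (real^'n \<Rightarrow> real) \<Rightarrow> real^'n \<Rightarrow> real" where
  "pd i f x = frechet_derivative f (at x) (axis i 1)"

lemma pd_eqI: "(f has_derivative f') (at x) \<Longrightarrow> pd i f x = f' (axis i 1)"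
  by (simp add: pd_def frechet_derivative_eqI)

text \<open>\<open>frechet_derivative\<close> is a choice among all derivatives at the point, and
  functions that agree nearby have the same ones. So the equation holds even at points without a
  derivative.\<close>

lemma pd_cong: "open S \<Longrightarrow> x \<in> S \<Longrightarrow> (\<And>y. y \<in> S \<Longrightarrow> f y = g y) \<Longrightarrow> pd i f x = pd i g x"
proof -
  assume a: "open S" "x \<in> S" "\<And>y. y \<in> S \<Longrightarrow> f y = g y"
  have "(f has_derivative F) (at x) \<longleftrightarrow> (g has_derivative F) (at x)" for F
    using has_derivative_transform_within_open[OF _ a(1,2), of f F UNIV g]
      has_derivative_transform_within_open[OF _ a(1,2), of g F UNIV f] a(3) by (metis (no_types, lifting))
  then show ?thesis by (simp add: pd_def frechet_derivative_def)
qed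

lemma pd_const [simp]: "pd i (\<lambda>x. c) = (\<lambda>x. 0)"
  by (simp add: pd_def[abs_def])

lemma pd_nth: "pd i (\<lambda>x. x $ j) x = (if i = j then 1 else 0)"
  by (subst pd_eqI[OF bounded_linear_imp_has_derivative[OF bounded_linear_vec_nth]]) (simp add: axis_def)

lemma pd_add: "f differentiable (at x) \<Longrightarrow> g differentiable (at x) \<Longrightarrow> pd i (\<lambda>x. f x + g x) x = pd i f x + pd i g x"
  unfolding pd_def by (subst frechet_derivative_eqI[OF has_derivative_add]) (auto intro: frechet_derivative_worksI)

lemma pd_diff: "f differentiable (at x) \<Longrightarrow> g differentiable (at x) \<Longrightarrow> pd i (\<lambda>x. f x - g x) x = pd i f x - pd i g x"
  unfolding pd_def by (subst frechet_derivative_eqI[OF has_derivative_diff]) (auto intro: frechet_derivative_worksI)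

lemma pd_minus: "f differentiable (at x) \<Longrightarrow> pd i (\<lambda>x. - f x) x = - pd i f x"
  unfolding pd_def by (subst frechet_derivative_eqI[OF has_derivative_minus]) (auto intro: frechet_derivative_worksI)

lemma pd_mult: "f differentiable (at x) \<Longrightarrow> g differentiable (at x) \<Longrightarrow>
  pd i (\<lambda>x. f x * g x) x = f x * pd i g x + pd i f x * g x"
  unfolding pd_def by (subst frechet_derivative_eqI[OF has_derivative_mult]) (auto intro: frechet_derivative_worksI)

lemma pd_cmult: "f differentiable (at x) \<Longrightarrow> pd i (\<lambda>x. c * f x) x = c * pd i f x"
  using pd_mult[of "\<lambda>x. c" x f i] by simp

lemma pd_divide_const: "f differentiable (at x) \<Longrightarrow> pd i (\<lambda>x. f x / c) x = pd i f x / c"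
  using pd_cmult[of f x i "inverse c"] by (simp add: field_class.field_divide_inverse mult.commute)

lemma pd_compose:
  "(h has_real_derivative h') (at (f x)) \<Longrightarrow> f differentiable (at x) \<Longrightarrow> pd i (\<lambda>x. h (f x)) x = h' * pd i f x"
  unfolding pd_def has_field_derivative_def
  by (subst frechet_derivative_eqI[OF has_derivative_compose[of f "frechet_derivative f (at x)" x UNIV h "(*) h'"]])
     (simp_all add: frechet_derivative_worksI)

lemma smooth_on_pd: "smooth_on S f \<Longrightarrow> smooth_on S (pd i f)"
  unfolding pd_def[abs_def] by (rule smooth_on_frechet)

lemma pd_commute: "open S \<Longrightarrow> x \<in> S \<Longrightarrow> smooth_on S f \<Longrightarrow> pd i (pd j f) x = pd j (pd i f) x"
  unfolding pd_def[abs_def] by (rule frechet_derivative_commute)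

lemma test_functionI:
  assumes "smooth_on UNIV \<phi>" "compact K" "\<And>x. x \<notin> K \<Longrightarrow> \<phi> x = 0"
  shows "test_function \<phi>"
proof -
  have "closure {x. \<phi> x \<noteq> 0} \<subseteq> K"
    using assms(2,3) by (intro closure_minimal) (auto intro: compact_imp_closed)
  moreover have "compact (K \<inter> closure {x. \<phi> x \<noteq> 0})"
    using assms(2) by (simp add: compact_Int_closed)
  ultimately show ?thesis using assms(1) by (simp add: test_function_iff Int_absorb1)
qed

lemma pd_eq_0_outside:
  assumes "closed K" "\<And>x. x \<notin> K \<Longrightarrow> f x = 0" "x \<notin> K" shows "pd i f x = 0"
  using pd_cong[of "- K" x f "\<lambda>x. 0" i] assms by auto

section \<open>Approximating functions with a jump across the plane\<close>

text \<open>For \<sigma> = 1 or -1 this is the open half-space on the side of sign \<sigma>,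
  enlarged across the plane by \<open>d\<close>. Fields live on \<open>hs \<sigma> d\<close> with d
  > 0, integrals are taken over \<open>hs \<sigma> 0\<close>.\<close>

definition hs :: "real \<Rightarrow> real \<Rightarrow> (real^3) set" where
  "hs \<sigma> d = {x. - d < \<sigma> * x $ 3}"

lemma open_hs [simp]: "open (hs \<sigma> d)"
  unfolding hs_def by (intro open_Collect_less continuous_intros)

text \<open>Rises from 0 at signed height -\<delta> to 1 at \<delta>: a smooth substitute for the
  indicator of the half-space.\<close>

definition step_at :: "real \<Rightarrow> real \<Rightarrow> real^3 \<Rightarrow> real" where
  "step_at \<sigma> \<delta> x = sstep ((\<sigma> * x $ 3 / \<delta> + 1) / 2)"

text \<open>The normal derivative of the step, up to sign: an approximation of the surface measure
  on the plane, of height O(1/\<delta>) and supported in |x3| \<le> \<delta>. One function serves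
  both sides, by the symmetry of \<open>sstep\<close>.\<close>

definition slab :: "real \<Rightarrow> real^3 \<Rightarrow> real" where
  "slab \<delta> x = deriv sstep ((x $ 3 / \<delta> + 1) / 2) / (2 * \<delta>)"

lemma deriv_sstep_symm: "deriv sstep (1 - t) = deriv sstep t"
proof -
  have "((\<lambda>t. 1 - sstep (1 - t)) has_real_derivative deriv sstep (1 - t)) (at t)"
  proof -
    have "((\<lambda>t. 1 - t) has_real_derivative (0 - 1)) (at t)" by (intro DERIV_diff DERIV_const DERIV_ident)
    from DERIV_chain2[OF smooth_on_real_DERIV[OF smooth_on_sstep UNIV_I] this]
    have "((\<lambda>t. 1 - sstep (1 - t)) has_real_derivative (0 - deriv sstep (1 - t) * (0 - 1))) (at t)"
      by (intro DERIV_diff DERIV_const)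
    then show ?thesis by simp
  qed
  moreover have "(\<lambda>t. 1 - sstep (1 - t)) = sstep"
    using sstep_symm by (auto simp: fun_eq_iff algebra_simps)
  ultimately show ?thesis
    using smooth_on_real_DERIV[OF smooth_on_sstep UNIV_I, of t] DERIV_unique by simp
qed

lemma deriv_sstep_eq_0: "t < 0 \<or> 1 < t \<Longrightarrow> deriv sstep t = 0"
proof (elim disjE)
  assume "t < 0"
  have "((\<lambda>t. 0) has_real_derivative 0) (at t)" by simp
  then have "(sstep has_real_derivative 0) (at t)"
    by (rule has_field_derivative_transform_within_open[of _ _ _ "{..<0}"]) (use \<open>t < 0\<close> in \<open>auto simp: sstep_eq_0\<close>)
  then show ?thesis by (rule DERIV_imp_deriv)
next
  assume "1 < t"
  have "((\<lambda>t. 1) has_real_derivative 0) (at t)" by simp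
  then have "(sstep has_real_derivative 0) (at t)"
    by (rule has_field_derivative_transform_within_open[of _ _ _ "{1<..}"]) (use \<open>1 < t\<close> in \<open>auto simp: sstep_eq_1\<close>)
  then show ?thesis by (rule DERIV_imp_deriv)
qed

lemma continuous_on_deriv_sstep: "continuous_on UNIV (deriv sstep)"
  by (rule smooth_on_continuous[OF smooth_on_deriv[OF open_UNIV smooth_on_sstep]])

lemma deriv_sstep_bounded: obtains M where "M > 0" "\<And>t. \<bar>deriv sstep t\<bar> \<le> M"
proof -
  have "bounded (deriv sstep ` {0..1})"
    by (intro compact_imp_bounded compact_continuous_image continuous_on_subset[OF continuous_on_deriv_sstep]) auto
  then obtain M where M: "M > 0" "\<And>t. t \<in> {0..1} \<Longrightarrow> \<bar>deriv sstep t\<bar> \<le> M"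
    unfolding bounded_pos by auto
  have "\<bar>deriv sstep t\<bar> \<le> M" for t
    using M deriv_sstep_eq_0[of t] by (cases "t \<in> {0..1}") auto
  then show ?thesis using M(1) that by blast
qed

lemma smooth_on_step_at: "smooth_on UNIV (step_at \<sigma> \<delta>)"
  unfolding step_at_def[abs_def]
  by (intro smooth_on_compose[OF open_UNIV smooth_on_sstep] smooth_on_intros smooth_on_const open_UNIV UNIV_I)

lemma step_at_eq_0: "0 < \<delta> \<Longrightarrow> \<sigma> * x $ 3 \<le> - \<delta> \<Longrightarrow> step_at \<sigma> \<delta> x = 0"
  unfolding step_at_def by (rule sstep_eq_0) (simp add: divide_simps)

lemma step_at_eq_1: "0 < \<delta> \<Longrightarrow> \<delta> \<le> \<sigma> * x $ 3 \<Longrightarrow> step_at \<sigma> \<delta> x = 1"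
  unfolding step_at_def by (rule sstep_eq_1) (simp add: divide_simps)

lemma step_at_bounds: "0 \<le> step_at \<sigma> \<delta> x" "step_at \<sigma> \<delta> x \<le> 1"
  by (simp_all add: step_at_def sstep_bounds)

lemma pd_step_at:
  assumes "\<sigma> = 1 \<or> \<sigma> = -1"
  shows "pd j (step_at \<sigma> \<delta>) x = (if j = 3 then \<sigma> * slab \<delta> x else 0)"
proof -
  have d: "(\<lambda>x::real^3. x $ 3) differentiable (at x)"
    by (intro bounded_linear_imp_differentiable bounded_linear_vec_nth)
  have "pd j (step_at \<sigma> \<delta>) x = deriv sstep ((\<sigma> * x $ 3 / \<delta> + 1) / 2) * pd j (\<lambda>x. (\<sigma> * x $ 3 / \<delta> + 1) / 2) x"
    unfolding step_at_def[abs_def]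
    by (rule pd_compose[where h = sstep, OF smooth_on_real_DERIV[OF smooth_on_sstep UNIV_I]])
       (intro smooth_on_differentiable[OF _ UNIV_I] smooth_on_intros smooth_on_const open_UNIV)
  also have "pd j (\<lambda>x. (\<sigma> * x $ 3 / \<delta> + 1) / 2) x = (if j = 3 then \<sigma> / (2 * \<delta>) else 0)"
  proof -
    have "(\<lambda>x::real^3. (\<sigma> * x $ 3 / \<delta> + 1) / 2) = (\<lambda>x. (\<sigma> / (2 * \<delta>)) * x $ 3 + 1 / 2)"
      by (auto simp: fun_eq_iff divide_simps)
    then show ?thesis
      using d by (simp add: pd_add pd_cmult pd_nth differentiable_mult del: times_divide_eq_left)
  qed
  also have "deriv sstep ((\<sigma> * x $ 3 / \<delta> + 1) / 2) = deriv sstep ((x $ 3 / \<delta> + 1) / 2)"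
  proof (cases "\<sigma> = 1")
    case False
    then have "(\<sigma> * x $ 3 / \<delta> + 1) / 2 = 1 - (x $ 3 / \<delta> + 1) / 2" using assms by (auto simp: field_simps)
    then show ?thesis by (simp only: deriv_sstep_symm)
  qed simp
  finally show ?thesis by (simp add: slab_def)
qed

lemma slab_eq_0: "0 < \<delta> \<Longrightarrow> \<delta> < \<bar>x $ 3\<bar> \<Longrightarrow> slab \<delta> x = 0"
  unfolding slab_def by (subst deriv_sstep_eq_0) (auto simp: field_simps)

lemma continuous_on_slab: "continuous_on UNIV (slab \<delta>)"
  unfolding slab_def[abs_def] divide_inverse
  by (intro continuous_intros continuous_on_compose2[OF continuous_on_deriv_sstep]) auto

text \<open>Beyond depth \<delta> on the wrong side the step vanishes identically, and this region
  overlaps \<open>hs \<sigma> d\<close> because \<delta> < d. The values of \<open>g\<close> outside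
  \<open>hs \<sigma> d\<close> are therefore irrelevant.\<close>

lemma cut_smooth:
  assumes "smooth_on (hs \<sigma> d) g" "0 < \<delta>" "\<delta> < d"
  shows "smooth_on UNIV (\<lambda>x. step_at \<sigma> \<delta> x * g x)"
proof -
  let ?T = "{x::real^3. \<sigma> * x $ 3 < - \<delta>}"
  have oT: "open ?T" by (intro open_Collect_less continuous_intros)
  have "smooth_on (hs \<sigma> d \<union> ?T) (\<lambda>x. step_at \<sigma> \<delta> x * g x)"
  proof (rule smooth_on_Un[OF open_hs oT])
    show "smooth_on (hs \<sigma> d) (\<lambda>x. step_at \<sigma> \<delta> x * g x)"
      by (intro smooth_on_mult open_hs smooth_on_subset[OF smooth_on_step_at] assms) auto
    show "smooth_on ?T (\<lambda>x. step_at \<sigma> \<delta> x * g x)"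
      by (rule smooth_on_cong[OF oT smooth_on_const[of _ 0]]) (simp add: step_at_eq_0 assms)
  qed
  moreover have "hs \<sigma> d \<union> ?T = UNIV" using assms by (auto simp: hs_def)
  ultimately show ?thesis by simp
qed

lemma pd_cut:
  assumes "\<sigma> = 1 \<or> \<sigma> = -1" "smooth_on (hs \<sigma> d) g" "0 < \<delta>" "\<delta> < d"
  shows "pd j (\<lambda>x. step_at \<sigma> \<delta> x * g x) x = step_at \<sigma> \<delta> x * pd j g x + (if j = 3 then \<sigma> * slab \<delta> x else 0) * g x"
proof (cases "x \<in> hs \<sigma> d")
  case True
  then show ?thesis
    using pd_step_at[OF assms(1)] smooth_on_differentiable[OF assms(2)] smooth_on_differentiable[OF smooth_on_step_at]
    by (simp add: pd_mult)
next
  case False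
  let ?T = "{x::real^3. \<sigma> * x $ 3 < - \<delta>}"
  have oT: "open ?T" by (intro open_Collect_less continuous_intros)
  have x: "x \<in> ?T" using False assms(4) by (simp add: hs_def)
  have "pd j (\<lambda>x. step_at \<sigma> \<delta> x * g x) x = pd j (\<lambda>x. 0) x"
    by (rule pd_cong[OF oT x]) (simp add: step_at_eq_0 assms)
  moreover have "slab \<delta> x = 0" using x assms(1,3) by (intro slab_eq_0) auto
  moreover have "step_at \<sigma> \<delta> x = 0" using x assms(3) by (intro step_at_eq_0) auto
  ultimately show ?thesis by simp
qed

section \<open>Limits of integrals against a locally integrable weight\<close>

lemma integrable_locally_L1_mult:
  fixes w h :: "real^3 \<Rightarrow> real"
  assumes "locally_L1 w" "h \<in> borel_measurable lebesgue" "compact K" "\<And>x. x \<notin> K \<Longrightarrow> h x = 0" "\<And>x. x \<in> K \<Longrightarrow> \<bar>h x\<bar> \<le> B"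
  shows "integrable lebesgue (\<lambda>x. w x * h x)"
proof -
  have i: "integrable lebesgue (\<lambda>x. indicator K x *\<^sub>R w x)"
    using assms(1,3) unfolding locally_L1_def set_integrable_def by blast
  have "integrable lebesgue (\<lambda>x. h x *\<^sub>R (indicator K x *\<^sub>R w x))"
  proof (rule Bochner_Integration.integrable_bound[OF integrable_mult_right[OF i, of "B"]])
    show "(\<lambda>x. h x *\<^sub>R (indicator K x *\<^sub>R w x)) \<in> borel_measurable lebesgue"
      by (rule borel_measurable_scaleR[OF assms(2) borel_measurable_integrable[OF i]])
    show "AE x in lebesgue. norm (h x *\<^sub>R (indicator K x *\<^sub>R w x)) \<le> norm (B * indicator K x *\<^sub>R w x)"
    proof (intro AE_I2)
      fix x
      show "norm (h x *\<^sub>R (indicator K x *\<^sub>R w x)) \<le> norm (B * indicator K x *\<^sub>R w x)"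
      proof (cases "x \<in> K")
        case True
        then have "\<bar>h x\<bar> \<le> \<bar>B\<bar>" using assms(5)[OF True] by linarith
        then show ?thesis using True by (simp add: abs_mult mult_right_mono)
      qed simp
    qed
  qed
  moreover have "(\<lambda>x. h x *\<^sub>R (indicator K x *\<^sub>R w x)) = (\<lambda>x. w x * h x)"
    using assms(4) by (auto simp: fun_eq_iff indicator_def)
  ultimately show ?thesis by simp
qed

lemma integrable_locally_L1_mult_continuous:
  fixes w h :: "real^3 \<Rightarrow> real"
  assumes "locally_L1 w" "continuous_on UNIV h" "compact K" "\<And>x. x \<notin> K \<Longrightarrow> h x = 0"
  shows "integrable lebesgue (\<lambda>x. w x * h x)"
proof -
  have "bounded (h ` K)"
    by (intro compact_imp_bounded compact_continuous_image continuous_on_subset[OF assms(2)] assms) auto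
  then obtain B where "\<And>x. x \<in> K \<Longrightarrow> \<bar>h x\<bar> \<le> B" unfolding bounded_iff by auto
  then show ?thesis
    using assms by (intro integrable_locally_L1_mult[of w h K B] continuous_imp_measurable_on_sets_lebesgue)
      (auto simp: borel_measurable_continuous_onI measurable_completion)
qed

lemma negligible_plane: "negligible {x::real^3. x $ 3 = 0}"
  by (rule negligible_standard_hyperplane_cart)

lemma AE_off_plane: "AE x in lebesgue. (x::real^3) $ 3 \<noteq> 0"
proof -
  have "{x::real^3. x $ 3 = 0} \<in> null_sets lebesgue"
    using negligible_plane by (simp add: negligible_iff_null_sets)
  then show ?thesis by (rule AE_I') auto
qed

text \<open>Uniform bounds on a common compact support supply the majorant, and the plane is a null
  set, so convergence off it is enough.\<close>

lemma locally_L1_dominated_convergence: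
  fixes w :: "real^3 \<Rightarrow> real" and f :: "nat \<Rightarrow> real^3 \<Rightarrow> real"
  assumes "locally_L1 w" "compact K" "\<And>n. continuous_on UNIV (f n)"
    "\<And>n x. x \<notin> K \<Longrightarrow> f n x = 0" "\<And>n x. x \<in> K \<Longrightarrow> \<bar>f n x\<bar> \<le> B"
    "\<And>x. x $ 3 \<noteq> 0 \<Longrightarrow> (\<lambda>n. f n x) \<longlonglongrightarrow> g x"
    "g \<in> borel_measurable lebesgue"
  shows "(\<lambda>n. integral\<^sup>L lebesgue (\<lambda>x. w x * f n x)) \<longlonglongrightarrow> integral\<^sup>L lebesgue (\<lambda>x. w x * g x)"
    and "integrable lebesgue (\<lambda>x. w x * g x)"
proof -
  \<comment> \<open>Off the plane \<open>g\<close> inherits the bound and the support of the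
    \<open>f n\<close>; on the plane it is unconstrained, so it is replaced by 0 there to obtain
    integrability.\<close>
  define g' where "g' x = (if x $ 3 = 0 then 0 else g x)" for x :: "real^3"
  have ig: "integrable lebesgue (\<lambda>x. indicator K x *\<^sub>R w x)"
    using assms(1,2) unfolding locally_L1_def set_integrable_def by blast
  have m': "g' \<in> borel_measurable lebesgue"
  proof -
    have "{x::real^3. x $ 3 = 0} \<in> sets lebesgue"
      by (rule negligible_imp_sets[OF negligible_plane])
    then have "{x \<in> space lebesgue. (x::real^3) $ 3 = 0} \<in> sets lebesgue" by simp
    then show ?thesis unfolding g'_def[abs_def] by (intro measurable_If assms(7) measurable_const) auto
  qed
  have b': "\<bar>g' x\<bar> \<le> \<bar>B\<bar>" for x
  proof (cases "x $ 3 = 0")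
    case False
    have "\<bar>f n x\<bar> \<le> \<bar>B\<bar>" for n using assms(4)[of x n] assms(5)[of x n] by (cases "x \<in> K") auto
    then have "\<bar>g x\<bar> \<le> \<bar>B\<bar>" using tendsto_rabs[OF assms(6)[OF False]] by (intro LIMSEQ_le_const2) auto
    then show ?thesis using False by (simp add: g'_def)
  qed (simp add: g'_def)
  have z': "g' x = 0" if "x \<notin> K" for x
    using assms(4)[OF that] assms(6)[of x] LIMSEQ_unique[of "\<lambda>n. 0" 0 "g x"] by (auto simp: g'_def)
  have i': "integrable lebesgue (\<lambda>x. w x * g' x)"
    using integrable_locally_L1_mult[OF assms(1) m' assms(2) z' b'] .
  have ae: "AE x in lebesgue. w x * g' x = w x * g x"
    using AE_off_plane by eventually_elim (simp add: g'_def)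
  \<comment> \<open>Local integrability gives measurability of the truncations to compact sets;
    exhausting by balls recovers it for \<open>w\<close>.\<close>
  have wb: "w \<in> borel_measurable lebesgue"
  proof (rule borel_measurable_LIMSEQ_real)
    show "(\<lambda>x. indicator (cball 0 (real n)) x *\<^sub>R w x) \<in> borel_measurable lebesgue" for n
      using assms(1) unfolding locally_L1_def set_integrable_def by (meson borel_measurable_integrable compact_cball)
    show "(\<lambda>n. indicator (cball 0 (real n)) x *\<^sub>R w x) \<longlonglongrightarrow> w x" for x
    proof (rule Lim_transform_eventually[OF tendsto_const])
      obtain N where "norm x \<le> real N" using real_arch_simple by blast
      then show "\<forall>\<^sub>F n in sequentially. w x = indicator (cball 0 (real n)) x *\<^sub>R w x"
        by (intro eventually_sequentiallyI[of N]) (simp add: indicator_def)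
    qed
  qed
  have mg: "(\<lambda>x. w x * g x) \<in> borel_measurable lebesgue"
    using wb assms(7) by (rule borel_measurable_times)
  show "integrable lebesgue (\<lambda>x. w x * g x)"
    using i' ae mg by (simp add: integrable_cong_AE[OF borel_measurable_integrable[OF i'] mg ae])
  show "(\<lambda>n. integral\<^sup>L lebesgue (\<lambda>x. w x * f n x)) \<longlonglongrightarrow> integral\<^sup>L lebesgue (\<lambda>x. w x * g x)"
  proof (rule integral_dominated_convergence[where w = "\<lambda>x. \<bar>B\<bar> * norm (indicator K x *\<^sub>R w x)"])
    show "(\<lambda>x. w x * f n x) \<in> borel_measurable lebesgue" for n
      by (rule borel_measurable_integrable[OF integrable_locally_L1_mult_continuous[OF assms(1,3,2,4)]])
    show "integrable lebesgue (\<lambda>x. \<bar>B\<bar> * norm (indicator K x *\<^sub>R w x))"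
      by (intro integrable_mult_right integrable_norm ig)
    show "AE x in lebesgue. (\<lambda>n. w x * f n x) \<longlonglongrightarrow> w x * g x"
      using AE_off_plane by eventually_elim (intro tendsto_mult tendsto_const assms(6))
    show "AE x in lebesgue. norm (w x * f n x) \<le> \<bar>B\<bar> * norm (indicator K x *\<^sub>R w x)" for n
    proof (intro AE_I2)
      fix x
      show "norm (w x * f n x) \<le> \<bar>B\<bar> * norm (indicator K x *\<^sub>R w x)"
      proof (cases "x \<in> K")
        case True
        then have "\<bar>f n x\<bar> \<le> \<bar>B\<bar>" using assms(5)[OF True, of n] by linarith
        then show ?thesis using True by (simp add: abs_mult mult.commute[of "\<bar>w x\<bar>"] mult_right_mono)
      qed (simp add: assms(4))
    qed
  qed (rule mg)
qed

lemma pd_line: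
  assumes "f differentiable (at (p + s *\<^sub>R axis i 1))"
  shows "((\<lambda>s. f (p + s *\<^sub>R axis i 1)) has_real_derivative pd i f (p + s *\<^sub>R axis i 1)) (at s)"
  unfolding pd_def by (rule DERIV_along_line[OF assms])

text \<open>Integral of w g over the open half-space of sign \<sigma>. The indicator is attached to
  \<open>g\<close>, whose values on the other side are arbitrary.\<close>

definition HI :: "real \<Rightarrow> (real^3 \<Rightarrow> real) \<Rightarrow> (real^3 \<Rightarrow> real) \<Rightarrow> real" where
  "HI \<sigma> w g = integral\<^sup>L lebesgue (\<lambda>x. w x * (indicator (hs \<sigma> 0) x * g x))"

lemma compact_Int_hs_closed: "compact K \<Longrightarrow> compact (K \<inter> {x::real^3. c \<le> \<sigma> * x $ 3})"
  by (intro compact_Int_closed closed_Collect_le continuous_intros)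

lemma compact_Int_strip: "compact K \<Longrightarrow> compact (K \<inter> {x::real^3. \<bar>x $ 3\<bar> \<le> c})"
  by (intro compact_Int_closed closed_Collect_le continuous_intros)

lemma continuous_on_bounded_abs:
  fixes g :: "'a::topological_space \<Rightarrow> real"
  assumes "compact K" "continuous_on K g" obtains B where "B > 0" "\<And>x. x \<in> K \<Longrightarrow> \<bar>g x\<bar> \<le> B"
proof -
  have "bounded (g ` K)" by (intro compact_imp_bounded compact_continuous_image assms)
  then show ?thesis using that unfolding bounded_pos by auto
qed

lemma shrink_limit: "(\<lambda>n. d / (real n + 2)) \<longlonglongrightarrow> (0::real)"
proof -
  have "(\<lambda>n. d * inverse (real (n + 2))) \<longlonglongrightarrow> d * 0"
    by (intro tendsto_mult tendsto_const LIMSEQ_ignore_initial_segment lim_inverse_n)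
  then show ?thesis by (simp add: field_class.field_divide_inverse add.commute)
qed

text \<open>The widths d/(n+2) stay at most d/2, so the supports of the steps keep a closed margin
  inside \<open>hs \<sigma> d\<close>.\<close>

lemma shrink_bounds:
  assumes "0 < (d::real)"
  shows "0 < d / (real n + 2)" "d / (real n + 2) \<le> d / 2" "d / (real n + 2) < d"
proof -
  show 1: "0 < d / (real n + 2)" using assms by simp
  show 2: "d / (real n + 2) \<le> d / 2" using assms by (intro divide_left_mono) auto
  show "d / (real n + 2) < d" using 2 assms by linarith
qed

lemma abs_slab_le:
  assumes "\<And>t. \<bar>deriv sstep t\<bar> \<le> M" "0 < e"
  shows "\<bar>slab e x\<bar> \<le> M / (2 * e)"
proof -
  have "\<bar>slab e x\<bar> = \<bar>deriv sstep ((x $ 3 / e + 1) / 2)\<bar> / (2 * e)"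
    using assms(2) by (simp add: slab_def abs_divide)
  also have "\<dots> \<le> M / (2 * e)" using assms by (intro divide_right_mono) auto
  finally show ?thesis .
qed

lemma step_at_limit:
  assumes "\<sigma> = 1 \<or> \<sigma> = -1" "x $ 3 \<noteq> 0" "d > 0"
  shows "(\<lambda>n. step_at \<sigma> (d / (real n + 2)) x) \<longlonglongrightarrow> indicator (hs \<sigma> 0) x"
proof (rule Lim_transform_eventually[OF tendsto_const])
  have "(\<lambda>n. d / (real n + 2)) \<longlonglongrightarrow> 0" by (rule shrink_limit)
  then have "\<forall>\<^sub>F n in sequentially. d / (real n + 2) < \<bar>x $ 3\<bar>"
    using assms(2) by (intro order_tendstoD) auto
  then show "\<forall>\<^sub>F n in sequentially. indicator (hs \<sigma> 0) x = step_at \<sigma> (d / (real n + 2)) x"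
  proof eventually_elim
    case (elim n)
    have "0 < d / (real n + 2)" using assms(3) by simp
    then show ?case
      using elim assms(1) step_at_eq_0[of "d / (real n + 2)" \<sigma> x] step_at_eq_1[of "d / (real n + 2)" \<sigma> x]
      by (auto simp: hs_def indicator_def)
  qed
qed

lemma borel_measurable_indicator_hs:
  assumes "continuous_on (hs \<sigma> d) g" "d > 0"
  shows "(\<lambda>x. indicator (hs \<sigma> 0) x * g x :: real) \<in> borel_measurable lebesgue"
proof -
  have "(\<lambda>x. indicator (hs \<sigma> 0) x *\<^sub>R g x) \<in> borel_measurable borel"
  proof (rule borel_measurable_continuous_on_indicator)
    show "hs \<sigma> 0 \<in> sets borel" by simp
    show "continuous_on (hs \<sigma> 0) g"
      by (rule continuous_on_subset[OF assms(1)]) (use assms(2) in \<open>auto simp: hs_def\<close>)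
  qed
  then show ?thesis by (simp add: measurable_completion)
qed

text \<open>Replacing the sharp cut along the plane by smooth steps costs nothing in the limit: the
  products stay bounded on a fixed compact set and converge off the plane.\<close>

lemma cut_limit:
  assumes s: "\<sigma> = 1 \<or> \<sigma> = -1" and w: "locally_L1 w" and g: "continuous_on (hs \<sigma> d) g"
    and K: "compact K" "\<And>x. x \<notin> K \<Longrightarrow> g x = 0" and d: "d > 0"
  shows "(\<lambda>n. integral\<^sup>L lebesgue (\<lambda>x. w x * (step_at \<sigma> (d / (real n + 2)) x * g x))) \<longlonglongrightarrow> HI \<sigma> w g"
    and "integrable lebesgue (\<lambda>x. w x * (indicator (hs \<sigma> 0) x * g x))"
    and "integrable lebesgue (\<lambda>x. w x * (step_at \<sigma> (d / (real n + 2)) x * g x))"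
proof -
  \<comment> \<open>Continuity on the open set \<open>hs \<sigma> d\<close> bounds \<open>g\<close>
    only on compact subsets; the steps vanish below signed height -d/2, so this subset
    suffices.\<close>
  define K2 where "K2 = K \<inter> {x. - d / 2 \<le> \<sigma> * x $ 3}"
  have K2: "compact K2" unfolding K2_def by (rule compact_Int_hs_closed[OF K(1)])
  have "continuous_on K2 g"
    by (rule continuous_on_subset[OF g]) (use d in \<open>auto simp: K2_def hs_def\<close>)
  then obtain B where B: "B > 0" "\<And>x. x \<in> K2 \<Longrightarrow> \<bar>g x\<bar> \<le> B" by (rule continuous_on_bounded_abs[OF K2]) blast
  have dn: "0 < d / (real n + 2)" "d / (real n + 2) \<le> d / 2" "d / (real n + 2) < d" for n
    using shrink_bounds[OF d] by blast+
  have cont: "continuous_on UNIV (\<lambda>x. step_at \<sigma> (d / (real n + 2)) x * g x)" for n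
  proof -
    let ?T = "{x::real^3. \<sigma> * x $ 3 < - (d / (real n + 2))}"
    have oT: "open ?T" by (intro open_Collect_less continuous_intros)
    have "continuous_on (hs \<sigma> d \<union> ?T) (\<lambda>x. step_at \<sigma> (d / (real n + 2)) x * g x)"
    proof (rule continuous_on_open_Un[OF open_hs oT])
      show "continuous_on (hs \<sigma> d) (\<lambda>x. step_at \<sigma> (d / (real n + 2)) x * g x)"
        by (intro continuous_on_mult g continuous_on_subset[OF smooth_on_continuous[OF smooth_on_step_at]]) auto
      show "continuous_on ?T (\<lambda>x. step_at \<sigma> (d / (real n + 2)) x * g x)"
        by (rule continuous_on_cong[THEN iffD1, OF refl _ continuous_on_const[of _ 0]])
           (use step_at_eq_0[OF dn(1)[of n]] in force)
    qed
    moreover have "hs \<sigma> d \<union> ?T = UNIV" using dn(3)[of n] by (auto simp: hs_def)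
    ultimately show ?thesis by simp
  qed
  have b: "\<bar>step_at \<sigma> (d / (real n + 2)) x * g x\<bar> \<le> B" if "x \<in> K" for n x
  proof (cases "x \<in> K2")
    case True
    then have "\<bar>step_at \<sigma> (d / (real n + 2)) x\<bar> * \<bar>g x\<bar> \<le> 1 * B"
      using step_at_bounds[of \<sigma> "d / (real n + 2)" x] B by (intro mult_mono) auto
    then show ?thesis by (simp add: abs_mult)
  next
    case False
    then have "\<sigma> * x $ 3 \<le> - (d / (real n + 2))" using that dn(2)[of n] by (auto simp: K2_def)
    then show ?thesis using step_at_eq_0[OF dn(1)] B(1) by simp
  qed
  have z: "step_at \<sigma> (d / (real n + 2)) x * g x = 0" if "x \<notin> K" for n x using K(2)[OF that] by simp
  have lim: "(\<lambda>n. step_at \<sigma> (d / (real n + 2)) x * g x) \<longlonglongrightarrow> indicator (hs \<sigma> 0) x * g x" if "x $ 3 \<noteq> 0" for x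
    by (intro tendsto_mult tendsto_const step_at_limit s that d)
  note D = locally_L1_dominated_convergence[OF w K(1) cont z b lim borel_measurable_indicator_hs[OF g d]]
  show "(\<lambda>n. integral\<^sup>L lebesgue (\<lambda>x. w x * (step_at \<sigma> (d / (real n + 2)) x * g x))) \<longlonglongrightarrow> HI \<sigma> w g"
    unfolding HI_def by (rule D(1))
  show "integrable lebesgue (\<lambda>x. w x * (indicator (hs \<sigma> 0) x * g x))"
    by (rule D(2))
  show "integrable lebesgue (\<lambda>x. w x * (step_at \<sigma> (d / (real n + 2)) x * g x))"
    by (rule integrable_locally_L1_mult_continuous[OF w cont K(1) z])
qed

lemma slab_mult_continuous:
  assumes "continuous_on {x. \<bar>x $ 3\<bar> < d} D" "0 < \<delta>" "\<delta> < d"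
  shows "continuous_on UNIV (\<lambda>x. slab \<delta> x * D x)"
proof -
  let ?T = "{x::real^3. \<delta> < \<bar>x $ 3\<bar>}" and ?S = "{x::real^3. \<bar>x $ 3\<bar> < d}"
  have o: "open ?T" "open ?S" by (intro open_Collect_less continuous_intros)+
  have "continuous_on (?S \<union> ?T) (\<lambda>x. slab \<delta> x * D x)"
  proof (rule continuous_on_open_Un[OF o(2,1)])
    show "continuous_on ?S (\<lambda>x. slab \<delta> x * D x)"
      by (intro continuous_on_mult assms continuous_on_subset[OF continuous_on_slab]) auto
    show "continuous_on ?T (\<lambda>x. slab \<delta> x * D x)"
      by (rule continuous_on_cong[THEN iffD1, OF refl _ continuous_on_const[of _ 0]])
         (use slab_eq_0[OF assms(2)] in force)
  qed
  moreover have "?S \<union> ?T = UNIV" using assms by auto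
  ultimately show ?thesis by simp
qed

text \<open>The slab has height O(1/\<delta>), but a smooth function vanishing on the plane is
  O(\<delta>) on its support; the product stays bounded while its support shrinks to the null set x3
  = 0. This is why matched fields leave no surface term although \<open>w\<close> need not have a
  trace.\<close>

lemma slab_matched_limit:
  assumes w: "locally_L1 w" and D: "smooth_on {x. \<bar>x $ 3\<bar> < d} D" "\<And>x. x $ 3 = 0 \<Longrightarrow> D x = 0"
    and K: "compact K" "\<And>x. x \<notin> K \<Longrightarrow> D x = 0" and d: "d > 0"
  shows "(\<lambda>n. integral\<^sup>L lebesgue (\<lambda>x. w x * (slab (d / (real n + 2)) x * D x))) \<longlonglongrightarrow> 0"
proof -
  let ?S = "{x::real^3. \<bar>x $ 3\<bar> < d}"
  define K2 where "K2 = K \<inter> {x. \<bar>x $ 3\<bar> \<le> d / 2}"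
  have K2: "compact K2" unfolding K2_def by (rule compact_Int_strip[OF K(1)])
  have "continuous_on K2 (pd 3 D)"
    by (rule continuous_on_subset[OF smooth_on_continuous[OF smooth_on_pd[OF D(1)]]]) (use d in \<open>auto simp: K2_def\<close>)
  then obtain C where C: "C > 0" "\<And>x. x \<in> K2 \<Longrightarrow> \<bar>pd 3 D x\<bar> \<le> C" by (rule continuous_on_bounded_abs[OF K2]) blast
  have C': "\<bar>pd 3 D x\<bar> \<le> C" if "\<bar>x $ 3\<bar> \<le> d / 2" for x
  proof (cases "x \<in> K")
    case False
    have "pd 3 D x = 0" by (rule pd_eq_0_outside[of K D x 3, OF compact_imp_closed[OF K(1)] K(2) False])
    then show ?thesis using C(1) by simp
  next
    case True
    then have "x \<in> K2" using that by (simp add: K2_def)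
    then show ?thesis by (rule C(2))
  qed
  \<comment> \<open>Mean value theorem along the vertical line through \<open>x\<close>, starting at
    the foot point \<open>q\<close> on the plane.\<close>
  have Dbd: "\<bar>D x\<bar> \<le> C * \<bar>x $ 3\<bar>" if x: "\<bar>x $ 3\<bar> \<le> d / 2" for x
  proof -
    define q where "q = x - (x $ 3) *\<^sub>R axis 3 1"
    have rng: "t \<in> {- d / 2..d / 2} \<longleftrightarrow> \<bar>t\<bar> \<le> d / 2" for t
      unfolding atLeastAtMost_iff by linarith
    have q3: "(q + t *\<^sub>R axis 3 1) $ 3 = t" for t by (simp add: q_def axis_def)
    have der: "((\<lambda>s. D (q + s *\<^sub>R axis 3 1)) has_real_derivative pd 3 D (q + t *\<^sub>R axis 3 1)) (at t)" if "\<bar>t\<bar> \<le> d / 2" for t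
    proof (rule pd_line[OF smooth_on_differentiable[OF D(1)]])
      show "q + t *\<^sub>R axis 3 1 \<in> {x. \<bar>x $ 3\<bar> < d}" unfolding mem_Collect_eq q3 using that d by linarith
    qed
    have "norm (D (q + (x $ 3) *\<^sub>R axis 3 1) - D (q + 0 *\<^sub>R axis 3 1)) \<le> C * norm (x $ 3 - 0)"
    proof (rule field_differentiable_bound[of "{- d / 2..d / 2}"])
      show "((\<lambda>s. D (q + s *\<^sub>R axis 3 1)) has_field_derivative pd 3 D (q + t *\<^sub>R axis 3 1)) (at t within {- d / 2..d / 2})"
        if "t \<in> {- d / 2..d / 2}" for t
        using that unfolding rng by (rule has_field_derivative_at_within[OF der])
      show "norm (pd 3 D (q + t *\<^sub>R axis 3 1)) \<le> C" if "t \<in> {- d / 2..d / 2}" for t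
      proof -
        have "\<bar>(q + t *\<^sub>R axis 3 1) $ 3\<bar> \<le> d / 2" using that unfolding q3 rng .
        then show ?thesis unfolding real_norm_def by (rule C')
      qed
      show "x $ 3 \<in> {- d / 2..d / 2}" using x unfolding rng .
      show "0 \<in> {- d / 2..d / 2}" using d unfolding rng by simp
    qed simp
    moreover have "D (q + 0 *\<^sub>R axis 3 1) = 0" using q3[of 0] by (intro D(2)) simp
    moreover have "q + (x $ 3) *\<^sub>R axis 3 1 = x" by (simp add: q_def)
    ultimately show ?thesis by simp
  qed
  obtain M where M: "M > 0" "\<And>t. \<bar>deriv sstep t\<bar> \<le> M" using deriv_sstep_bounded by blast
  have dn: "0 < d / (real n + 2)" "d / (real n + 2) \<le> d / 2" "d / (real n + 2) < d" for n
    using shrink_bounds[OF d] by blast+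
  have b: "\<bar>slab (d / (real n + 2)) x * D x\<bar> \<le> M * C" for n x
  proof (cases "d / (real n + 2) < \<bar>x $ 3\<bar>")
    case True
    then show ?thesis using slab_eq_0[OF dn(1) True] M C by simp
  next
    case False
    define e where "e = d / (real n + 2)"
    have e: "0 < e" "\<bar>x $ 3\<bar> \<le> e" "e \<le> d / 2" using dn(1,2)[of n] False by (simp_all add: e_def)
    have "\<bar>slab e x\<bar> \<le> M / (2 * e)" by (rule abs_slab_le[OF M(2) e(1)])
    also have "\<dots> \<le> M / e" using M(1) e(1) by (intro divide_left_mono mult_pos_pos) auto
    finally have 1: "\<bar>slab e x\<bar> \<le> M / e" .
    have "\<bar>D x\<bar> \<le> C * \<bar>x $ 3\<bar>" using e by (intro Dbd) linarith
    also have "\<dots> \<le> C * e" using e C by (intro mult_left_mono) auto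
    finally have "\<bar>slab e x\<bar> * \<bar>D x\<bar> \<le> (M / e) * (C * e)"
      using 1 M e by (intro mult_mono) auto
    also have "\<dots> = M * C" using e(1) by simp
    finally have "\<bar>slab e x\<bar> * \<bar>D x\<bar> \<le> M * C" .
    then show ?thesis by (simp add: abs_mult e_def)
  qed
  have lim: "(\<lambda>n. slab (d / (real n + 2)) x * D x) \<longlonglongrightarrow> 0" if "x $ 3 \<noteq> 0" for x
  proof (rule Lim_transform_eventually[OF tendsto_const])
    have "(\<lambda>n. d / (real n + 2)) \<longlonglongrightarrow> 0" by (rule shrink_limit)
    then have "\<forall>\<^sub>F n in sequentially. d / (real n + 2) < \<bar>x $ 3\<bar>"
      using that by (intro order_tendstoD) auto
    then show "\<forall>\<^sub>F n in sequentially. 0 = slab (d / (real n + 2)) x * D x"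
      by eventually_elim (use slab_eq_0[OF dn(1)] in simp)
  qed
  have "(\<lambda>n. integral\<^sup>L lebesgue (\<lambda>x. w x * (slab (d / (real n + 2)) x * D x))) \<longlonglongrightarrow> integral\<^sup>L lebesgue (\<lambda>x. w x * 0)"
    by (rule locally_L1_dominated_convergence(1)[OF w K(1) slab_mult_continuous[OF smooth_on_continuous[OF D(1)] dn(1,3)] _ b lim])
       (use K(2) in simp_all)
  then show ?thesis by simp
qed

lemma slab_integrable:
  assumes "locally_L1 w" "continuous_on {x. \<bar>x $ 3\<bar> < d} g" "compact K" "\<And>x. x \<notin> K \<Longrightarrow> g x = 0" "0 < \<delta>" "\<delta> < d"
  shows "integrable lebesgue (\<lambda>x. w x * (slab \<delta> x * g x))"
  by (rule integrable_locally_L1_mult_continuous[OF assms(1) slab_mult_continuous[OF assms(2,5,6)] assms(3)])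
     (simp add: assms(4))

section \<open>Weak solutions tested against piecewise smooth fields\<close>

lemma abs_integral_le_box:
  fixes f :: "real^3 \<Rightarrow> real"
  assumes "integrable lebesgue f" "0 \<le> c" "\<And>i. a $ i \<le> b $ i" "\<And>x. \<bar>f x\<bar> \<le> c * indicator (cbox a b) x"
  shows "\<bar>integral\<^sup>L lebesgue f\<bar> \<le> c * ((b $ 1 - a $ 1) * (b $ 2 - a $ 2) * (b $ 3 - a $ 3))"
proof -
  have "cbox a b \<in> lmeasurable" by simp
  then have ind: "integrable lebesgue (indicator (cbox a b) :: real^3 \<Rightarrow> real)"
    by (rule lmeasurable_iff_integrable[THEN iffD1])
  have "\<bar>integral\<^sup>L lebesgue f\<bar> \<le> integral\<^sup>L lebesgue (\<lambda>x. \<bar>f x\<bar>)"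
    using integral_norm_bound[of lebesgue f] by simp
  also have "\<dots> \<le> integral\<^sup>L lebesgue (\<lambda>x. c * indicator (cbox a b) x)"
    by (rule integral_mono[OF integrable_abs[OF assms(1)] integrable_mult_right[OF ind] assms(4)])
  also have "\<dots> = c * integral\<^sup>L lebesgue (indicator (cbox a b))"
    by (rule integral_mult_right_zero)
  also have "integral\<^sup>L lebesgue (indicator (cbox a b) :: real^3 \<Rightarrow> real) = measure lebesgue (cbox a b)"
    by simp
  also have "measure lebesgue (cbox a b) = (\<Prod>i\<in>UNIV. b $ i - a $ i)"
  proof -
    have "a \<in> cbox a b" using assms(3) by (simp add: mem_box_cart)
    then have "cbox a b \<noteq> {}" by blast
    then have "measure lborel (cbox a b) = (\<Prod>i\<in>UNIV. b $ i - a $ i)" by (rule content_cbox_cart)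
    moreover have "measure lebesgue (cbox a b) = measure lborel (cbox a b)" by (rule measure_completion) simp
    ultimately show ?thesis by simp
  qed
  also have "\<dots> = (b $ 1 - a $ 1) * (b $ 2 - a $ 2) * (b $ 3 - a $ 3)"
    unfolding UNIV_3 by simp
  finally show ?thesis .
qed

text \<open>The weak problem in components: \<open>G\<close> is the weak gradient of
  \<open>u\<close> and \<open>W\<close> the stress. The constitutive law enters only in
  \<open>green_identity\<close>; up to there \<open>W\<close> is any locally integrable matrix field
  satisfying the equation.\<close>

locale weak_solution =
  fixes u :: "3 \<Rightarrow> real^3 \<Rightarrow> real" and G W :: "3 \<Rightarrow> 3 \<Rightarrow> real^3 \<Rightarrow> real" and l y :: "real^3"
  assumes Lu: "locally_L1 (u i)" and LG: "locally_L1 (G i j)" and LW: "locally_L1 (W i j)"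
    and weak_grad: "test_function \<phi> \<Longrightarrow>
      integral\<^sup>L lebesgue (\<lambda>x. u i x * pd j \<phi> x) = - integral\<^sup>L lebesgue (\<lambda>x. G i j x * \<phi> x)"
    and weak_eq: "test_function \<phi> \<Longrightarrow>
      integral\<^sup>L lebesgue (\<lambda>x. \<Sum>j\<in>UNIV. W i j x * pd j \<phi> x) = l $ i * \<phi> y"
begin

text \<open>Testing the weak gradient with step times \<open>g\<close> leaves, as the step sharpens,
  integrals over the half-space plus the slab term. The limit of the slab term is thus a one-sided
  trace of \<open>u\<close>, whose existence follows from the identity itself. In tangential
  directions the step contributes no derivative, hence no boundary term.\<close>

lemma one_sided:
  assumes s: "\<sigma> = 1 \<or> \<sigma> = -1" and g: "smooth_on (hs \<sigma> d) g"
    and K: "compact K" "\<And>x. x \<notin> K \<Longrightarrow> g x = 0" and d: "d > 0"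
  shows "(\<lambda>n. integral\<^sup>L lebesgue (\<lambda>x. u i x * (slab (d / (real n + 2)) x * g x)))
      \<longlonglongrightarrow> - \<sigma> * (HI \<sigma> (G i 3) g + HI \<sigma> (u i) (pd 3 g))"
    and "j \<noteq> 3 \<Longrightarrow> HI \<sigma> (G i j) g + HI \<sigma> (u i) (pd j g) = 0"
proof -
  note dn = shrink_bounds[OF d]
  have gz: "pd j g x = 0" if "x \<notin> K" for x j
    by (rule pd_eq_0_outside[of K g x j, OF compact_imp_closed[OF K(1)] K(2) that])
  have gc: "continuous_on (hs \<sigma> d) g" by (rule smooth_on_continuous[OF g])
  have pc: "continuous_on (hs \<sigma> d) (pd j g)" for j by (rule smooth_on_continuous[OF smooth_on_pd[OF g]])
  have sub: "{x. \<bar>x $ 3\<bar> < d} \<subseteq> hs \<sigma> d" using s by (auto simp: hs_def)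
  have test: "test_function (\<lambda>x. step_at \<sigma> (d / (real n + 2)) x * g x)" for n
    by (rule test_functionI[OF cut_smooth[OF g dn(1,3)] K(1)]) (simp add: K)
  let ?S = "\<lambda>n x. step_at \<sigma> (d / (real n + 2)) x"
  have id: "integral\<^sup>L lebesgue (\<lambda>x. u i x * (?S n x * pd j g x)) +
      (if j = 3 then \<sigma> else 0) * integral\<^sup>L lebesgue (\<lambda>x. u i x * (slab (d / (real n + 2)) x * g x))
      = - integral\<^sup>L lebesgue (\<lambda>x. G i j x * (?S n x * g x))" for n j
  proof -
    have i1: "integrable lebesgue (\<lambda>x. u i x * (?S n x * pd j g x))"
      by (rule cut_limit(3)[OF s Lu pc K(1) gz d])
    have i2: "integrable lebesgue (\<lambda>x. u i x * (slab (d / (real n + 2)) x * g x))"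
      by (rule slab_integrable[OF Lu continuous_on_subset[OF gc sub] K dn(1,3)])
    have "integral\<^sup>L lebesgue (\<lambda>x. u i x * pd j (\<lambda>x. ?S n x * g x) x)
        = integral\<^sup>L lebesgue (\<lambda>x. u i x * (?S n x * pd j g x) + (if j = 3 then \<sigma> else 0) * (u i x * (slab (d / (real n + 2)) x * g x)))"
      unfolding pd_cut[OF s g dn(1,3)] by (rule Bochner_Integration.integral_cong) (simp_all add: algebra_simps)
    also have "\<dots> = integral\<^sup>L lebesgue (\<lambda>x. u i x * (?S n x * pd j g x)) +
      (if j = 3 then \<sigma> else 0) * integral\<^sup>L lebesgue (\<lambda>x. u i x * (slab (d / (real n + 2)) x * g x))"
      by (subst Bochner_Integration.integral_add[OF i1 integrable_mult_right[OF i2]]) simp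
    finally show ?thesis using weak_grad[OF test, of i j n] by simp
  qed
  have l1: "(\<lambda>n. integral\<^sup>L lebesgue (\<lambda>x. u i x * (?S n x * pd j g x))) \<longlonglongrightarrow> HI \<sigma> (u i) (pd j g)" for j
    by (rule cut_limit(1)[OF s Lu pc K(1) gz d])
  have l2: "(\<lambda>n. integral\<^sup>L lebesgue (\<lambda>x. G i j x * (?S n x * g x))) \<longlonglongrightarrow> HI \<sigma> (G i j) g" for j
    by (rule cut_limit(1)[OF s LG gc K d])
  show "(\<lambda>n. integral\<^sup>L lebesgue (\<lambda>x. u i x * (slab (d / (real n + 2)) x * g x)))
      \<longlonglongrightarrow> - \<sigma> * (HI \<sigma> (G i 3) g + HI \<sigma> (u i) (pd 3 g))"
  proof -
    have "integral\<^sup>L lebesgue (\<lambda>x. u i x * (slab (d / (real n + 2)) x * g x)) =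
       - \<sigma> * (integral\<^sup>L lebesgue (\<lambda>x. G i 3 x * (?S n x * g x)) + integral\<^sup>L lebesgue (\<lambda>x. u i x * (?S n x * pd 3 g x)))" for n
      using id[of n 3] s by auto
    then show ?thesis by (simp only:) (intro tendsto_mult tendsto_add tendsto_const l1 l2)
  qed
  show "HI \<sigma> (G i j) g + HI \<sigma> (u i) (pd j g) = 0" if "j \<noteq> 3"
  proof -
    have "(\<lambda>n. integral\<^sup>L lebesgue (\<lambda>x. u i x * (?S n x * pd j g x)) + integral\<^sup>L lebesgue (\<lambda>x. G i j x * (?S n x * g x)))
       \<longlonglongrightarrow> HI \<sigma> (u i) (pd j g) + HI \<sigma> (G i j) g" by (intro tendsto_add l1 l2)
    moreover have "(\<lambda>n. integral\<^sup>L lebesgue (\<lambda>x. u i x * (?S n x * pd j g x)) + integral\<^sup>L lebesgue (\<lambda>x. G i j x * (?S n x * g x))) = (\<lambda>n. 0)"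
      using id[of _ j] that by (simp add: fun_eq_iff)
    ultimately have "HI \<sigma> (u i) (pd j g) + HI \<sigma> (G i j) g = 0"
      by (simp only:) (rule LIMSEQ_unique[OF _ tendsto_const])
    then show ?thesis by simp
  qed
qed

text \<open>The one-sided traces of \<open>u\<close> against \<open>g1\<close> and \<open>g2\<close>
  are limits over the same slab, and their difference tests \<open>u\<close> against g1 - g2, which
  vanishes on the plane. Hence integration by parts across the interface has no surface
  term.\<close>

lemma matched:
  assumes g1: "smooth_on (hs 1 d) g1" and g2: "smooth_on (hs (-1) d) g2"
    and m: "\<And>x. x $ 3 = 0 \<Longrightarrow> g1 x = g2 x"
    and K: "compact K" "\<And>x. x \<notin> K \<Longrightarrow> g1 x = 0" "\<And>x. x \<notin> K \<Longrightarrow> g2 x = 0" and d: "d > 0"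
  shows "HI 1 (G i 3) g1 + HI (-1) (G i 3) g2 = - (HI 1 (u i) (pd 3 g1) + HI (-1) (u i) (pd 3 g2))"
proof -
  note dn = shrink_bounds[OF d]
  let ?T = "{x::real^3. \<bar>x $ 3\<bar> < d}"
  have oT: "open ?T" by (intro open_Collect_less continuous_intros)
  have sub: "?T \<subseteq> hs 1 d" "?T \<subseteq> hs (-1) d" by (auto simp: hs_def)
  have D: "smooth_on ?T (\<lambda>x. g1 x - g2 x)"
    by (intro smooth_on_diff oT smooth_on_subset[OF g1 sub(1)] smooth_on_subset[OF g2 sub(2)])
  have L: "(\<lambda>n. integral\<^sup>L lebesgue (\<lambda>x. u i x * (slab (d / (real n + 2)) x * (g1 x - g2 x)))) \<longlonglongrightarrow> 0"
    by (rule slab_matched_limit[OF Lu D _ K(1) _ d]) (simp_all add: m K)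
  have i1: "integrable lebesgue (\<lambda>x. u i x * (slab (d / (real n + 2)) x * g1 x))" for n
    by (rule slab_integrable[OF Lu continuous_on_subset[OF smooth_on_continuous[OF g1] sub(1)] K(1,2) dn(1,3)])
  have i2: "integrable lebesgue (\<lambda>x. u i x * (slab (d / (real n + 2)) x * g2 x))" for n
    by (rule slab_integrable[OF Lu continuous_on_subset[OF smooth_on_continuous[OF g2] sub(2)] K(1,3) dn(1,3)])
  have "integral\<^sup>L lebesgue (\<lambda>x. u i x * (slab (d / (real n + 2)) x * (g1 x - g2 x))) =
     integral\<^sup>L lebesgue (\<lambda>x. u i x * (slab (d / (real n + 2)) x * g1 x)) -
     integral\<^sup>L lebesgue (\<lambda>x. u i x * (slab (d / (real n + 2)) x * g2 x))" for n
    by (subst Bochner_Integration.integral_diff[OF i1 i2, symmetric]) (simp add: algebra_simps)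
  then have "(\<lambda>n. integral\<^sup>L lebesgue (\<lambda>x. u i x * (slab (d / (real n + 2)) x * (g1 x - g2 x))))
     \<longlonglongrightarrow> - 1 * (HI 1 (G i 3) g1 + HI 1 (u i) (pd 3 g1)) - - (-1) * (HI (-1) (G i 3) g2 + HI (-1) (u i) (pd 3 g2))"
    by (simp only:) (intro tendsto_diff one_sided(1)[OF _ g1 K(1,2) d] one_sided(1)[OF _ g2 K(1,3) d]; simp)
  from LIMSEQ_unique[OF L this] show ?thesis by simp
qed

text \<open>Complementary steps glue \<open>g1\<close> and \<open>g2\<close> into one smooth test
  function. Its normal derivative has the additional term slab times (g1 - g2), which disappears in
  the limit although \<open>W\<close> is merely locally integrable.\<close>

lemma equation_pair:
  assumes g1: "smooth_on (hs 1 d) g1" and g2: "smooth_on (hs (-1) d) g2"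
    and m: "\<And>x. x $ 3 = 0 \<Longrightarrow> g1 x = g2 x"
    and K: "compact K" "\<And>x. x \<notin> K \<Longrightarrow> g1 x = 0" "\<And>x. x \<notin> K \<Longrightarrow> g2 x = 0" and d: "d > 0" and y: "y $ 3 > 0"
  shows "(\<Sum>j\<in>UNIV. HI 1 (W i j) (pd j g1) + HI (-1) (W i j) (pd j g2)) = l $ i * g1 y"
proof -
  note dn = shrink_bounds[OF d]
  let ?T = "{x::real^3. \<bar>x $ 3\<bar> < d}"
  let ?e = "\<lambda>n. d / (real n + 2)"
  have oT: "open ?T" by (intro open_Collect_less continuous_intros)
  have sub: "?T \<subseteq> hs 1 d" "?T \<subseteq> hs (-1) d" by (auto simp: hs_def)
  have D: "smooth_on ?T (\<lambda>x. g1 x - g2 x)"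
    by (intro smooth_on_diff oT smooth_on_subset[OF g1 sub(1)] smooth_on_subset[OF g2 sub(2)])
  have L: "(\<lambda>n. integral\<^sup>L lebesgue (\<lambda>x. W i 3 x * (slab (?e n) x * (g1 x - g2 x)))) \<longlonglongrightarrow> 0"
    by (rule slab_matched_limit[OF LW D _ K(1) _ d]) (simp_all add: m K)
  have z1: "pd j g1 x = 0" if "x \<notin> K" for x j
    by (rule pd_eq_0_outside[of K g1 x j, OF compact_imp_closed[OF K(1)] K(2) that])
  have z2: "pd j g2 x = 0" if "x \<notin> K" for x j
    by (rule pd_eq_0_outside[of K g2 x j, OF compact_imp_closed[OF K(1)] K(3) that])
  have pc1: "continuous_on (hs 1 d) (pd j g1)" for j by (rule smooth_on_continuous[OF smooth_on_pd[OF g1]])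
  have pc2: "continuous_on (hs (-1) d) (pd j g2)" for j by (rule smooth_on_continuous[OF smooth_on_pd[OF g2]])
  have c1: "smooth_on UNIV (\<lambda>x. step_at 1 (?e n) x * g1 x)" for n by (rule cut_smooth[OF g1 dn(1,3)])
  have c2: "smooth_on UNIV (\<lambda>x. step_at (-1) (?e n) x * g2 x)" for n by (rule cut_smooth[OF g2 dn(1,3)])
  define \<phi> where "\<phi> n x = step_at 1 (?e n) x * g1 x + step_at (-1) (?e n) x * g2 x" for n x
  have test: "test_function (\<phi> n)" for n
    unfolding \<phi>_def[abs_def]
    by (rule test_functionI[OF smooth_on_add[OF open_UNIV c1 c2] K(1)]) (simp add: K)
  have pd\<phi>: "pd j (\<phi> n) x = step_at 1 (?e n) x * pd j g1 x + step_at (-1) (?e n) x * pd j g2 x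
      + (if j = 3 then slab (?e n) x * (g1 x - g2 x) else 0)" for j n x
    unfolding \<phi>_def[abs_def]
    by (subst pd_add[OF smooth_on_differentiable[OF c1 UNIV_I] smooth_on_differentiable[OF c2 UNIV_I]],
        subst pd_cut[OF _ g1 dn(1,3)], simp, subst pd_cut[OF _ g2 dn(1,3)], simp)
       (simp add: algebra_simps)
  have i1: "integrable lebesgue (\<lambda>x. W i j x * (step_at 1 (?e n) x * pd j g1 x))" for j n
    by (rule cut_limit(3)[OF _ LW pc1 K(1) z1 d]) simp
  have i2: "integrable lebesgue (\<lambda>x. W i j x * (step_at (-1) (?e n) x * pd j g2 x))" for j n
    by (rule cut_limit(3)[OF _ LW pc2 K(1) z2 d]) simp
  have i3: "integrable lebesgue (\<lambda>x. W i 3 x * (slab (?e n) x * (g1 x - g2 x)))" for n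
    by (rule slab_integrable[OF LW smooth_on_continuous[OF D] K(1) _ dn(1,3)]) (simp add: K)
  have i3': "integrable lebesgue (\<lambda>x. W i j x * (if j = 3 then slab (?e n) x * (g1 x - g2 x) else 0))" for n j
    using i3[of n] by (cases "j = 3") simp_all
  define A where "A n j = integral\<^sup>L lebesgue (\<lambda>x. W i j x * (step_at 1 (?e n) x * pd j g1 x)) +
      integral\<^sup>L lebesgue (\<lambda>x. W i j x * (step_at (-1) (?e n) x * pd j g2 x))" for n j
  have id: "(\<Sum>j\<in>UNIV. A n j) + integral\<^sup>L lebesgue (\<lambda>x. W i 3 x * (slab (?e n) x * (g1 x - g2 x))) = l $ i * \<phi> n y" for n
  proof -
    have "l $ i * \<phi> n y = integral\<^sup>L lebesgue (\<lambda>x. \<Sum>j\<in>UNIV. W i j x * pd j (\<phi> n) x)"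
      using weak_eq[OF test] by simp
    also have "\<dots> = integral\<^sup>L lebesgue (\<lambda>x. \<Sum>j\<in>UNIV. (W i j x * (step_at 1 (?e n) x * pd j g1 x)
       + W i j x * (step_at (-1) (?e n) x * pd j g2 x)) + W i j x * (if j = 3 then slab (?e n) x * (g1 x - g2 x) else 0))"
      by (rule Bochner_Integration.integral_cong) (simp_all only: pd\<phi> distrib_left)
    also have "\<dots> = (\<Sum>j\<in>UNIV. integral\<^sup>L lebesgue (\<lambda>x. (W i j x * (step_at 1 (?e n) x * pd j g1 x)
       + W i j x * (step_at (-1) (?e n) x * pd j g2 x)) + W i j x * (if j = 3 then slab (?e n) x * (g1 x - g2 x) else 0)))"
      by (rule Bochner_Integration.integral_sum) (intro Bochner_Integration.integrable_add i1 i2 i3')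
    also have "\<dots> = (\<Sum>j\<in>UNIV. A n j + integral\<^sup>L lebesgue (\<lambda>x. W i j x * (if j = 3 then slab (?e n) x * (g1 x - g2 x) else 0)))"
      unfolding A_def
      by (rule sum.cong[OF refl], subst Bochner_Integration.integral_add[OF Bochner_Integration.integrable_add[OF i1 i2] i3'],
          subst Bochner_Integration.integral_add[OF i1 i2]) (rule refl)
    also have "\<dots> = (\<Sum>j\<in>UNIV. A n j) + integral\<^sup>L lebesgue (\<lambda>x. W i 3 x * (slab (?e n) x * (g1 x - g2 x)))"
      by (simp add: sum.distrib sum_3)
    finally show ?thesis by simp
  qed
  have lA: "(\<lambda>n. A n j) \<longlonglongrightarrow> HI 1 (W i j) (pd j g1) + HI (-1) (W i j) (pd j g2)" for j
    unfolding A_def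
    by (intro tendsto_add cut_limit(1)[OF _ LW pc1 K(1) z1 d] cut_limit(1)[OF _ LW pc2 K(1) z2 d]) simp_all
  have 1: "(\<lambda>n. l $ i * \<phi> n y) \<longlonglongrightarrow> (\<Sum>j\<in>UNIV. HI 1 (W i j) (pd j g1) + HI (-1) (W i j) (pd j g2)) + 0"
    unfolding id[symmetric] by (intro tendsto_add tendsto_sum lA L)
  \<comment> \<open>\<open>y\<close> lies above the plane, so in the limit the upper step is 1 and
    the lower step is 0 there.\<close>
  have 2: "(\<lambda>n. l $ i * \<phi> n y) \<longlonglongrightarrow> l $ i * (indicator (hs 1 0) y * g1 y + indicator (hs (-1) 0) y * g2 y)"
    unfolding \<phi>_def using y d by (intro tendsto_mult tendsto_add tendsto_const step_at_limit) auto
  show ?thesis using LIMSEQ_unique[OF 1 2] y by (simp add: hs_def indicator_def)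
qed

lemma HI_bound0:
  assumes s: "\<sigma> = 1 \<or> \<sigma> = -1" and h: "continuous_on (hs \<sigma> d) h"
    and K: "compact K" "\<And>x. x \<notin> K \<Longrightarrow> h x = 0" and d: "d > 0"
    and box: "\<And>x. x \<in> K \<Longrightarrow> \<bar>x $ 1 - p\<bar> \<le> 2 * R \<and> \<bar>x $ 2 - q\<bar> \<le> 2 * R \<and> \<bar>x $ 3\<bar> \<le> 2 * R"
    and m: "\<And>x. x \<in> K \<Longrightarrow> \<bar>u i x\<bar> \<le> m" "0 \<le> m" and R: "0 < R"
    and A: "\<And>x. x \<in> K \<Longrightarrow> x \<in> hs \<sigma> d \<Longrightarrow> \<bar>h x\<bar> \<le> A" "0 \<le> A"
  shows "\<bar>HI \<sigma> (u i) h\<bar> \<le> m * (64 * R ^ 3 * A)"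
proof -
  define lo hi where "lo = (vector [p - 2 * R, q - 2 * R, - (2 * R)] :: real^3)"
    and "hi = (vector [p + 2 * R, q + 2 * R, 2 * R] :: real^3)"
  have lohi: "lo $ 1 = p - 2 * R" "lo $ 2 = q - 2 * R" "lo $ 3 = - (2 * R)"
     "hi $ 1 = p + 2 * R" "hi $ 2 = q + 2 * R" "hi $ 3 = 2 * R"
    by (simp_all add: lo_def hi_def)
  have le: "lo $ i \<le> hi $ i" for i
    using R exhaust_3[of i] by (auto simp: lohi)
  have b1: "\<bar>u i x * (indicator (hs \<sigma> 0) x * h x)\<bar> \<le> (m * A) * indicator (cbox lo hi) x" for x
  proof (cases "x \<in> K \<and> x \<in> hs \<sigma> 0")
    case True
    then have hx: "x \<in> hs \<sigma> d" using d by (auto simp: hs_def)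
    have "x \<in> cbox lo hi" using box[of x] True by (auto simp: mem_box_cart forall_3 lohi abs_le_iff)
    moreover have "\<bar>u i x\<bar> * \<bar>h x\<bar> \<le> m * A" using True hx m A by (intro mult_mono) auto
    ultimately show ?thesis using True by (simp add: abs_mult)
  next
    case False
    then have z: "indicator (hs \<sigma> 0) x * h x = 0" using K(2) by (auto simp: indicator_def)
    show ?thesis unfolding z using m(2) A(2) by simp
  qed
  have "\<bar>HI \<sigma> (u i) h\<bar> \<le> (m * A) * ((hi $ 1 - lo $ 1) * (hi $ 2 - lo $ 2) * (hi $ 3 - lo $ 3))"
    unfolding HI_def
    by (rule abs_integral_le_box[OF cut_limit(2)[OF s Lu h K d] _ le b1]) (use m A in auto)
  then show ?thesis by (simp add: lohi power3_eq_cube algebra_simps)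
qed

text \<open>The gradient pairing is bounded by the supremum \<open>m\<close> of |u| alone. By parts
  it becomes the integral of \<open>u\<close> against a derivative of \<open>g\<close>, over a box
  of volume 64 R^3, and for j = 3 also a slab integral, whose height M/(2e) is compensated by the
  thickness 2e of its support, leaving the area 16 R^2.\<close>

lemma HI_bound:
  assumes s: "\<sigma> = 1 \<or> \<sigma> = -1" and g: "smooth_on (hs \<sigma> d) g"
    and K: "compact K" "\<And>x. x \<notin> K \<Longrightarrow> g x = 0" and d: "d > 0"
    and box: "\<And>x. x \<in> K \<Longrightarrow> \<bar>x $ 1 - p\<bar> \<le> 2 * R \<and> \<bar>x $ 2 - q\<bar> \<le> 2 * R \<and> \<bar>x $ 3\<bar> \<le> 2 * R"
    and m: "\<And>x. x \<in> K \<Longrightarrow> \<bar>u i x\<bar> \<le> m" "0 \<le> m" and R: "0 < R"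
    and A: "\<And>x. x \<in> K \<Longrightarrow> x \<in> hs \<sigma> d \<Longrightarrow> \<bar>g x\<bar> \<le> A" "0 \<le> A"
    and A': "\<And>x. x \<in> K \<Longrightarrow> x \<in> hs \<sigma> d \<Longrightarrow> \<bar>pd j g x\<bar> \<le> A'" "0 \<le> A'"
    and M: "\<And>t. \<bar>deriv sstep t\<bar> \<le> M"
  shows "\<bar>HI \<sigma> (G i j) g\<bar> \<le> m * (64 * R ^ 3 * A' + 16 * R\<^sup>2 * M * A)"
proof -
  note dn = shrink_bounds[OF d]
  have M0: "0 \<le> M" using M[of 0] by simp
  have gz: "pd j g x = 0" if "x \<notin> K" for x
    by (rule pd_eq_0_outside[of K g x j, OF compact_imp_closed[OF K(1)] K(2) that])
  have gc: "continuous_on (hs \<sigma> d) g" by (rule smooth_on_continuous[OF g])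
  have pc: "continuous_on (hs \<sigma> d) (pd j g)" by (rule smooth_on_continuous[OF smooth_on_pd[OF g]])
  have sub: "{x. \<bar>x $ 3\<bar> < d} \<subseteq> hs \<sigma> d" using s by (auto simp: hs_def)
  define lo hi where "lo t = (vector [p - 2 * R, q - 2 * R, - t] :: real^3)"
    and "hi t = (vector [p + 2 * R, q + 2 * R, t] :: real^3)" for t
  have lohi: "lo t $ 1 = p - 2 * R" "lo t $ 2 = q - 2 * R" "lo t $ 3 = - t"
     "hi t $ 1 = p + 2 * R" "hi t $ 2 = q + 2 * R" "hi t $ 3 = t" for t
    by (simp_all add: lo_def hi_def)
  have le: "lo t $ i \<le> hi t $ i" if "0 \<le> t" for t i
    using that R exhaust_3[of i] by (auto simp: lohi)
  have inbox: "x \<in> cbox (lo t) (hi t)" if "x \<in> K" "\<bar>x $ 3\<bar> \<le> t" for x t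
    using box[OF that(1)] that(2) by (auto simp: mem_box_cart forall_3 lohi abs_le_iff)
  have 1: "\<bar>HI \<sigma> (u i) (pd j g)\<bar> \<le> m * (64 * R ^ 3 * A')"
    by (rule HI_bound0[OF s pc K(1) gz d box m R A'])
  show "\<bar>HI \<sigma> (G i j) g\<bar> \<le> m * (64 * R ^ 3 * A' + 16 * R\<^sup>2 * M * A)"
  proof (cases "j = 3")
    case False
    then have "HI \<sigma> (G i j) g = - HI \<sigma> (u i) (pd j g)" using one_sided(2)[OF s g K d False, of i] by linarith
    moreover have "0 \<le> m * (16 * R\<^sup>2 * M * A)" using m(2) M0 A(2) by simp
    ultimately show ?thesis using 1 unfolding distrib_left by linarith
  next
    case True
    have sb: "\<bar>integral\<^sup>L lebesgue (\<lambda>x. u i x * (slab e x * g x))\<bar> \<le> m * (16 * R\<^sup>2 * M * A)" if e: "0 < e" "e < d" for e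
    proof -
      have b: "\<bar>u i x * (slab e x * g x)\<bar> \<le> (m * ((M / (2 * e)) * A)) * indicator (cbox (lo e) (hi e)) x" for x
      proof (cases "x \<in> K \<and> \<bar>x $ 3\<bar> \<le> e")
        case T: True
        then have h: "x \<in> hs \<sigma> d" using e sub by auto
        have "\<bar>slab e x\<bar> * \<bar>g x\<bar> \<le> (M / (2 * e)) * A"
          using T h A M0 e by (intro mult_mono abs_slab_le[OF M e(1)]) auto
        then have "\<bar>u i x\<bar> * (\<bar>slab e x\<bar> * \<bar>g x\<bar>) \<le> m * ((M / (2 * e)) * A)"
          using T by (intro mult_mono[OF m(1) _ m(2)]) auto
        then show ?thesis using T inbox[of x e] by (simp add: abs_mult)
      next
        case F: False
        then have z: "slab e x * g x = 0" using K(2)[of x] slab_eq_0[OF e(1), of x] by auto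
        show ?thesis unfolding z using m(2) A(2) M0 e(1) by simp
      qed
      have "\<bar>integral\<^sup>L lebesgue (\<lambda>x. u i x * (slab e x * g x))\<bar> \<le> (m * ((M / (2 * e)) * A)) * ((hi e $ 1 - lo e $ 1) * (hi e $ 2 - lo e $ 2) * (hi e $ 3 - lo e $ 3))"
        by (rule abs_integral_le_box[OF slab_integrable[OF Lu continuous_on_subset[OF gc sub] K e] _ le b])
           (use m A M0 e in auto)
      also have "\<dots> = m * (16 * R\<^sup>2 * M * A)"
        using e(1) by (simp add: lohi power2_eq_square field_simps)
      finally show ?thesis .
    qed
    have "\<bar>- \<sigma> * (HI \<sigma> (G i 3) g + HI \<sigma> (u i) (pd 3 g))\<bar> \<le> m * (16 * R\<^sup>2 * M * A)"
    proof (rule LIMSEQ_le_const2[OF tendsto_rabs[OF one_sided(1)[OF s g K d]]])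
      show "\<exists>N. \<forall>n\<ge>N. \<bar>integral\<^sup>L lebesgue (\<lambda>x. u i x * (slab (d / (real n + 2)) x * g x))\<bar> \<le> m * (16 * R\<^sup>2 * M * A)"
        by (intro exI allI impI sb dn)
    qed
    then have "\<bar>HI \<sigma> (G i 3) g + HI \<sigma> (u i) (pd 3 g)\<bar> \<le> m * (16 * R\<^sup>2 * M * A)"
      using s by (auto simp: abs_mult)
    then show ?thesis using 1 True by (simp add: distrib_left)
  qed
qed

end

section \<open>From the vector formulation to components\<close>

lemma locally_L1_inner: "locally_L1 f \<Longrightarrow> locally_L1 (\<lambda>x. f x \<bullet> b)"
  unfolding locally_L1_def by (blast intro: absolutely_integrable_component)

lemma locally_L1_nth: "locally_L1 (f :: real^3 \<Rightarrow> real^3) \<Longrightarrow> locally_L1 (\<lambda>x. f x $ i)"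
  using locally_L1_inner[of f "axis i 1"] by (simp add: inner_axis)

lemma locally_L1_nth2: "locally_L1 (f :: real^3 \<Rightarrow> real^3^3) \<Longrightarrow> locally_L1 (\<lambda>x. f x $ i $ j)"
  using locally_L1_inner[of f "axis i (axis j 1)"] by (simp add: inner_axis)

lemma locally_L1_add: "locally_L1 f \<Longrightarrow> locally_L1 g \<Longrightarrow> locally_L1 (\<lambda>x. f x + g x)"
  unfolding locally_L1_def by (blast intro: set_integral_add(1))

lemma locally_L1_cmult: "locally_L1 (f :: real^3 \<Rightarrow> real) \<Longrightarrow> locally_L1 (\<lambda>x. c * f x)"
  unfolding locally_L1_def by (auto intro: set_integrable_mult_right)

lemma locally_L1_indicator:
  fixes f :: "real^3 \<Rightarrow> real"
  assumes "locally_L1 f" "S \<in> sets lebesgue" shows "locally_L1 (\<lambda>x. indicator S x * f x)"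
  unfolding locally_L1_def
proof (intro allI impI)
  fix K :: "(real^3) set" assume K: "compact K"
  then have "integrable lebesgue (\<lambda>x. indicator K x *\<^sub>R f x)"
    using assms(1) unfolding locally_L1_def set_integrable_def by blast
  then have "integrable lebesgue (\<lambda>x. indicator S x *\<^sub>R (indicator K x *\<^sub>R f x))"
    by (rule integrable_mult_indicator[OF assms(2)])
  then show "(\<lambda>x. indicator S x * f x) absolutely_integrable_on K"
    unfolding set_integrable_def by (simp add: ac_simps)
qed

lemma elastic_nth:
  "elastic mu lam A $ i $ j = mu * (A $ i $ j + A $ j $ i) + (if i = j then lam * (A $ 1 $ 1 + A $ 2 $ 2 + A $ 3 $ 3) else 0)"
  by (simp add: elastic_def sym_part_def transpose_def trace_def mat_def sum_3)

lemma biphase_nth: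
  "biphase mu_i lam_i mu_e lam_e x A $ i $ j
    = elastic mu_e lam_e A $ i $ j + indicator {z. z $ 3 < 0} x * (elastic mu_i lam_i A $ i $ j - elastic mu_e lam_e A $ i $ j)"
  by (simp add: biphase_def)

lemma locally_L1_elastic:
  fixes G :: "real^3 \<Rightarrow> real^3^3"
  assumes "locally_L1 G" shows "locally_L1 (\<lambda>x. elastic mu lam (G x) $ i $ j)"
proof -
  note G = locally_L1_nth2[OF assms]
  have "locally_L1 (\<lambda>x. mu * (G x $ i $ j + G x $ j $ i) + (if i = j then lam else 0) * (G x $ 1 $ 1 + G x $ 2 $ 2 + G x $ 3 $ 3))"
    by (intro locally_L1_add locally_L1_cmult G)
  then show ?thesis by (simp add: elastic_nth if_distrib[of "\<lambda>c. c * _"] cong: if_cong)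
qed

lemma locally_L1_biphase:
  fixes G :: "real^3 \<Rightarrow> real^3^3"
  assumes "locally_L1 G" shows "locally_L1 (\<lambda>x. biphase mu_i lam_i mu_e lam_e x (G x) $ i $ j)"
proof -
  have "{z::real^3. z $ 3 < 0} \<in> sets lebesgue"
    using open_Collect_less[of "\<lambda>z::real^3. z $ 3" "\<lambda>z. 0"] by (simp add: continuous_intros)
  then have "locally_L1 (\<lambda>x. elastic mu_e lam_e (G x) $ i $ j + indicator {z. z $ 3 < 0} x *
      (elastic mu_i lam_i (G x) $ i $ j + (-1) * elastic mu_e lam_e (G x) $ i $ j))"
    by (intro locally_L1_add locally_L1_indicator locally_L1_cmult locally_L1_elastic assms)
  then show ?thesis by (simp add: biphase_nth)
qed

text \<open>The vector test field \<phi> e_i isolates the i-th row of the stress, so the vector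
  equation yields one scalar equation per component.\<close>

lemma weak_solution_rongved:
  assumes "rongved_solution mu_i lam_i mu_e lam_e y l u"
  shows "weak_solution (\<lambda>i x. u x $ i) (\<lambda>i j x. grad u x $ i $ j)
    (\<lambda>i j x. biphase mu_i lam_i mu_e lam_e x (grad u x) $ i $ j) l y"
proof
  have wg: "weak_gradient u (grad u)" and Lu: "locally_L1 u"
    and eq: "\<And>\<phi> :: real^3 \<Rightarrow> real^3. test_function \<phi> \<Longrightarrow>
        integral\<^sup>L lebesgue (\<lambda>x. biphase mu_i lam_i mu_e lam_e x (grad u x) \<bullet> grad \<phi> x) = l \<bullet> \<phi> y"
    using assms unfolding rongved_solution_def by blast+
  have LG: "locally_L1 (grad u)" using wg by (simp add: weak_gradient_def)
  show "locally_L1 (\<lambda>x. u x $ i)" for i by (rule locally_L1_nth[OF Lu])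
  show "locally_L1 (\<lambda>x. grad u x $ i $ j)" for i j by (rule locally_L1_nth2[OF LG])
  show "locally_L1 (\<lambda>x. biphase mu_i lam_i mu_e lam_e x (grad u x) $ i $ j)" for i j
    by (rule locally_L1_biphase[OF LG])
  fix \<phi> :: "real^3 \<Rightarrow> real" assume t: "test_function \<phi>"
  show "integral\<^sup>L lebesgue (\<lambda>x. u x $ i * pd j \<phi> x) = - integral\<^sup>L lebesgue (\<lambda>x. grad u x $ i $ j * \<phi> x)" for i j
    using wg t unfolding weak_gradient_def pd_def by blast
  show "integral\<^sup>L lebesgue (\<lambda>x. \<Sum>j\<in>UNIV. biphase mu_i lam_i mu_e lam_e x (grad u x) $ i $ j * pd j \<phi> x) = l $ i * \<phi> y" for i
  proof -
    have sm: "smooth_on UNIV \<phi>" and cp: "compact (closure {x. \<phi> x \<noteq> 0})" using t by (simp_all add: test_function_iff)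
    let ?\<Phi> = "\<lambda>x. \<phi> x *\<^sub>R (axis i 1 :: real^3)"
    have "smooth_on UNIV ?\<Phi>" by (intro smooth_on_scaleR open_UNIV sm smooth_on_const)
    moreover have "{x. ?\<Phi> x \<noteq> 0} = {x. \<phi> x \<noteq> 0}" by (simp add: axis_eq_0_iff)
    ultimately have "test_function ?\<Phi>" using cp by (simp add: test_function_iff)
    note e = eq[OF this]
    have g: "grad ?\<Phi> x $ p $ q = (if p = i then pd q \<phi> x else 0)" for x p q
    proof -
      have "(?\<Phi> has_derivative (\<lambda>h. frechet_derivative \<phi> (at x) h *\<^sub>R axis i 1)) (at x)"
        by (intro has_derivative_scaleR_left frechet_derivative_worksI smooth_on_differentiable[OF sm UNIV_I])
      then show ?thesis
        by (simp add: grad_def matrix_def frechet_derivative_eqI pd_def axis_def)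
    qed
    have "biphase mu_i lam_i mu_e lam_e x (grad u x) \<bullet> grad ?\<Phi> x
        = (\<Sum>j\<in>UNIV. biphase mu_i lam_i mu_e lam_e x (grad u x) $ i $ j * pd j \<phi> x)" for x
    proof -
      have "biphase mu_i lam_i mu_e lam_e x (grad u x) \<bullet> grad ?\<Phi> x
         = (\<Sum>p\<in>UNIV. if p = i then (\<Sum>j\<in>UNIV. biphase mu_i lam_i mu_e lam_e x (grad u x) $ p $ j * pd j \<phi> x) else 0)"
        unfolding inner_vec_def g by (intro sum.cong refl) simp
      then show ?thesis by simp
    qed
    then show ?thesis using e by (simp add: inner_axis)
  qed
qed

lemma HI_sum2:
  assumes "\<And>i j. integrable lebesgue (\<lambda>x. w i j x * (indicator (hs \<sigma> 0) x * h i j x))"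
  shows "(\<Sum>i\<in>(UNIV::3 set). \<Sum>j\<in>(UNIV::3 set). HI \<sigma> (w i j) (h i j))
    = integral\<^sup>L lebesgue (\<lambda>x. \<Sum>i\<in>UNIV. \<Sum>j\<in>UNIV. w i j x * (indicator (hs \<sigma> 0) x * h i j x))"
  unfolding HI_def
  by (subst Bochner_Integration.integral_sum, intro Bochner_Integration.integrable_sum assms,
      subst Bochner_Integration.integral_sum, rule assms, rule refl)

section \<open>Hooke's law in index form and Betti's identity\<close>

definition hooke :: "real \<Rightarrow> real \<Rightarrow> (3 \<Rightarrow> 3 \<Rightarrow> real) \<Rightarrow> 3 \<Rightarrow> 3 \<Rightarrow> real" where
  "hooke mu lam h i j = mu * (h i j + h j i) + (if i = j then lam * (h 1 1 + h 2 2 + h 3 3) else 0)"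

text \<open>Major symmetry of the isotropic tensor: it moves from the gradient of \<open>u\<close>
  to that of the test field. The index form \<open>hooke\<close> applies equally to the products v_i
  d_j \<eta>, which are not gradients; the factor \<open>c\<close> receives the indicator of the
  half-space.\<close>

lemma hooke_symmetric:
  "(\<Sum>i\<in>UNIV. \<Sum>j\<in>UNIV. hooke mu lam A i j * (c * h i j)) = (\<Sum>i\<in>UNIV. \<Sum>j\<in>UNIV. A i j * (c * hooke mu lam h i j))"
  by (simp add: hooke_def sum_3 algebra_simps)

lemma smooth_on_hooke:
  assumes "open S" "\<And>i j. smooth_on S (h i j)"
  shows "smooth_on S (\<lambda>x. hooke mu lam (\<lambda>i j. h i j x) i j)"
  unfolding hooke_def by (cases "i = j") (auto intro!: smooth_on_intros smooth_on_const assms)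

context weak_solution
begin

text \<open>Betti's reciprocity with a cutoff \<eta>. The tensor is moved onto v by its symmetry and
  the gradient of \<open>u\<close> is removed by parts wherever \<eta> is not differentiated. This
  leaves two terms with derivatives of \<eta>, of which only the first still contains the gradient
  of \<open>u\<close>, and one with the divergence of the stress of v.\<close>

lemma green_identity:
  fixes v1 v2 :: "3 \<Rightarrow> real^3 \<Rightarrow> real" and S1 S2 :: "3 \<Rightarrow> 3 \<Rightarrow> real^3 \<Rightarrow> real"
  assumes W1: "\<And>x i j. x $ 3 > 0 \<Longrightarrow> W i j x = hooke mu1 lam1 (\<lambda>i j. G i j x) i j"
    and W2: "\<And>x i j. x $ 3 < 0 \<Longrightarrow> W i j x = hooke mu2 lam2 (\<lambda>i j. G i j x) i j"
    and v: "\<And>i. smooth_on (hs 1 d) (v1 i)" "\<And>i. smooth_on (hs (-1) d) (v2 i)"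
    and S1: "\<And>i j x. x \<in> hs 1 d \<Longrightarrow> S1 i j x = hooke mu1 lam1 (\<lambda>i j. pd j (v1 i) x) i j"
    and S2: "\<And>i j x. x \<in> hs (-1) d \<Longrightarrow> S2 i j x = hooke mu2 lam2 (\<lambda>i j. pd j (v2 i) x) i j"
    and mv: "\<And>i x. x $ 3 = 0 \<Longrightarrow> v1 i x = v2 i x"
    and mS: "\<And>i x. x $ 3 = 0 \<Longrightarrow> S1 i 3 x = S2 i 3 x"
    and chi: "smooth_on UNIV \<eta>" and K: "compact K" "\<And>x. x \<notin> K \<Longrightarrow> \<eta> x = 0" and d: "d > 0" and y: "y $ 3 > 0"
  shows "(\<Sum>i\<in>UNIV. l $ i * (\<eta> y * v1 i y)) =
     (\<Sum>i\<in>UNIV. \<Sum>j\<in>UNIV. HI 1 (G i j) (\<lambda>x. hooke mu1 lam1 (\<lambda>i j. v1 i x * pd j \<eta> x) i j)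
        + HI (-1) (G i j) (\<lambda>x. hooke mu2 lam2 (\<lambda>i j. v2 i x * pd j \<eta> x) i j))
   - (\<Sum>i\<in>UNIV. \<Sum>j\<in>UNIV. HI 1 (u i) (\<lambda>x. pd j \<eta> x * S1 i j x) + HI (-1) (u i) (\<lambda>x. pd j \<eta> x * S2 i j x))
   - (\<Sum>i\<in>UNIV. \<Sum>j\<in>UNIV. HI 1 (u i) (\<lambda>x. \<eta> x * pd j (S1 i j) x) + HI (-1) (u i) (\<lambda>x. \<eta> x * pd j (S2 i j) x))"
proof -
  have kz: "pd j \<eta> x = 0" if "x \<notin> K" for x j
    by (rule pd_eq_0_outside[of K \<eta> x j, OF compact_imp_closed[OF K(1)] K(2) that])
  have chd: "\<eta> differentiable (at x)" for x by (rule smooth_on_differentiable[OF chi UNIV_I])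
  have chs: "smooth_on S \<eta>" for S by (rule smooth_on_subset[OF chi]) simp
  have pchs: "smooth_on S (pd j \<eta>)" for S j by (rule smooth_on_subset[OF smooth_on_pd[OF chi]]) simp
  \<comment> \<open>One side at a time: with S the stress of v, the density W : grad(\<eta> v)
    equals \<eta> G : S plus G paired with the tensor applied to the products v_i d_j
    \<eta>.\<close>
  have half: "(\<Sum>i\<in>UNIV. \<Sum>j\<in>UNIV. HI \<sigma> (W i j) (pd j (\<lambda>x. \<eta> x * v i x))) =
      (\<Sum>i\<in>UNIV. \<Sum>j\<in>UNIV. HI \<sigma> (G i j) (\<lambda>x. \<eta> x * S i j x)) +
      (\<Sum>i\<in>UNIV. \<Sum>j\<in>UNIV. HI \<sigma> (G i j) (\<lambda>x. hooke mu lam (\<lambda>i j. v i x * pd j \<eta> x) i j))"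
    and sS: "smooth_on (hs \<sigma> d) (S i j)"
    if s: "\<sigma> = 1 \<or> \<sigma> = -1" and Ws: "\<And>x i j. x \<in> hs \<sigma> 0 \<Longrightarrow> W i j x = hooke mu lam (\<lambda>i j. G i j x) i j"
      and vs: "\<And>i. smooth_on (hs \<sigma> d) (v i)"
      and Ss: "\<And>i j x. x \<in> hs \<sigma> d \<Longrightarrow> S i j x = hooke mu lam (\<lambda>i j. pd j (v i) x) i j"
    for \<sigma> mu lam and v :: "3 \<Rightarrow> real^3 \<Rightarrow> real" and S :: "3 \<Rightarrow> 3 \<Rightarrow> real^3 \<Rightarrow> real" and i j
  proof -
    have sS': "smooth_on (hs \<sigma> d) (S i j)" for i j
      by (rule smooth_on_cong[OF open_hs smooth_on_hooke[where h = "\<lambda>i j. pd j (v i)", OF open_hs] Ss[symmetric]])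
         (intro smooth_on_pd vs)
    then show "smooth_on (hs \<sigma> d) (S i j)" .
    have vd: "v i differentiable (at x)" if "x \<in> hs \<sigma> d" for i x by (rule smooth_on_differentiable[OF vs that])
    have pdcv: "pd j (\<lambda>x. \<eta> x * v i x) x = \<eta> x * pd j (v i) x + pd j \<eta> x * v i x" if "x \<in> hs \<sigma> d" for i j x
      by (rule pd_mult[OF chd vd[OF that]])
    have scv: "smooth_on (hs \<sigma> d) (\<lambda>x. \<eta> x * v i x)" for i by (intro smooth_on_mult open_hs chs vs)
    have iW: "integrable lebesgue (\<lambda>x. W i j x * (indicator (hs \<sigma> 0) x * pd j (\<lambda>x. \<eta> x * v i x) x))" for i j
      by (rule cut_limit(2)[OF s LW smooth_on_continuous[OF smooth_on_pd[OF scv]] K(1) _ d])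
         (rule pd_eq_0_outside[of K _ _ j, OF compact_imp_closed[OF K(1)]], simp_all add: K(2))
    have iS: "integrable lebesgue (\<lambda>x. G i j x * (indicator (hs \<sigma> 0) x * (\<eta> x * S i j x)))" for i j
      by (rule cut_limit(2)[OF s LG _ K(1) _ d])
         (auto intro!: smooth_on_continuous smooth_on_mult chs sS' simp: K(2))
    have iM: "integrable lebesgue (\<lambda>x. G i j x * (indicator (hs \<sigma> 0) x * hooke mu lam (\<lambda>i j. v i x * pd j \<eta> x) i j))" for i j
    proof (rule cut_limit(2)[OF s LG _ K(1) _ d])
      show "continuous_on (hs \<sigma> d) (\<lambda>x. hooke mu lam (\<lambda>i j. v i x * pd j \<eta> x) i j)"
        by (intro smooth_on_continuous smooth_on_hooke smooth_on_mult open_hs pchs vs)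
    qed (simp add: kz hooke_def)
    have pt: "(\<Sum>i\<in>UNIV. \<Sum>j\<in>UNIV. W i j x * (indicator (hs \<sigma> 0) x * pd j (\<lambda>x. \<eta> x * v i x) x)) =
        (\<Sum>i\<in>UNIV. \<Sum>j\<in>UNIV. G i j x * (indicator (hs \<sigma> 0) x * (\<eta> x * S i j x))) +
        (\<Sum>i\<in>UNIV. \<Sum>j\<in>UNIV. G i j x * (indicator (hs \<sigma> 0) x * hooke mu lam (\<lambda>i j. v i x * pd j \<eta> x) i j))" for x
    proof (cases "x \<in> hs \<sigma> 0")
      case True
      then have x: "x \<in> hs \<sigma> d" using d by (auto simp: hs_def)
      have "(\<Sum>i\<in>UNIV. \<Sum>j\<in>UNIV. W i j x * (indicator (hs \<sigma> 0) x * pd j (\<lambda>x. \<eta> x * v i x) x)) =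
         (\<Sum>i\<in>UNIV. \<Sum>j\<in>UNIV. hooke mu lam (\<lambda>i j. G i j x) i j * (indicator (hs \<sigma> 0) x * pd j (\<lambda>x. \<eta> x * v i x) x))"
        by (simp add: Ws[OF True])
      also have "\<dots> = (\<Sum>i\<in>UNIV. \<Sum>j\<in>UNIV. G i j x * (indicator (hs \<sigma> 0) x * hooke mu lam (\<lambda>i j. pd j (\<lambda>x. \<eta> x * v i x) x) i j))"
        by (rule hooke_symmetric)
      also have "\<dots> = (\<Sum>i\<in>UNIV. \<Sum>j\<in>UNIV. G i j x * (indicator (hs \<sigma> 0) x * (\<eta> x * S i j x)) +
          G i j x * (indicator (hs \<sigma> 0) x * hooke mu lam (\<lambda>i j. v i x * pd j \<eta> x) i j))"
      proof (intro sum.cong refl)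
        fix i j
        have "hooke mu lam (\<lambda>i j. pd j (\<lambda>x. \<eta> x * v i x) x) i j = \<eta> x * S i j x + hooke mu lam (\<lambda>i j. v i x * pd j \<eta> x) i j"
          unfolding pdcv[OF x] Ss[OF x] hooke_def by (simp add: algebra_simps)
        then show "G i j x * (indicator (hs \<sigma> 0) x * hooke mu lam (\<lambda>i j. pd j (\<lambda>x. \<eta> x * v i x) x) i j)
          = G i j x * (indicator (hs \<sigma> 0) x * (\<eta> x * S i j x)) +
          G i j x * (indicator (hs \<sigma> 0) x * hooke mu lam (\<lambda>i j. v i x * pd j \<eta> x) i j)"
          by (simp only: distrib_left)
      qed
      finally show ?thesis by (simp only: sum.distrib)
    qed simp
    show "(\<Sum>i\<in>UNIV. \<Sum>j\<in>UNIV. HI \<sigma> (W i j) (pd j (\<lambda>x. \<eta> x * v i x))) =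
      (\<Sum>i\<in>UNIV. \<Sum>j\<in>UNIV. HI \<sigma> (G i j) (\<lambda>x. \<eta> x * S i j x)) +
      (\<Sum>i\<in>UNIV. \<Sum>j\<in>UNIV. HI \<sigma> (G i j) (\<lambda>x. hooke mu lam (\<lambda>i j. v i x * pd j \<eta> x) i j))"
      unfolding HI_sum2[OF iW] HI_sum2[OF iS] HI_sum2[OF iM] pt
      by (rule Bochner_Integration.integral_add) (intro Bochner_Integration.integrable_sum iS iM)+
  qed
  have W1': "W i j x = hooke mu1 lam1 (\<lambda>i j. G i j x) i j" if "x \<in> hs 1 0" for x i j
    using W1 that by (simp add: hs_def)
  have W2': "W i j x = hooke mu2 lam2 (\<lambda>i j. G i j x) i j" if "x \<in> hs (-1) 0" for x i j
    using W2 that by (simp add: hs_def)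
  note h1 = half[of 1 mu1 lam1 v1 S1, OF _ W1' v(1) S1, simplified]
  note h2 = half[of "-1" mu2 lam2 v2 S2, OF _ W2' v(2) S2, simplified]
  note s1 = sS[of 1 mu1 lam1 v1 S1, OF _ W1' v(1) S1, simplified]
  note s2 = sS[of "-1" mu2 lam2 v2 S2, OF _ W2' v(2) S2, simplified]
  have c1: "smooth_on (hs 1 d) (\<lambda>x. \<eta> x * v1 i x)" and c2: "smooth_on (hs (-1) d) (\<lambda>x. \<eta> x * v2 i x)" for i
    by (intro smooth_on_mult open_hs chs v)+
  have cS1: "smooth_on (hs 1 d) (\<lambda>x. \<eta> x * S1 i j x)" and cS2: "smooth_on (hs (-1) d) (\<lambda>x. \<eta> x * S2 i j x)" for i j
    by (intro smooth_on_mult open_hs chs s1 s2)+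
  have "(\<Sum>i\<in>UNIV. l $ i * (\<eta> y * v1 i y)) = (\<Sum>i\<in>UNIV. \<Sum>j\<in>UNIV. HI 1 (W i j) (pd j (\<lambda>x. \<eta> x * v1 i x)) + HI (-1) (W i j) (pd j (\<lambda>x. \<eta> x * v2 i x)))"
    by (intro sum.cong refl equation_pair[OF c1 c2 _ K(1) _ _ d y, symmetric]) (simp_all add: mv K(2))
  also have "\<dots> = (\<Sum>i\<in>UNIV. \<Sum>j\<in>UNIV. HI 1 (G i j) (\<lambda>x. \<eta> x * S1 i j x) + HI (-1) (G i j) (\<lambda>x. \<eta> x * S2 i j x))
     + (\<Sum>i\<in>UNIV. \<Sum>j\<in>UNIV. HI 1 (G i j) (\<lambda>x. hooke mu1 lam1 (\<lambda>i j. v1 i x * pd j \<eta> x) i j)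
        + HI (-1) (G i j) (\<lambda>x. hooke mu2 lam2 (\<lambda>i j. v2 i x * pd j \<eta> x) i j))"
    by (simp only: sum.distrib h1 h2 ac_simps)
  also have "(\<Sum>i\<in>UNIV. \<Sum>j\<in>UNIV. HI 1 (G i j) (\<lambda>x. \<eta> x * S1 i j x) + HI (-1) (G i j) (\<lambda>x. \<eta> x * S2 i j x)) =
     (\<Sum>i\<in>UNIV. \<Sum>j\<in>UNIV. - (HI 1 (u i) (pd j (\<lambda>x. \<eta> x * S1 i j x)) + HI (-1) (u i) (pd j (\<lambda>x. \<eta> x * S2 i j x))))"
  proof (intro sum.cong refl)
    fix i j :: 3
    show "HI 1 (G i j) (\<lambda>x. \<eta> x * S1 i j x) + HI (-1) (G i j) (\<lambda>x. \<eta> x * S2 i j x) =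
      - (HI 1 (u i) (pd j (\<lambda>x. \<eta> x * S1 i j x)) + HI (-1) (u i) (pd j (\<lambda>x. \<eta> x * S2 i j x)))"
    \<comment> \<open>Normal components need equal traction on both sides; the tangential ones may
      jump, since integration by parts parallel to the plane has no boundary term.\<close>
    proof (cases "j = 3")
      case True
      show ?thesis unfolding True
        by (rule matched[OF cS1 cS2 _ K(1) _ _ d]) (simp_all add: mS K(2))
    next
      case False
      have "HI 1 (G i j) (\<lambda>x. \<eta> x * S1 i j x) + HI 1 (u i) (pd j (\<lambda>x. \<eta> x * S1 i j x)) = 0"
        by (rule one_sided(2)[OF _ cS1 K(1) _ d False]) (simp_all add: K(2))
      moreover have "HI (-1) (G i j) (\<lambda>x. \<eta> x * S2 i j x) + HI (-1) (u i) (pd j (\<lambda>x. \<eta> x * S2 i j x)) = 0"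
        by (rule one_sided(2)[OF _ cS2 K(1) _ d False]) (simp_all add: K(2))
      ultimately show ?thesis by linarith
    qed
  qed
  also have "\<dots> = (\<Sum>i\<in>UNIV. \<Sum>j\<in>UNIV. - (HI 1 (u i) (\<lambda>x. \<eta> x * pd j (S1 i j) x) + HI 1 (u i) (\<lambda>x. pd j \<eta> x * S1 i j x)
     + (HI (-1) (u i) (\<lambda>x. \<eta> x * pd j (S2 i j) x) + HI (-1) (u i) (\<lambda>x. pd j \<eta> x * S2 i j x))))"
  proof -
    have split: "HI \<sigma> (u i) (pd j (\<lambda>x. \<eta> x * S x)) = HI \<sigma> (u i) (\<lambda>x. \<eta> x * pd j S x) + HI \<sigma> (u i) (\<lambda>x. pd j \<eta> x * S x)"
      if s: "\<sigma> = 1 \<or> \<sigma> = -1" and sm: "smooth_on (hs \<sigma> d) S" for \<sigma> S i j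
    proof -
      have 1: "integrable lebesgue (\<lambda>x. u i x * (indicator (hs \<sigma> 0) x * (\<eta> x * pd j S x)))"
        by (rule cut_limit(2)[OF s Lu _ K(1) _ d])
           (auto intro!: smooth_on_continuous smooth_on_mult chs smooth_on_pd sm simp: K(2))
      have 2: "integrable lebesgue (\<lambda>x. u i x * (indicator (hs \<sigma> 0) x * (pd j \<eta> x * S x)))"
        by (rule cut_limit(2)[OF s Lu _ K(1) _ d])
           (auto intro!: smooth_on_continuous smooth_on_mult pchs sm simp: kz)
      have "u i x * (indicator (hs \<sigma> 0) x * pd j (\<lambda>x. \<eta> x * S x) x) =
         u i x * (indicator (hs \<sigma> 0) x * (\<eta> x * pd j S x)) + u i x * (indicator (hs \<sigma> 0) x * (pd j \<eta> x * S x))" for x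
      proof (cases "x \<in> hs \<sigma> 0")
        case True
        then have x: "x \<in> hs \<sigma> d" using d by (auto simp: hs_def)
        show ?thesis
          by (simp only: pd_mult[OF chd smooth_on_differentiable[OF sm x]] distrib_left)
      qed simp
      then show ?thesis unfolding HI_def
        by (simp only: Bochner_Integration.integral_add[OF 1 2])
    qed
    show ?thesis by (intro sum.cong refl arg_cong[where f = uminus]) (simp add: split s1 s2)
  qed
  finally show ?thesis by (simp add: sum.distrib sum_negf sum_subtractf)
qed

end

section \<open>Papkovich--Neuber potentials\<close>

definition lap :: "(real^3 \<Rightarrow> real) \<Rightarrow> real^3 \<Rightarrow> real" where
  "lap f x = pd 1 (pd 1 f) x + pd 2 (pd 2 f) x + pd 3 (pd 3 f) x"

text \<open>The Papkovich--Neuber representation \<open>\<mu> u = 4 (1 - \<nu>) B e\<^sub>3 - \<nabla>\<Psi>\<close>, with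
  \<open>\<Psi> = x\<^sub>3 B + \<beta>\<close> for harmonic \<open>B\<close>, \<open>\<beta>\<close>. The residual \<open>pn_res\<close> vanishes in that case and records
  the body force otherwise.\<close>

definition pn_disp :: "real \<Rightarrow> (real^3 \<Rightarrow> real) \<Rightarrow> (real^3 \<Rightarrow> real) \<Rightarrow> 3 \<Rightarrow> real^3 \<Rightarrow> real" where
  "pn_disp nu B \<Psi> i x = (if i = 3 then 4 * (1 - nu) else 0) * B x - pd i \<Psi> x"

definition pn_res :: "(real^3 \<Rightarrow> real) \<Rightarrow> (real^3 \<Rightarrow> real) \<Rightarrow> real^3 \<Rightarrow> real" where
  "pn_res B \<Psi> x = lap \<Psi> x - 2 * pd 3 B x"

text \<open>The stress of \<open>pn_disp\<close> / \<mu>, with \<lambda> / \<mu> = 2 \<nu> / (1 - 2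
  \<nu>). The divergence of \<open>pn_disp\<close> is 2 (1 - 2 \<nu>) d_3 B - \<open>pn_res\<close>,
  whence the first two terms.\<close>

definition pn_stress :: "real \<Rightarrow> (real^3 \<Rightarrow> real) \<Rightarrow> (real^3 \<Rightarrow> real) \<Rightarrow> 3 \<Rightarrow> 3 \<Rightarrow> real^3 \<Rightarrow> real" where
  "pn_stress nu B \<Psi> i j x =
     (if i = j then 4 * nu else 0) * pd 3 B x + (if i = j then - (2 * nu / (1 - 2 * nu)) else 0) * pn_res B \<Psi> x
     + (if i = 3 then 4 * (1 - nu) else 0) * pd j B x + (if j = 3 then 4 * (1 - nu) else 0) * pd i B x
     - 2 * pd j (pd i \<Psi>) x"

lemma smooth_on_lap: "open S \<Longrightarrow> smooth_on S f \<Longrightarrow> smooth_on S (lap f)"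
  unfolding lap_def[abs_def] by (intro smooth_on_add smooth_on_pd)

lemma smooth_on_pn_disp: "open S \<Longrightarrow> smooth_on S B \<Longrightarrow> smooth_on S \<Psi> \<Longrightarrow> smooth_on S (pn_disp nu B \<Psi> i)"
  unfolding pn_disp_def[abs_def] by (intro smooth_on_diff smooth_on_mult smooth_on_pd smooth_on_const)

lemma smooth_on_pn_res: "open S \<Longrightarrow> smooth_on S B \<Longrightarrow> smooth_on S \<Psi> \<Longrightarrow> smooth_on S (pn_res B \<Psi>)"
  unfolding pn_res_def[abs_def] by (intro smooth_on_diff smooth_on_mult smooth_on_lap smooth_on_pd smooth_on_const)

lemma smooth_on_pn_stress: "open S \<Longrightarrow> smooth_on S B \<Longrightarrow> smooth_on S \<Psi> \<Longrightarrow> smooth_on S (pn_stress nu B \<Psi> i j)"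
  unfolding pn_stress_def[abs_def]
  by (intro smooth_on_diff smooth_on_add smooth_on_mult smooth_on_pn_res smooth_on_pd smooth_on_const)

lemma pd_pn_disp:
  assumes "open S" "x \<in> S" "smooth_on S B" "smooth_on S \<Psi>"
  shows "pd j (pn_disp nu B \<Psi> i) x = (if i = 3 then 4 * (1 - nu) else 0) * pd j B x - pd j (pd i \<Psi>) x"
proof -
  note d = smooth_on_differentiable[OF _ assms(2)]
  have dB: "(\<lambda>x. c * B x) differentiable (at x)" for c
    by (rule d[of "\<lambda>x. c * B x", OF smooth_on_mult[OF assms(1) smooth_on_const assms(3)]])
  show ?thesis
    unfolding pn_disp_def[abs_def]
    by (subst pd_diff[OF dB d[OF smooth_on_pd[OF assms(4)]]], subst pd_cmult[OF d[OF assms(3)]]) (rule refl)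
qed

lemma pn_hooke:
  assumes S: "open S" "x \<in> S" "smooth_on S B" "smooth_on S \<Psi>"
    and nu: "nu \<noteq> 1 / 2" "mu \<noteq> 0" "lam = mu * (2 * nu / (1 - 2 * nu))"
  shows "hooke mu lam (\<lambda>i j. pd j (\<lambda>x. pn_disp nu B \<Psi> i x / mu) x) i j = pn_stress nu B \<Psi> i j x"
proof -
  have 1: "pd j (\<lambda>x. pn_disp nu B \<Psi> i x / mu) x = pd j (pn_disp nu B \<Psi> i) x / mu" for i j
    by (rule pd_divide_const[OF smooth_on_differentiable[OF smooth_on_pn_disp[OF S(1,3,4)] S(2)]])
  have c: "pd i (pd j \<Psi>) x = pd j (pd i \<Psi>) x" by (rule pd_commute[OF S(1,2,4)])
  have 2: "4 * nu = 2 * nu / (1 - 2 * nu) * (2 * (1 - 2 * nu))" using nu(1) by (simp add: field_simps)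
  define t where "t = 2 * nu / (1 - 2 * nu)"
  show ?thesis
    unfolding hooke_def 1 pd_pn_disp[OF S] pn_stress_def pn_res_def lap_def nu(3) 2 t_def[symmetric]
    using nu(2) c 2[unfolded t_def[symmetric]] by (auto simp: field_simps)
qed

text \<open>The terms d_i d_3 B carry the total coefficient 4 \<nu> + 4 (1 - \<nu>) - 4 = 0, so the
  body force consists of the Laplacian of \<open>B\<close> and the gradient of the residual
  alone.\<close>

lemma pn_div:
  assumes S: "open S" "x \<in> S" "smooth_on S B" "smooth_on S \<Psi>" and nu: "nu \<noteq> 1 / 2"
  shows "(\<Sum>j\<in>UNIV. pd j (pn_stress nu B \<Psi> i j) x) =
    (if i = 3 then 4 * (1 - nu) else 0) * lap B x - (2 * (1 - nu) / (1 - 2 * nu)) * pd i (pn_res B \<Psi>) x"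
proof -
  note d = smooth_on_differentiable[OF _ S(2)]
  note sP = smooth_on_pd[OF S(3)] smooth_on_pd[OF S(4)] smooth_on_pd[OF smooth_on_pd[OF S(4)]]
     smooth_on_pn_res[OF S(1,3,4)]
  have dP: "pd k B differentiable (at x)" "pd k (pd m \<Psi>) differentiable (at x)" "pn_res B \<Psi> differentiable (at x)" for k m
    using d sP by blast+
  note dd = differentiable_mult[OF differentiable_const dP(1)] differentiable_mult[OF differentiable_const dP(2)]
    differentiable_mult[OF differentiable_const dP(3)]
  have 1: "pd j (pn_stress nu B \<Psi> i j) x =
     (if i = j then 4 * nu else 0) * pd j (pd 3 B) x + (if i = j then - (2 * nu / (1 - 2 * nu)) else 0) * pd j (pn_res B \<Psi>) x
     + (if i = 3 then 4 * (1 - nu) else 0) * pd j (pd j B) x + (if j = 3 then 4 * (1 - nu) else 0) * pd j (pd i B) x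
     - 2 * pd j (pd j (pd i \<Psi>)) x" for j
    unfolding pn_stress_def[abs_def]
    by (subst pd_diff, (intro differentiable_add dd)+,
        (subst pd_add, (intro differentiable_add dd)+)+)
       (simp only: pd_cmult[OF dP(1)] pd_cmult[OF dP(2)] pd_cmult[OF dP(3)])
  have 2: "pd j (pd j (pd i \<Psi>)) x = pd i (pd j (pd j \<Psi>)) x" for j
  proof -
    have "pd j (pd j (pd i \<Psi>)) x = pd j (pd i (pd j \<Psi>)) x"
      by (rule pd_cong[OF S(1,2)]) (rule pd_commute[OF S(1) _ S(4)])
    also have "\<dots> = pd i (pd j (pd j \<Psi>)) x" by (rule pd_commute[OF S(1,2) smooth_on_pd[OF S(4)]])
    finally show ?thesis .
  qed
  have 3: "pd i (pn_res B \<Psi>) x = pd i (pd 1 (pd 1 \<Psi>)) x + pd i (pd 2 (pd 2 \<Psi>)) x + pd i (pd 3 (pd 3 \<Psi>)) x - 2 * pd i (pd 3 B) x"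
    unfolding pn_res_def[abs_def] lap_def
    by (subst pd_diff, (intro differentiable_add dP dd)+, (subst pd_add, (intro differentiable_add dP)+)+)
       (simp only: pd_cmult[OF dP(1)])
  have 4: "pd 3 (pd i B) x = pd i (pd 3 B) x" by (rule pd_commute[OF S(1,2,3)])
  have t: "2 * (1 - nu) / (1 - 2 * nu) = 2 * nu / (1 - 2 * nu) + 2" using nu by (simp add: field_simps)
  define t where "t = 2 * nu / (1 - 2 * nu)"
  have i: "i = 1 \<or> i = 2 \<or> i = 3" by (rule exhaust_3)
  have "(\<Sum>j\<in>UNIV. pd j (pn_stress nu B \<Psi> i j) x) =
     4 * nu * pd i (pd 3 B) x - t * pd i (pn_res B \<Psi>) x + (if i = 3 then 4 * (1 - nu) else 0) * lap B x
     + 4 * (1 - nu) * pd i (pd 3 B) x - 2 * (pd i (pn_res B \<Psi>) x + 2 * pd i (pd 3 B) x)"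
  proof -
    have 5: "pd i (pd 1 (pd 1 \<Psi>)) x = pd i (pn_res B \<Psi>) x + 2 * pd i (pd 3 B) x - pd i (pd 2 (pd 2 \<Psi>)) x - pd i (pd 3 (pd 3 \<Psi>)) x"
      using 3 by linarith
    show ?thesis
      unfolding 1 2 sum_3 lap_def t_def[symmetric] 5 using i 4 by (auto simp: algebra_simps)
  qed
  then show ?thesis unfolding t t_def[symmetric] by (simp add: algebra_simps)
qed

section \<open>Decay at infinity\<close>

text \<open>Symbol-type classes: \<open>f\<close> is O(N^m) on \<open>A\<close>, and each of the
  first \<open>n\<close> derivatives gains one power of 1/N. They are stable under sums and products
  of smooth functions, so decay of the fields follows from decay of the building blocks.\<close>

primrec decays :: "(real^3) set \<Rightarrow> (real^3 \<Rightarrow> real) \<Rightarrow> nat \<Rightarrow> int \<Rightarrow> (real^3 \<Rightarrow> real) \<Rightarrow> bool" where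
  "decays A N 0 m f \<longleftrightarrow> (\<exists>C. \<forall>x\<in>A. \<bar>f x\<bar> \<le> C * N x powi m)"
| "decays A N (Suc n) m f \<longleftrightarrow> (\<exists>C. \<forall>x\<in>A. \<bar>f x\<bar> \<le> C * N x powi m) \<and> (\<forall>i. decays A N n (m - 1) (pd i f))"

locale decay =
  fixes S A :: "(real^3) set" and N :: "real^3 \<Rightarrow> real"
  assumes open_S: "open S" and A_S: "A \<subseteq> S" and N1: "\<And>x. x \<in> A \<Longrightarrow> 1 \<le> N x"
begin

lemma decays_0D: "decays A N n m f \<Longrightarrow> \<exists>C. \<forall>x\<in>A. \<bar>f x\<bar> \<le> C * N x powi m"
  by (cases n) auto

lemma decays_SucD: "decays A N (Suc n) m f \<Longrightarrow> decays A N n m f"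
proof (induction n arbitrary: m f)
  case (Suc n)
  then show ?case by (simp only: decays.simps(2)) blast
qed simp

lemma decays_cong:
  assumes "\<And>x. x \<in> S \<Longrightarrow> f x = g x" "decays A N n m f" shows "decays A N n m g"
  using assms
proof (induction n arbitrary: m f g)
  case 0
  have "g x = f x" if "x \<in> A" for x using 0(1)[of x] subsetD[OF A_S that] by simp
  then show ?case using 0(2) by simp
next
  case (Suc n)
  have "g x = f x" if "x \<in> A" for x using Suc.prems(1)[of x] subsetD[OF A_S that] by simp
  then have "\<exists>C. \<forall>x\<in>A. \<bar>g x\<bar> \<le> C * N x powi m" using Suc.prems(2) by simp
  moreover have "decays A N n (m - 1) (pd i g)" for i
  proof (rule Suc.IH[of "pd i f"])
    show "pd i f x = pd i g x" if "x \<in> S" for x by (rule pd_cong[OF open_S that Suc.prems(1)])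
    show "decays A N n (m - 1) (pd i f)" using Suc.prems(2) by simp
  qed
  ultimately show ?case by simp
qed

lemma decays_weaken: "decays A N n m f \<Longrightarrow> decays A N n (m + 1) f"
proof (induction n arbitrary: m f)
  have base: "\<exists>C. \<forall>x\<in>A. \<bar>f x\<bar> \<le> C * N x powi (m + 1)" if d: "\<exists>C. \<forall>x\<in>A. \<bar>f x\<bar> \<le> C * N x powi m" for f m
  proof -
    obtain C where C: "\<forall>x\<in>A. \<bar>f x\<bar> \<le> C * N x powi m" using d by (elim exE)
    have "\<bar>f x\<bar> \<le> \<bar>C\<bar> * N x powi (m + 1)" if x: "x \<in> A" for x
    proof -
      have "\<bar>f x\<bar> \<le> C * N x powi m" using C x by (rule bspec)
      also have "\<dots> \<le> \<bar>C\<bar> * N x powi m" using N1[OF x] by (intro mult_right_mono) auto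
      also have "\<dots> \<le> \<bar>C\<bar> * N x powi (m + 1)"
        using N1[OF x] by (intro mult_left_mono power_int_increasing) auto
      finally show ?thesis .
    qed
    then show ?thesis by (intro exI ballI)
  qed
  {
    case 0
    then show ?case using base by simp
  next
    case (Suc n)
    have "decays A N n (m + 1 - 1) (pd i f)" for i
      using Suc.IH[of "m - 1" "pd i f"] Suc.prems by simp
    moreover have "\<exists>C. \<forall>x\<in>A. \<bar>f x\<bar> \<le> C * N x powi (m + 1)"
      by (rule base[OF decays_0D[OF Suc.prems]])
    ultimately show ?case by simp
  }
qed

lemma decays_add:
  assumes "smooth_on S f" "smooth_on S g" "decays A N n m f" "decays A N n m g"
  shows "decays A N n m (\<lambda>x. f x + g x)"
  using assms
proof (induction n arbitrary: m f g)
  have base: "\<exists>C. \<forall>x\<in>A. \<bar>f x + g x\<bar> \<le> C * N x powi m"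
    if f: "\<exists>C. \<forall>x\<in>A. \<bar>f x\<bar> \<le> C * N x powi m" and g: "\<exists>C. \<forall>x\<in>A. \<bar>g x\<bar> \<le> C * N x powi m" for f g m
  proof -
    obtain C where C: "\<forall>x\<in>A. \<bar>f x\<bar> \<le> C * N x powi m" using f by (elim exE)
    obtain D where D: "\<forall>x\<in>A. \<bar>g x\<bar> \<le> D * N x powi m" using g by (elim exE)
    have "\<bar>f x + g x\<bar> \<le> (C + D) * N x powi m" if "x \<in> A" for x
      using abs_triangle_ineq[of "f x" "g x"] bspec[OF C that] bspec[OF D that] unfolding distrib_right by linarith
    then show ?thesis by (intro exI ballI)
  qed
  {
    case 0
    then show ?case using base by simp
  next
    case (Suc n)
    have "\<exists>C. \<forall>x\<in>A. \<bar>f x + g x\<bar> \<le> C * N x powi m"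
      by (rule base[OF decays_0D[OF Suc.prems(3)] decays_0D[OF Suc.prems(4)]])
    moreover have "decays A N n (m - 1) (pd i (\<lambda>x. f x + g x))" for i
    proof (rule decays_cong)
      show "decays A N n (m - 1) (\<lambda>x. pd i f x + pd i g x)"
        using Suc.prems by (intro Suc.IH smooth_on_pd) simp_all
      show "pd i f x + pd i g x = pd i (\<lambda>x. f x + g x) x" if "x \<in> S" for x
        by (rule pd_add[symmetric]) (intro smooth_on_differentiable[OF _ that] Suc.prems)+
    qed
    ultimately show ?case by simp
  }
qed

lemma decays_mult:
  assumes "smooth_on S f" "smooth_on S g" "decays A N n m f" "decays A N n k g"
  shows "decays A N n (m + k) (\<lambda>x. f x * g x)"
proof -
  have base: "\<exists>C. \<forall>x\<in>A. \<bar>f x * g x\<bar> \<le> C * N x powi (m + k)"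
    if bf: "\<exists>C. \<forall>x\<in>A. \<bar>f x\<bar> \<le> C * N x powi m" and bg: "\<exists>C. \<forall>x\<in>A. \<bar>g x\<bar> \<le> C * N x powi k" for f g m k
  proof -
    obtain C where C: "\<forall>x\<in>A. \<bar>f x\<bar> \<le> C * N x powi m" using bf by (elim exE)
    obtain D where D: "\<forall>x\<in>A. \<bar>g x\<bar> \<le> D * N x powi k" using bg by (elim exE)
    have "\<bar>f x * g x\<bar> \<le> (C * D) * N x powi (m + k)" if "x \<in> A" for x
    proof -
      have n: "N x \<noteq> 0" using N1[OF that] by auto
      have f: "\<bar>f x\<bar> \<le> C * N x powi m" and g: "\<bar>g x\<bar> \<le> D * N x powi k" using bspec[OF C that] bspec[OF D that] .
      have "\<bar>f x\<bar> * \<bar>g x\<bar> \<le> (C * N x powi m) * (D * N x powi k)"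
        by (rule mult_mono[OF f g order_trans[OF abs_ge_zero f] abs_ge_zero])
      then show ?thesis using n by (simp add: abs_mult power_int_add ac_simps)
    qed
    then show ?thesis by (intro exI ballI)
  qed
  show ?thesis using assms
  proof (induction n arbitrary: m k f g)
    case 0
    then show ?case using base by simp
  next
    case (Suc n)
    have "\<exists>C. \<forall>x\<in>A. \<bar>f x * g x\<bar> \<le> C * N x powi (m + k)"
      by (rule base[OF decays_0D[OF Suc.prems(3)] decays_0D[OF Suc.prems(4)]])
    moreover have "decays A N n (m + k - 1) (pd i (\<lambda>x. f x * g x))" for i
    proof (rule decays_cong)
      have 1: "decays A N n (m + (k - 1)) (\<lambda>x. f x * pd i g x)"
        by (rule Suc.IH[OF Suc.prems(1) smooth_on_pd[OF Suc.prems(2)] decays_SucD[OF Suc.prems(3)]])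
           (use Suc.prems(4) in simp)
      have 2: "decays A N n (m - 1 + k) (\<lambda>x. pd i f x * g x)"
        by (rule Suc.IH[OF smooth_on_pd[OF Suc.prems(1)] Suc.prems(2) _ decays_SucD[OF Suc.prems(4)]])
           (use Suc.prems(3) in simp)
      have e: "m + (k - 1) = m + k - 1" "m - 1 + k = m + k - 1" by simp_all
      show "decays A N n (m + k - 1) (\<lambda>x. f x * pd i g x + pd i f x * g x)"
        by (rule decays_add[OF _ _ 1[unfolded e(1)] 2[unfolded e(2)]])
           (intro smooth_on_mult open_S smooth_on_pd Suc.prems)+
      show "f x * pd i g x + pd i f x * g x = pd i (\<lambda>x. f x * g x) x" if "x \<in> S" for x
        by (rule pd_mult[symmetric]) (intro smooth_on_differentiable[OF _ that] Suc.prems)+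
    qed
    ultimately show ?case by simp
  qed
qed

lemma decays_zero: "decays A N n m (\<lambda>x. 0)"
  by (induction n arbitrary: m) (auto intro!: exI[of _ 0])

lemma decays_const: "decays A N n 0 (\<lambda>x. c)"
  by (cases n) (auto intro!: exI[of _ "\<bar>c\<bar>"] simp: decays_zero)

lemma decays_cmult:
  assumes "smooth_on S f" "decays A N n m f" shows "decays A N n m (\<lambda>x. c * f x)"
  using decays_mult[OF smooth_on_const assms(1) decays_const assms(2), of c] by simp

lemma decays_diff:
  assumes "smooth_on S f" "smooth_on S g" "decays A N n m f" "decays A N n m g"
  shows "decays A N n m (\<lambda>x. f x - g x)"
  using decays_add[OF assms(1) _ assms(3) decays_cmult[OF assms(2,4), of "-1"]] smooth_on_minus[OF open_S assms(2)] by simp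

lemma decays_pd: "decays A N (Suc n) m f \<Longrightarrow> decays A N n (m - 1) (pd i f)"
  by simp

lemma decays_nth:
  assumes "\<And>x. x \<in> A \<Longrightarrow> \<bar>x $ i - c\<bar> \<le> C * N x"
  shows "decays A N n 1 (\<lambda>x. x $ i - c)"
proof (cases n)
  case 0
  then show ?thesis using assms by (auto intro!: exI[of _ C])
next
  case (Suc k)
  have "pd j (\<lambda>x. x $ i - c) = (\<lambda>x. if j = i then 1 else 0)" for j
    by (rule ext) (subst pd_diff, auto simp: pd_nth bounded_linear_imp_differentiable bounded_linear_vec_nth)
  then show ?thesis using assms Suc by (auto intro!: exI[of _ C] simp: decays_const)
qed

end

section \<open>The harmonic building blocks\<close>

text \<open>With \<sigma> = 1 or -1, \<open>sqd\<close>, \<open>invr\<close> and \<open>logr\<close>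
  refer to the pole (p, q, -\<sigma> a): \<sigma> = -1 gives the source itself and \<sigma> = 1 its
  mirror image. \<open>ht\<close> is the height measured from that pole, positive on the side
  containing the interface.\<close>

definition ht :: "real \<Rightarrow> real \<Rightarrow> real^3 \<Rightarrow> real" where
  "ht \<sigma> a x = \<sigma> * x $ 3 + a"

definition sqd :: "real \<Rightarrow> real \<Rightarrow> real \<Rightarrow> real \<Rightarrow> real^3 \<Rightarrow> real" where
  "sqd p q \<sigma> a x = (x $ 1 - p)\<^sup>2 + (x $ 2 - q)\<^sup>2 + (ht \<sigma> a x)\<^sup>2"

definition invr :: "real \<Rightarrow> real \<Rightarrow> real \<Rightarrow> real \<Rightarrow> real^3 \<Rightarrow> real" where
  "invr p q \<sigma> a x = inverse (sqrt (sqd p q \<sigma> a x))"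

text \<open>The classical potential ln(R + z), a vertical primitive of the pole up to sign. It is
  singular on the whole half-line behind the pole, hence the condition ht > 0 in its lemmas.\<close>

definition logr :: "real \<Rightarrow> real \<Rightarrow> real \<Rightarrow> real \<Rightarrow> real^3 \<Rightarrow> real" where
  "logr p q \<sigma> a x = ln (sqrt (sqd p q \<sigma> a x) + ht \<sigma> a x)"

text \<open>Occurs in the horizontal derivatives of \<open>logr\<close>. Its own derivatives are
  products of itself with those of \<open>logr\<close> (\<open>pd_invs\<close>), so the family is
  closed under differentiation.\<close>

definition invs :: "real \<Rightarrow> real \<Rightarrow> real \<Rightarrow> real \<Rightarrow> real^3 \<Rightarrow> real" where
  "invs p q \<sigma> a x = inverse (sqrt (sqd p q \<sigma> a x) + ht \<sigma> a x)"

definition coord :: "real \<Rightarrow> real \<Rightarrow> real \<Rightarrow> real \<Rightarrow> 3 \<Rightarrow> real^3 \<Rightarrow> real" where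
  "coord p q \<sigma> a i x = (if i = 1 then x $ 1 - p else if i = 2 then x $ 2 - q else x $ 3 + \<sigma> * a)"

lemma smooth_on_ht: "open S \<Longrightarrow> smooth_on S (ht \<sigma> a)"
  unfolding ht_def[abs_def] by (intro smooth_on_intros smooth_on_const)

lemma smooth_on_sqd: "open S \<Longrightarrow> smooth_on S (sqd p q \<sigma> a)"
  unfolding sqd_def[abs_def] by (intro smooth_on_intros smooth_on_const smooth_on_ht)

lemma smooth_on_coord: "open S \<Longrightarrow> smooth_on S (coord p q \<sigma> a i)"
proof -
  assume S: "open S"
  have "smooth_on S (\<lambda>x. x $ 1 - p)" "smooth_on S (\<lambda>x. x $ 2 - q)" "smooth_on S (\<lambda>x. x $ 3 + \<sigma> * a)"
    using S by (intro smooth_on_intros smooth_on_const; simp)+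
  moreover have "i = 1 \<or> i = 2 \<or> i = 3" by (rule exhaust_3)
  ultimately show ?thesis by (auto simp: coord_def[abs_def])
qed

lemma differentiable_nth [simp]: "(\<lambda>x::real^'n. x $ i) differentiable (at x)"
  by (intro bounded_linear_imp_differentiable bounded_linear_vec_nth)

lemma pd_coord: "pd j (coord p q \<sigma> a i) x = (if i = j then 1 else 0)"
proof -
  have "pd j (\<lambda>x. x $ 1 - p) x = (if j = 1 then 1 else 0)" "pd j (\<lambda>x. x $ 2 - q) x = (if j = 2 then 1 else 0)"
    "pd j (\<lambda>x. x $ 3 + \<sigma> * a) x = (if j = 3 then 1 else 0)"
    by (simp_all add: pd_diff pd_add pd_nth)
  moreover have "i = 1 \<or> i = 2 \<or> i = 3" by (rule exhaust_3)
  ultimately show ?thesis by (auto simp: coord_def[abs_def])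
qed

lemma ht_coord: "\<sigma>\<^sup>2 = 1 \<Longrightarrow> ht \<sigma> a x = \<sigma> * coord p q \<sigma> a 3 x"
  by (simp add: ht_def coord_def distrib_left power2_eq_square mult.assoc[symmetric])

lemma ht_coord_sq: "\<sigma>\<^sup>2 = 1 \<Longrightarrow> (ht \<sigma> a x)\<^sup>2 = (coord p q \<sigma> a 3 x)\<^sup>2"
  by (simp add: ht_coord[of \<sigma> a x p q] power_mult_distrib)

lemma sqd_coord:
  assumes "\<sigma>\<^sup>2 = 1" shows "sqd p q \<sigma> a x = (coord p q \<sigma> a 1 x)\<^sup>2 + (coord p q \<sigma> a 2 x)\<^sup>2 + (coord p q \<sigma> a 3 x)\<^sup>2"
  using ht_coord_sq[OF assms, of a x p q] by (simp add: sqd_def coord_def)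

lemma pd_power2: "f differentiable (at x) \<Longrightarrow> pd i (\<lambda>x. (f x)\<^sup>2) x = 2 * f x * pd i f x"
  using pd_mult[of f x f i] by (simp add: power2_eq_square)

lemma pd_sqd:
  assumes "\<sigma>\<^sup>2 = 1" shows "pd j (sqd p q \<sigma> a) x = 2 * coord p q \<sigma> a j x"
proof -
  have d: "coord p q \<sigma> a i differentiable (at x)" for i
    by (rule smooth_on_differentiable[OF smooth_on_coord[OF open_UNIV] UNIV_I])
  have d2: "(\<lambda>x. (coord p q \<sigma> a i x)\<^sup>2) differentiable (at x)" for i
    by (rule smooth_on_differentiable[OF smooth_on_power[OF open_UNIV smooth_on_coord[OF open_UNIV]] UNIV_I])
  have e: "sqd p q \<sigma> a = (\<lambda>x. (coord p q \<sigma> a 1 x)\<^sup>2 + (coord p q \<sigma> a 2 x)\<^sup>2 + (coord p q \<sigma> a 3 x)\<^sup>2)"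
    by (rule ext) (rule sqd_coord[OF assms])
  have j: "j = 1 \<or> j = 2 \<or> j = 3" by (rule exhaust_3)
  show ?thesis unfolding e
    by (subst pd_add[OF differentiable_add[OF d2 d2] d2], subst pd_add[OF d2 d2])
       (use j in \<open>auto simp: pd_power2[OF d] pd_coord\<close>)
qed

lemma open_sqd_pos: "open {x. 0 < sqd p q \<sigma> a x}"
  unfolding sqd_def ht_def by (intro open_Collect_less continuous_intros)

lemma open_ht_pos: "open {x. 0 < ht \<sigma> a x}"
  unfolding ht_def by (intro open_Collect_less continuous_intros)

lemma DERIV_inverse_sqrt:
  assumes "0 < t"
  shows "((\<lambda>t. inverse (sqrt t)) has_real_derivative - (inverse (sqrt t) ^ 3) / 2) (at t)"
proof -
  have "((\<lambda>t. inverse (sqrt t)) has_real_derivative - (inverse (sqrt t) * (inverse (sqrt t) / 2) * inverse (sqrt t))) (at t)"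
    using assms by (intro DERIV_inverse' DERIV_real_sqrt) auto
  then show ?thesis by (simp add: power3_eq_cube)
qed

lemma has_derivative_chain_real:
  assumes "(h has_real_derivative h') (at (f x))" "f differentiable (at x)"
  shows "((\<lambda>x. h (f x)) has_derivative (\<lambda>v. h' * frechet_derivative f (at x) v)) (at x)"
  using has_derivative_compose[OF frechet_derivative_worksI[OF assms(2)] assms(1)[unfolded has_field_derivative_def]] .

text \<open>The derivative contains the cube of the function itself, which is the situation handled
  by \<open>smooth_on_bootstrap\<close>.\<close>

lemma smooth_on_inverse_sqrt:
  fixes f :: "'a::euclidean_space \<Rightarrow> real"
  assumes "open S" "smooth_on S f" "\<And>x. x \<in> S \<Longrightarrow> 0 < f x"
  shows "smooth_on S (\<lambda>x. inverse (sqrt (f x)))"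
proof (rule smooth_on_bootstrap[OF assms(1)])
  show "((\<lambda>x. inverse (sqrt (f x))) has_derivative (\<lambda>v. - (inverse (sqrt (f x)) ^ 3) / 2 * frechet_derivative f (at x) v)) (at x)"
    if "x \<in> S" for x
    by (rule has_derivative_chain_real[OF DERIV_inverse_sqrt[OF assms(3)[OF that]] smooth_on_differentiable[OF assms(2) that]])
next
  fix k v assume *: "Ck_on k S (\<lambda>x. inverse (sqrt (f x)))"
  have "Ck_on k S (\<lambda>x. (inverse (sqrt (f x)) * (inverse (sqrt (f x)) * inverse (sqrt (f x)))) * (- 1 / 2 * frechet_derivative f (at x) v))"
    by (intro Ck_on_bilinear[OF bounded_bilinear_mult] assms(1) * Ck_on_const smooth_onD smooth_on_frechet assms(2))
  then show "Ck_on k S (\<lambda>x. - (inverse (sqrt (f x)) ^ 3) / 2 * frechet_derivative f (at x) v)"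
    by (simp add: power3_eq_cube mult.assoc)
qed

lemma smooth_on_ln:
  fixes f :: "'a::euclidean_space \<Rightarrow> real"
  assumes "open S" "smooth_on S f" "\<And>x. x \<in> S \<Longrightarrow> 0 < f x"
  shows "smooth_on S (\<lambda>x. ln (f x))"
proof (rule smooth_on_bootstrap[OF assms(1)])
  show "((\<lambda>x. ln (f x)) has_derivative (\<lambda>v. inverse (f x) * frechet_derivative f (at x) v)) (at x)"
    if "x \<in> S" for x
    using has_derivative_chain_real[OF DERIV_ln[OF assms(3)[OF that]] smooth_on_differentiable[OF assms(2) that]] .
next
  fix k v
  have "smooth_on S (\<lambda>x. inverse (f x))"
    by (rule smooth_on_compose[OF assms(1) smooth_on_inverse assms(2)]) (simp add: assms(3))
  then show "Ck_on k S (\<lambda>x. inverse (f x) * frechet_derivative f (at x) v)"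
    by (intro Ck_on_bilinear[OF bounded_bilinear_mult] assms(1) smooth_onD smooth_on_frechet assms(2))
qed

lemma smooth_on_invr: "open S \<Longrightarrow> S \<subseteq> {x. 0 < sqd p q \<sigma> a x} \<Longrightarrow> smooth_on S (invr p q \<sigma> a)"
  unfolding invr_def[abs_def] by (intro smooth_on_inverse_sqrt smooth_on_sqd) auto

lemma pd_invr:
  assumes "\<sigma>\<^sup>2 = 1" "0 < sqd p q \<sigma> a x"
  shows "pd i (invr p q \<sigma> a) x = - (coord p q \<sigma> a i x * invr p q \<sigma> a x ^ 3)"
proof -
  have "pd i (invr p q \<sigma> a) x = - (inverse (sqrt (sqd p q \<sigma> a x)) ^ 3) / 2 * pd i (sqd p q \<sigma> a) x"
    unfolding invr_def[abs_def]
    by (rule pd_compose[OF DERIV_inverse_sqrt[OF assms(2)] smooth_on_differentiable[OF smooth_on_sqd[OF open_UNIV] UNIV_I]])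
  then show ?thesis unfolding pd_sqd[OF assms(1)] invr_def by simp
qed

lemma sqd_pos_of_ht: "0 < ht \<sigma> a x \<Longrightarrow> 0 < sqd p q \<sigma> a x"
  unfolding sqd_def by (simp add: add_nonneg_pos)

lemma sqrt_sqd: "0 < sqd p q \<sigma> a x \<Longrightarrow> sqrt (sqd p q \<sigma> a x) = sqd p q \<sigma> a x * invr p q \<sigma> a x"
  unfolding invr_def by (simp add: real_div_sqrt divide_inverse[symmetric])

lemma sqd_invr: "0 < sqd p q \<sigma> a x \<Longrightarrow> sqd p q \<sigma> a x * invr p q \<sigma> a x ^ 2 = 1"
  unfolding invr_def by (simp add: power_inverse)

lemma smooth_on_sqrt_sqd: "open S \<Longrightarrow> S \<subseteq> {x. 0 < sqd p q \<sigma> a x} \<Longrightarrow> smooth_on S (\<lambda>x. sqrt (sqd p q \<sigma> a x))"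
  by (rule smooth_on_cong[OF _ smooth_on_mult[OF _ smooth_on_sqd smooth_on_invr]]) (auto simp: sqrt_sqd)

lemma smooth_on_rad_ht: "open S \<Longrightarrow> S \<subseteq> {x. 0 < ht \<sigma> a x} \<Longrightarrow> smooth_on S (\<lambda>x. sqrt (sqd p q \<sigma> a x) + ht \<sigma> a x)"
  by (intro smooth_on_add smooth_on_sqrt_sqd smooth_on_ht) (auto dest!: sqd_pos_of_ht)

lemma rad_ht_pos: "0 < ht \<sigma> a x \<Longrightarrow> 0 < sqrt (sqd p q \<sigma> a x) + ht \<sigma> a x"
  using sqd_pos_of_ht[of \<sigma> a x p q] by (simp add: add_pos_pos)

lemma smooth_on_logr: "open S \<Longrightarrow> S \<subseteq> {x. 0 < ht \<sigma> a x} \<Longrightarrow> smooth_on S (logr p q \<sigma> a)"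
  unfolding logr_def[abs_def] by (intro smooth_on_ln smooth_on_rad_ht) (auto intro: rad_ht_pos)

lemma smooth_on_invs: "open S \<Longrightarrow> S \<subseteq> {x. 0 < ht \<sigma> a x} \<Longrightarrow> smooth_on S (invs p q \<sigma> a)"
  unfolding invs_def[abs_def]
  by (intro smooth_on_compose[OF _ smooth_on_inverse] smooth_on_rad_ht) (auto intro: rad_ht_pos)

lemma pd_ht: "pd i (ht \<sigma> a) x = (if i = 3 then \<sigma> else 0)"
  unfolding ht_def[abs_def] by (subst pd_add) (simp_all add: pd_cmult pd_nth differentiable_mult)

lemma pd_rad_ht:
  assumes s: "\<sigma>\<^sup>2 = 1" and x: "0 < ht \<sigma> a x"
  shows "pd i (\<lambda>x. sqrt (sqd p q \<sigma> a x) + ht \<sigma> a x) x = coord p q \<sigma> a i x * invr p q \<sigma> a x + (if i = 3 then \<sigma> else 0)"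
proof -
  let ?S = "{x. 0 < sqd p q \<sigma> a x}"
  have x0: "0 < sqd p q \<sigma> a x" by (rule sqd_pos_of_ht[OF x])
  have d: "(\<lambda>x. sqrt (sqd p q \<sigma> a x)) differentiable (at x)"
    by (rule smooth_on_differentiable[OF smooth_on_sqrt_sqd[OF open_sqd_pos order_refl]]) (simp add: x0)
  have d2: "ht \<sigma> a differentiable (at x)" by (rule smooth_on_differentiable[OF smooth_on_ht[OF open_UNIV] UNIV_I])
  have "pd i (\<lambda>x. sqrt (sqd p q \<sigma> a x)) x = inverse (sqrt (sqd p q \<sigma> a x)) / 2 * pd i (sqd p q \<sigma> a) x"
    by (rule pd_compose[OF DERIV_real_sqrt[OF x0] smooth_on_differentiable[OF smooth_on_sqd[OF open_UNIV] UNIV_I]])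
  then have "pd i (\<lambda>x. sqrt (sqd p q \<sigma> a x)) x = coord p q \<sigma> a i x * invr p q \<sigma> a x"
    unfolding pd_sqd[OF s] invr_def by simp
  then show ?thesis by (subst pd_add[OF d d2]) (simp add: pd_ht)
qed

lemma rad_ht_invs: "0 < ht \<sigma> a x \<Longrightarrow> invs p q \<sigma> a x * (sqrt (sqd p q \<sigma> a x) + ht \<sigma> a x) = 1"
  using rad_ht_pos[of \<sigma> a x p q] by (simp add: invs_def)

text \<open>For i = 3 the numerator z/R + 1 = (R + z)/R cancels the factor 1/(R + z), leaving the
  pole up to the sign \<sigma>.\<close>

lemma pd_logr:
  assumes s: "\<sigma>\<^sup>2 = 1" and x: "0 < ht \<sigma> a x"
  shows "pd i (logr p q \<sigma> a) x = (if i = 3 then \<sigma> * invr p q \<sigma> a x else coord p q \<sigma> a i x * invr p q \<sigma> a x * invs p q \<sigma> a x)"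
proof -
  have d: "(\<lambda>x. sqrt (sqd p q \<sigma> a x) + ht \<sigma> a x) differentiable (at x)"
    by (rule smooth_on_differentiable[OF smooth_on_rad_ht[OF open_ht_pos order_refl]]) (simp add: x)
  have "pd i (logr p q \<sigma> a) x = inverse (sqrt (sqd p q \<sigma> a x) + ht \<sigma> a x) * pd i (\<lambda>x. sqrt (sqd p q \<sigma> a x) + ht \<sigma> a x) x"
    unfolding logr_def[abs_def] by (rule pd_compose[OF DERIV_ln[OF rad_ht_pos[OF x]] d])
  then have e: "pd i (logr p q \<sigma> a) x = invs p q \<sigma> a x * (coord p q \<sigma> a i x * invr p q \<sigma> a x + (if i = 3 then \<sigma> else 0))"
    unfolding pd_rad_ht[OF s x] invs_def .
  show ?thesis
  proof (cases "i = 3")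
    case True
    have x0: "0 < sqd p q \<sigma> a x" by (rule sqd_pos_of_ht[OF x])
    have c: "coord p q \<sigma> a 3 x = \<sigma> * ht \<sigma> a x" using s by (simp add: ht_coord[OF s, of a x p q] power2_eq_square mult.assoc[symmetric])
    have r: "sqrt (sqd p q \<sigma> a x) * invr p q \<sigma> a x = 1" using x0 by (simp add: invr_def)
    have "coord p q \<sigma> a 3 x * invr p q \<sigma> a x + \<sigma> = \<sigma> * invr p q \<sigma> a x * (sqrt (sqd p q \<sigma> a x) + ht \<sigma> a x)"
      using r by (simp add: c algebra_simps)
    then show ?thesis using True e rad_ht_invs[OF x, of p q] by simp
  qed (simp add: e)
qed

lemma pd_invs:
  assumes s: "\<sigma>\<^sup>2 = 1" and x: "0 < ht \<sigma> a x"
  shows "pd i (invs p q \<sigma> a) x = - (invs p q \<sigma> a x * pd i (logr p q \<sigma> a) x)"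
proof -
  have d: "(\<lambda>x. sqrt (sqd p q \<sigma> a x) + ht \<sigma> a x) differentiable (at x)"
    by (rule smooth_on_differentiable[OF smooth_on_rad_ht[OF open_ht_pos order_refl]]) (simp add: x)
  have p: "sqrt (sqd p q \<sigma> a x) + ht \<sigma> a x \<noteq> 0" using rad_ht_pos[OF x, of p q] by simp
  have "pd i (logr p q \<sigma> a) x = inverse (sqrt (sqd p q \<sigma> a x) + ht \<sigma> a x) * pd i (\<lambda>x. sqrt (sqd p q \<sigma> a x) + ht \<sigma> a x) x"
    unfolding logr_def[abs_def] by (rule pd_compose[OF DERIV_ln[OF rad_ht_pos[OF x]] d])
  moreover have "pd i (invs p q \<sigma> a) x = - (inverse (sqrt (sqd p q \<sigma> a x) + ht \<sigma> a x) ^ Suc (Suc 0)) * pd i (\<lambda>x. sqrt (sqd p q \<sigma> a x) + ht \<sigma> a x) x"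
    unfolding invs_def[abs_def] by (rule pd_compose[OF DERIV_inverse[OF p] d])
  ultimately show ?thesis by (simp add: invs_def)
qed

lemma pd2_invr:
  assumes s: "\<sigma>\<^sup>2 = 1" and x: "0 < sqd p q \<sigma> a x"
  shows "pd j (pd i (invr p q \<sigma> a)) x = (if i = j then - (invr p q \<sigma> a x ^ 3) else 0)
    + 3 * coord p q \<sigma> a i x * coord p q \<sigma> a j x * invr p q \<sigma> a x ^ 5"
proof -
  let ?S = "{x. 0 < sqd p q \<sigma> a x}" and ?b = "invr p q \<sigma> a" and ?c = "coord p q \<sigma> a"
  have sb: "smooth_on ?S ?b" by (rule smooth_on_invr[OF open_sqd_pos order_refl])
  have db: "?b differentiable (at x)" "(\<lambda>x. ?b x ^ 3) differentiable (at x)"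
    using smooth_on_differentiable[OF sb, of x] smooth_on_differentiable[OF smooth_on_power[OF open_sqd_pos sb], of x] x by simp_all
  have dc: "?c i differentiable (at x)" for i by (rule smooth_on_differentiable[OF smooth_on_coord[OF open_UNIV] UNIV_I])
  have "pd j (pd i ?b) x = pd j (\<lambda>x. - (?c i x * ?b x ^ 3)) x"
    by (rule pd_cong[OF open_sqd_pos]) (use x pd_invr[OF s] in auto)
  also have "\<dots> = - (?c i x * pd j (\<lambda>x. ?b x ^ 3) x + pd j (?c i) x * ?b x ^ 3)"
    by (subst pd_minus[OF differentiable_mult[OF dc db(2)]], subst pd_mult[OF dc db(2)]) (rule refl)
  also have "pd j (\<lambda>x. ?b x ^ 3) x = 3 * ?b x ^ 2 * pd j ?b x"
    by (rule pd_compose[OF _ db(1)]) (auto intro!: derivative_eq_intros)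
  also have "pd j ?b x = - (?c j x * ?b x ^ 3)" by (rule pd_invr[OF s x])
  finally show ?thesis by (auto simp: pd_coord power2_eq_square power_numeral_reduce algebra_simps)
qed

lemma lap_invr:
  assumes s: "\<sigma>\<^sup>2 = 1" and x: "0 < sqd p q \<sigma> a x"
  shows "lap (invr p q \<sigma> a) x = 0"
proof -
  let ?b = "invr p q \<sigma> a"
  have "lap ?b x = - 3 * ?b x ^ 3 + 3 * (sqd p q \<sigma> a x * ?b x ^ 2) * ?b x ^ 3"
    unfolding lap_def pd2_invr[OF s x] sqd_coord[OF s] by (simp add: power2_eq_square power_numeral_reduce algebra_simps)
  then show ?thesis unfolding sqd_invr[OF x] by simp
qed

lemma pd_pd3_logr:
  assumes s: "\<sigma>\<^sup>2 = 1" and x: "0 < ht \<sigma> a x"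
  shows "pd 3 (pd i (logr p q \<sigma> a)) x = \<sigma> * pd i (invr p q \<sigma> a) x"
proof -
  have d: "invr p q \<sigma> a differentiable (at x)"
    using smooth_on_differentiable[OF smooth_on_invr[OF open_sqd_pos order_refl], of x] sqd_pos_of_ht[OF x] by simp
  have "pd 3 (pd i (logr p q \<sigma> a)) x = pd i (pd 3 (logr p q \<sigma> a)) x"
    by (rule pd_commute[OF open_ht_pos _ smooth_on_logr[OF open_ht_pos order_refl]]) (simp add: x)
  also have "\<dots> = pd i (\<lambda>x. \<sigma> * invr p q \<sigma> a x) x"
    by (rule pd_cong[OF open_ht_pos]) (use x pd_logr[OF s] in auto)
  also have "\<dots> = \<sigma> * pd i (invr p q \<sigma> a) x" by (rule pd_cmult[OF d])
  finally show ?thesis .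
qed

lemma lap_logr:
  assumes s: "\<sigma>\<^sup>2 = 1" and x: "0 < ht \<sigma> a x"
  shows "lap (logr p q \<sigma> a) x = 0"
proof -
  let ?S = "{x. 0 < ht \<sigma> a x}" and ?b = "invr p q \<sigma> a" and ?c = "coord p q \<sigma> a" and ?E = "invs p q \<sigma> a"
  let ?r = "sqrt (sqd p q \<sigma> a x)" and ?z = "ht \<sigma> a x"
  have x0: "0 < sqd p q \<sigma> a x" by (rule sqd_pos_of_ht[OF x])
  have db: "?b differentiable (at x)"
    using smooth_on_differentiable[OF smooth_on_invr[OF open_sqd_pos order_refl], of x] x0 by simp
  have dE: "?E differentiable (at x)"
    using smooth_on_differentiable[OF smooth_on_invs[OF open_ht_pos order_refl], of x] x by simp
  have dc: "?c i differentiable (at x)" for i by (rule smooth_on_differentiable[OF smooth_on_coord[OF open_UNIV] UNIV_I])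
  have k: "pd i (pd i (logr p q \<sigma> a)) x = ?b x * ?E x - (?c i x)\<^sup>2 * (?b x ^ 2 * ?E x ^ 2 + ?b x ^ 3 * ?E x)"
    if "i \<noteq> 3" for i
  proof -
    have "pd i (pd i (logr p q \<sigma> a)) x = pd i (\<lambda>x. ?c i x * ?b x * ?E x) x"
      by (rule pd_cong[OF open_ht_pos]) (use x pd_logr[OF s] that in auto)
    also have "\<dots> = (?c i x * ?b x) * pd i ?E x + (?c i x * pd i ?b x + pd i (?c i) x * ?b x) * ?E x"
      by (subst pd_mult[OF differentiable_mult[OF dc db] dE], subst pd_mult[OF dc db]) (rule refl)
    finally show ?thesis
      unfolding pd_invs[OF s x] pd_logr[OF s x] pd_invr[OF s x0] pd_coord using that
      by (simp add: power2_eq_square power3_eq_cube algebra_simps)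
  qed
  have 3: "pd 3 (pd 3 (logr p q \<sigma> a)) x = - (?z * ?b x ^ 3)"
  proof -
    have "pd 3 (pd 3 (logr p q \<sigma> a)) x = pd 3 (\<lambda>x. \<sigma> * ?b x) x"
      by (rule pd_cong[OF open_ht_pos]) (use x pd_logr[OF s] in auto)
    also have "\<dots> = \<sigma> * pd 3 ?b x" by (rule pd_cmult[OF db])
    finally show ?thesis unfolding pd_invr[OF s x0] ht_coord[OF s, of a x p q] by simp
  qed
  have R: "?b x * ?r = 1" using x0 by (simp add: invr_def)
  have E: "?E x * (?r + ?z) = 1" by (rule rad_ht_invs[OF x])
  \<comment> \<open>The squared horizontal distance factors as (R - z)(R + z), and the second factor
    cancels a power of \<open>invs\<close>.\<close>
  have Q: "(?c 1 x)\<^sup>2 + (?c 2 x)\<^sup>2 = ?r\<^sup>2 - ?z\<^sup>2"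
    using x0 sqd_coord[OF s, of p q a x] ht_coord_sq[OF s, of a x p q] by simp
  have "lap (logr p q \<sigma> a) x = 2 * (?b x * ?E x) - ((?c 1 x)\<^sup>2 + (?c 2 x)\<^sup>2) * (?b x ^ 2 * ?E x ^ 2 + ?b x ^ 3 * ?E x) - ?z * ?b x ^ 3"
    unfolding lap_def 3 using k[of 1] k[of 2] by (simp add: algebra_simps)
  also have "\<dots> = 0" unfolding Q using R E by algebra
  finally show ?thesis .
qed

section \<open>Decay of the building blocks away from the poles\<close>

definition rad :: "real \<Rightarrow> real \<Rightarrow> real^3 \<Rightarrow> real" where
  "rad p q x = sqrt (sqd p q 1 0 x)"

lemma rad_sq: "(rad p q x)\<^sup>2 = (x $ 1 - p)\<^sup>2 + (x $ 2 - q)\<^sup>2 + (x $ 3)\<^sup>2"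
  by (simp add: rad_def sqd_def ht_def)

lemma rad_nonneg: "0 \<le> rad p q x"
  by (simp add: rad_def sqd_def)

lemma coord_le_rad: "\<bar>x $ 1 - p\<bar> \<le> rad p q x" "\<bar>x $ 2 - q\<bar> \<le> rad p q x" "\<bar>x $ 3\<bar> \<le> rad p q x"
  by (intro abs_le_square_iff[THEN iffD2, of _ "rad p q x", unfolded abs_of_nonneg[OF rad_nonneg]];
      simp add: rad_sq)+

text \<open>\<open>rad\<close> is the distance to the foot point (p, q, 0). The poles at heights a
  and -a are within a \<le> rad/2 of that point, so at least rad/2 remains.\<close>

lemma sqd_ge_rad:
  assumes "\<sigma>\<^sup>2 = 1" "0 \<le> a" "2 * a \<le> rad p q x"
  shows "rad p q x / 2 \<le> sqrt (sqd p q \<sigma> a x)"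
proof (rule real_le_rsqrt)
  have s: "\<bar>\<sigma>\<bar> = 1" using assms(1) by (auto simp: power2_eq_1_iff)
  have e: "sqd p q \<sigma> a x = (rad p q x)\<^sup>2 + 2 * a * (\<sigma> * x $ 3) + a\<^sup>2"
    unfolding rad_sq sqd_def ht_def using assms(1) by (simp add: power2_eq_square algebra_simps)
  have "\<bar>\<sigma> * x $ 3\<bar> \<le> rad p q x" using coord_le_rad(3)[of x p q] s by (simp add: abs_mult)
  then have "a * - rad p q x \<le> a * (\<sigma> * x $ 3)" using assms(2) by (intro mult_left_mono) auto
  then have "(rad p q x - a)\<^sup>2 \<le> sqd p q \<sigma> a x" unfolding e by (simp add: power2_eq_square algebra_simps)
  moreover have "(rad p q x / 2)\<^sup>2 \<le> (rad p q x - a)\<^sup>2"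
    using assms(2,3) by (intro power_mono) auto
  ultimately show "(rad p q x / 2)\<^sup>2 \<le> sqd p q \<sigma> a x" by linarith
qed

text \<open>\<open>S\<close> is an open set on which the potentials are smooth, \<open>A\<close> a
  subset at distance at least 2a + 1 from the foot point, where rad \<ge> 1 and the poles are
  comparatively near the centre. The sign \<sigma> selects the pole of the logarithm; the source, of
  sign -1, is avoided as well.\<close>

locale far_region =
  fixes p q a \<sigma> :: real and S A :: "(real^3) set"
  assumes a_pos: "0 < a" and sigma: "\<sigma>\<^sup>2 = 1" and open_far: "open S" and S_ht: "S \<subseteq> {x. 0 < ht \<sigma> a x}"
    and S_sqd: "S \<subseteq> {x. 0 < sqd p q (-1) a x}" and A_sub: "A \<subseteq> S" and A_far: "\<And>x. x \<in> A \<Longrightarrow> 2 * a + 1 \<le> rad p q x"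
begin

sublocale decay S A "rad p q"
  using open_far A_sub A_far a_pos by unfold_locales force+

lemma S_sqd': "S \<subseteq> {x. 0 < sqd p q \<sigma> a x}"
  using S_ht sqd_pos_of_ht by fastforce

lemma decays_coord: "decays A (rad p q) n 1 (coord p q \<tau> a i)" if "\<tau>\<^sup>2 = 1"
proof -
  have t: "\<bar>\<tau>\<bar> = 1" using that by (auto simp: power2_eq_1_iff)
  have 3: "\<bar>x $ 3 - (- (\<tau> * a))\<bar> \<le> 2 * rad p q x" if "x \<in> A" for x
  proof -
    have "\<bar>\<tau> * a\<bar> \<le> rad p q x" using A_far[OF that] a_pos t by (simp add: abs_mult)
    then show ?thesis using coord_le_rad(3)[of x p q] by linarith
  qed
  have "decays A (rad p q) n 1 (\<lambda>x. x $ 1 - p)" "decays A (rad p q) n 1 (\<lambda>x. x $ 2 - q)"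
    by (rule decays_nth[of _ _ 1], simp add: coord_le_rad)+
  moreover have "decays A (rad p q) n 1 (\<lambda>x. x $ 3 - (- (\<tau> * a)))"
    by (rule decays_nth[OF 3])
  moreover have "i = 1 \<or> i = 2 \<or> i = 3" by (rule exhaust_3)
  ultimately show ?thesis by (auto simp: coord_def[abs_def])
qed

lemma decays_x3: "decays A (rad p q) n 1 (\<lambda>x. x $ 3 - c)" if "\<bar>c\<bar> \<le> a"
proof (rule decays_nth[of _ _ 2])
  fix x assume "x \<in> A"
  then show "\<bar>x $ 3 - c\<bar> \<le> 2 * rad p q x"
    using coord_le_rad(3)[of x p q] that A_far[of x] a_pos by linarith
qed

lemma inverse_le_rad:
  assumes "x \<in> A" "rad p q x / 2 \<le> t" shows "\<bar>inverse t\<bar> \<le> 2 * rad p q x powi (- 1)"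
proof -
  have r: "0 < rad p q x" using A_far[OF assms(1)] a_pos by linarith
  then have t: "0 < t" using assms(2) by linarith
  have "inverse t \<le> inverse (rad p q x / 2)" using r assms(2) by (intro le_imp_inverse_le) auto
  then show ?thesis using t r by (simp add: power_int_minus field_simps)
qed

lemma decays_invr:
  assumes t: "\<tau>\<^sup>2 = 1" and pos: "S \<subseteq> {x. 0 < sqd p q \<tau> a x}"
  shows "decays A (rad p q) n (-1) (invr p q \<tau> a)"
proof (induction n)
  have b: "\<bar>invr p q \<tau> a x\<bar> \<le> 2 * rad p q x powi (- 1)" if "x \<in> A" for x
    unfolding invr_def using A_far[OF that] a_pos
    by (intro inverse_le_rad[OF that] sqd_ge_rad[OF t]) auto
  {
    case 0
    show ?case using b by auto
  next
    case (Suc n)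
    have sm: "smooth_on S (invr p q \<tau> a)" by (rule smooth_on_invr[OF open_far pos])
    have sc: "smooth_on S (coord p q \<tau> a i)" for i by (rule smooth_on_coord[OF open_far])
    have s2: "smooth_on S (\<lambda>x. invr p q \<tau> a x * invr p q \<tau> a x)" by (intro smooth_on_mult open_far sm)
    have s3: "smooth_on S (\<lambda>x. invr p q \<tau> a x * (invr p q \<tau> a x * invr p q \<tau> a x))" by (intro smooth_on_mult open_far sm)
    have s4: "smooth_on S (\<lambda>x. coord p q \<tau> a i x * (invr p q \<tau> a x * (invr p q \<tau> a x * invr p q \<tau> a x)))" for i
      by (intro smooth_on_mult open_far sm sc)
    have "decays A (rad p q) n (1 + (- 1 + (- 1 + - 1))) (\<lambda>x. coord p q \<tau> a i x * (invr p q \<tau> a x * (invr p q \<tau> a x * invr p q \<tau> a x)))" for i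
      by (rule decays_mult[OF sc s3 decays_coord[OF t] decays_mult[OF sm s2 Suc decays_mult[OF sm sm Suc Suc]]])
    from decays_cmult[OF s4 this, of "-1"]
    have d: "decays A (rad p q) n (- 1 - 1) (\<lambda>x. - 1 * (coord p q \<tau> a i x * (invr p q \<tau> a x * (invr p q \<tau> a x * invr p q \<tau> a x))))" for i
      by simp
    have "decays A (rad p q) n (- 1 - 1) (pd i (invr p q \<tau> a))" for i
      by (rule decays_cong[OF _ d[of i]]) (use pos pd_invr[OF t] in \<open>auto simp: power3_eq_cube\<close>)
    then show ?case using b by auto
  }
qed

text \<open>A derivative of \<open>invs\<close> is a product of \<open>invs\<close> and a derivative
  of \<open>logr\<close>, which in turn is a multiple of \<open>invr\<close> or a product of
  \<open>coord\<close>, \<open>invr\<close> and \<open>invs\<close>; so each order of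
  \<open>invs\<close> yields the next. Only derivatives of \<open>logr\<close> are treated, since
  \<open>logr\<close> itself grows.\<close>

lemma decays_pd_logr_invs:
  shows "decays A (rad p q) n (-1) (invs p q \<sigma> a)" and "decays A (rad p q) n (-1) (pd i (logr p q \<sigma> a))"
proof -
  have sb: "smooth_on S (invr p q \<sigma> a)" by (rule smooth_on_invr[OF open_far S_sqd'])
  have sE: "smooth_on S (invs p q \<sigma> a)" by (rule smooth_on_invs[OF open_far S_ht])
  have sc: "smooth_on S (coord p q \<sigma> a i)" for i by (rule smooth_on_coord[OF open_far])
  have sL: "smooth_on S (pd i (logr p q \<sigma> a))" for i by (rule smooth_on_pd[OF smooth_on_logr[OF open_far S_ht]])
  note db = decays_invr[OF sigma S_sqd']
  have L: "decays A (rad p q) n (-1) (pd i (logr p q \<sigma> a))" if E: "decays A (rad p q) n (-1) (invs p q \<sigma> a)" for n i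
  proof -
    have "decays A (rad p q) n (1 + - 1 + - 1) (\<lambda>x. coord p q \<sigma> a i x * invr p q \<sigma> a x * invs p q \<sigma> a x)"
      by (rule decays_mult[OF smooth_on_mult[OF open_far sc sb] sE decays_mult[OF sc sb decays_coord[OF sigma] db] E])
    moreover have "decays A (rad p q) n (- 1) (\<lambda>x. \<sigma> * invr p q \<sigma> a x)"
      by (rule decays_cmult[OF sb db])
    ultimately have "decays A (rad p q) n (- 1) (if i = 3 then (\<lambda>x. \<sigma> * invr p q \<sigma> a x) else (\<lambda>x. coord p q \<sigma> a i x * invr p q \<sigma> a x * invs p q \<sigma> a x))"
      by simp
    then show ?thesis
      by (rule decays_cong[rotated]) (use S_ht pd_logr[OF sigma] in auto)
  qed
  have E: "decays A (rad p q) n (-1) (invs p q \<sigma> a)" for n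
  proof (induction n)
    have b: "\<bar>invs p q \<sigma> a x\<bar> \<le> 2 * rad p q x powi (- 1)" if "x \<in> A" for x
    proof -
      have "0 < ht \<sigma> a x" using that A_sub S_ht by blast
      moreover have "rad p q x / 2 \<le> sqrt (sqd p q \<sigma> a x)"
        using A_far[OF that] a_pos by (intro sqd_ge_rad[OF sigma]) auto
      ultimately show ?thesis unfolding invs_def by (intro inverse_le_rad[OF that]) auto
    qed
    {
      case 0
      show ?case using b by auto
    next
      case (Suc n)
      have "decays A (rad p q) n (- 1 + - 1) (\<lambda>x. invs p q \<sigma> a x * pd i (logr p q \<sigma> a) x)" for i
        by (rule decays_mult[OF sE sL Suc L[OF Suc]])
      from decays_cmult[OF smooth_on_mult[OF open_far sE sL] this, of "-1"]
      have d: "decays A (rad p q) n (- 1 - 1) (\<lambda>x. - 1 * (invs p q \<sigma> a x * pd i (logr p q \<sigma> a) x))" for i by simp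
      have "decays A (rad p q) n (- 1 - 1) (pd i (invs p q \<sigma> a))" for i
        by (rule decays_cong[OF _ d[of i]]) (use S_ht pd_invs[OF sigma] in auto)
      then show ?case using b by auto
    }
  qed
  show "decays A (rad p q) n (-1) (invs p q \<sigma> a)" by (rule E)
  show "decays A (rad p q) n (-1) (pd i (logr p q \<sigma> a))" by (rule L[OF E])
qed

end

context decay
begin

text \<open>The decay hypothesis concerns the derivatives of \<Psi>, because \<Psi> contains the
  logarithm; displacement and stress involve \<Psi> only through them.\<close>

lemma decays_pn:
  assumes sB: "smooth_on S B" and sP: "smooth_on S \<Psi>"
    and B: "decays A N (Suc n) (-1) B" and P: "\<And>i. decays A N (Suc n) (-1) (pd i \<Psi>)"
  shows "decays A N (Suc n) (-1) (pn_disp nu B \<Psi> i)" and "decays A N n (-2) (pn_stress nu B \<Psi> i j)"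
proof -
  note s1 = smooth_on_pd[OF sB] and s2 = smooth_on_pd[OF smooth_on_pd[OF sP]]
  show "decays A N (Suc n) (-1) (pn_disp nu B \<Psi> i)"
    unfolding pn_disp_def[abs_def]
    by (intro decays_diff decays_cmult sB B P smooth_on_mult smooth_on_const open_S smooth_on_pd sP)
  have b: "decays A N n (-2) (pd i B)" for i using B by simp
  have p: "decays A N n (-2) (pd j (pd i \<Psi>))" for i j using P[of i] by simp
  show "decays A N n (-2) (pn_stress nu B \<Psi> i j)"
    unfolding pn_stress_def[abs_def] pn_res_def[abs_def] lap_def[abs_def]
    by (intro decays_diff decays_add decays_cmult b p smooth_on_diff smooth_on_add smooth_on_mult smooth_on_const open_S s1 s2)
qed

end

section \<open>The transmission field\<close>

lemma lap_cmult: "open S \<Longrightarrow> x \<in> S \<Longrightarrow> smooth_on S f \<Longrightarrow> lap (\<lambda>x. c * f x) x = c * lap f x"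
proof -
  assume a: "open S" "x \<in> S" "smooth_on S f"
  have "pd i (pd i (\<lambda>x. c * f x)) x = c * pd i (pd i f) x" for i
  proof -
    have "pd i (pd i (\<lambda>x. c * f x)) x = pd i (\<lambda>x. c * pd i f x) x"
      by (rule pd_cong[OF a(1,2)]) (intro pd_cmult smooth_on_differentiable[OF a(3)])
    also have "\<dots> = c * pd i (pd i f) x"
      by (intro pd_cmult smooth_on_differentiable[OF smooth_on_pd[OF a(3)] a(2)])
    finally show ?thesis .
  qed
  then show ?thesis by (simp add: lap_def distrib_left)
qed

lemma lap_pd:
  assumes "open S" "x \<in> S" "smooth_on S f"
  shows "lap (pd i f) x = pd i (lap f) x"
proof -
  have c: "pd j (pd j (pd i f)) x = pd i (pd j (pd j f)) x" for j
  proof -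
    have "pd j (pd j (pd i f)) x = pd j (pd i (pd j f)) x"
      by (rule pd_cong[OF assms(1,2)]) (rule pd_commute[OF assms(1) _ assms(3)])
    then show ?thesis using pd_commute[OF assms(1,2) smooth_on_pd[OF assms(3)]] by simp
  qed
  note d = smooth_on_differentiable[OF smooth_on_pd[OF smooth_on_pd[OF assms(3)]] assms(2)]
  show ?thesis unfolding lap_def[abs_def]
    by (subst pd_add[OF differentiable_add[OF d d] d], subst pd_add[OF d d]) (simp add: c)
qed

lemma pd_x3_mult:
  assumes "f differentiable (at x)"
  shows "pd i (\<lambda>x. (x $ 3 - c) * f x) x = (if i = 3 then f x else 0) + (x $ 3 - c) * pd i f x"
  by (subst pd_mult[OF _ assms]) (auto simp: pd_diff pd_nth)

lemmas pd_x3_mult0 = pd_x3_mult[where c = 0, simplified]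

locale transmission =
  fixes p q a mu1 mu2 nu1 nu2 :: real
  assumes a_pos: "0 < a" and mu_pos: "0 < mu1" "0 < mu2" and nu1: "0 \<le> nu1" "nu1 < 1 / 2" and nu2: "0 \<le> nu2" "nu2 < 1 / 2"
begin

text \<open>\<open>kap1\<close> and \<open>kap2\<close> are the Kolosov constants of the upper and
  lower material, \<open>k\<close> is the ratio of shear moduli. The contrasts \<open>gam\<close>
  and \<open>del\<close> vanish for equal materials; then \<open>cl\<close> = 0 and
  \<open>pic\<close> = 1, and for the exact pole both half-space fields reduce to the Kelvin
  solution.\<close>

definition "kap1 = 3 - 4 * nu1"
definition "kap2 = 3 - 4 * nu2"
definition "k = mu2 / mu1"
definition "gam = (1 - k) / (1 + k * kap1)"
definition "del = (kap2 - k * kap1) / (kap2 + k)"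
definition "pic = k * (1 + kap1) / (kap2 + k)"
definition "cl = (del - gam * kap1\<^sup>2) / 2"

text \<open>The constants solve the linear system that expresses continuity of displacement and traction
  on \<open>x\<^sub>3 = 0\<close> in terms of the Papkovich--Neuber potentials; \<open>f\<close> is \<open>1 / |x - x\<^sub>0|\<close> or a
  regularisation of it, \<open>x\<^sub>0 = (p, q, a)\<close>, and the other terms are images of the pole.\<close>

definition "Bup f x = (f x + gam * kap1 * invr p q 1 a x) - 2 * a * gam * pd 3 (invr p q 1 a) x"
definition "Pup f x = ((x $ 3 - a) * (f x + gam * kap1 * invr p q 1 a x) - 2 * a * gam * ((x $ 3 - 0) * pd 3 (invr p q 1 a) x))
  - cl * logr p q 1 a x"
definition "Bdn x = pic * invr p q (-1) a x"
definition "Pdn x = (pic * ((x $ 3 - 0) * invr p q (-1) a x) - k * a * (1 + gam * kap1) * invr p q (-1) a x)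
  - k * cl * logr p q (-1) a x"

lemma kap_pos: "1 < kap1" "1 < kap2" "0 < k" "kap1 \<le> 3" "kap2 \<le> 3"
  using nu1 nu2 mu_pos by (simp_all add: kap1_def kap2_def k_def)

text \<open>Division-free forms of the constants, the shape in which polynomial identities can be
  derived from them.\<close>

lemma relations:
  "gam * (1 + k * kap1) = 1 - k" "del * (kap2 + k) = kap2 - k * kap1" "pic * (kap2 + k) = k * (1 + kap1)"
  "2 * cl = del - gam * kap1\<^sup>2" "4 * nu1 = 3 - kap1" "4 * nu2 = 3 - kap2" "mu2 = k * mu1"
proof -
  have "0 < 1 + k * kap1" "0 < kap2 + k" using kap_pos by (auto intro!: add_pos_pos mult_pos_pos)
  then show "gam * (1 + k * kap1) = 1 - k" "del * (kap2 + k) = kap2 - k * kap1" "pic * (kap2 + k) = k * (1 + kap1)"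
    by (simp_all add: gam_def del_def pic_def)
  show "2 * cl = del - gam * kap1\<^sup>2" "4 * nu1 = 3 - kap1" "4 * nu2 = 3 - kap2" "mu2 = k * mu1"
    using mu_pos by (simp_all add: cl_def kap1_def kap2_def k_def)
qed

lemma ht_sub: "{x. 0 < ht \<sigma> a x} \<subseteq> {x. 0 < sqd p q \<sigma> a x}"
  using sqd_pos_of_ht by blast

lemma up_smooth:
  assumes "open S" "S \<subseteq> {x. 0 < ht 1 a x}"
  shows "smooth_on S (invr p q 1 a)" "smooth_on S (logr p q 1 a)"
  using smooth_on_invr[OF assms(1) order_trans[OF assms(2) ht_sub]] smooth_on_logr[OF assms] by blast+

lemma smooth_up:
  assumes "open S" "S \<subseteq> {x. 0 < ht 1 a x}" "smooth_on S f"
  shows "smooth_on S (Bup f)" "smooth_on S (Pup f)"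
  unfolding Bup_def[abs_def] Pup_def[abs_def]
  by (intro smooth_on_intros smooth_on_pd smooth_on_const up_smooth[OF assms(1,2)] assms)+

lemma smooth_dn:
  assumes "open S" "S \<subseteq> {x. 0 < ht (-1) a x}"
  shows "smooth_on S Bdn" "smooth_on S Pdn"
  unfolding Bdn_def[abs_def] Pdn_def[abs_def]
  by (intro smooth_on_intros smooth_on_const smooth_on_logr[OF assms] smooth_on_invr[OF assms(1) order_trans[OF assms(2) ht_sub]] assms)+

context
  fixes S :: "(real^3) set" and f :: "real^3 \<Rightarrow> real"
  assumes S: "open S" "S \<subseteq> {x. 0 < ht 1 a x}" and f: "smooth_on S f"
begin

lemma pd_Bup:
  assumes "x \<in> S"
  shows "pd i (Bup f) x = pd i f x + gam * kap1 * pd i (invr p q 1 a) x - 2 * a * gam * pd i (pd 3 (invr p q 1 a)) x"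
proof -
  note d = smooth_on_differentiable[OF f assms] smooth_on_differentiable[OF up_smooth(1)[OF S] assms]
    smooth_on_differentiable[OF smooth_on_pd[OF up_smooth(1)[OF S]] assms]
  show ?thesis unfolding Bup_def[abs_def]
    by (simp add: pd_add pd_diff pd_cmult differentiable_mult d)
qed

lemma pd_Pup:
  assumes "x \<in> S"
  shows "pd i (Pup f) x = (if i = 3 then Bup f x else 0) + (x $ 3 - a) * (pd i f x + gam * kap1 * pd i (invr p q 1 a) x)
    - 2 * a * gam * (x $ 3 * pd i (pd 3 (invr p q 1 a)) x) - cl * pd i (logr p q 1 a) x"
proof -
  note d = smooth_on_differentiable[OF f assms] smooth_on_differentiable[OF up_smooth(1)[OF S] assms]
    smooth_on_differentiable[OF smooth_on_pd[OF up_smooth(1)[OF S]] assms] smooth_on_differentiable[OF up_smooth(2)[OF S] assms]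
  show ?thesis unfolding Pup_def[abs_def] Bup_def
    by (simp add: pd_x3_mult pd_x3_mult0 pd_add pd_diff pd_cmult differentiable_mult d del: diff_zero)
       (simp add: algebra_simps)
qed

lemma pd2_Pup:
  assumes "x \<in> S"
  shows "pd j (pd i (Pup f)) x = (if i = 3 then pd j (Bup f) x else 0) + (if j = 3 then pd i (Bup f) x else 0)
    + (x $ 3 - a) * (pd j (pd i f) x + gam * kap1 * pd j (pd i (invr p q 1 a)) x)
    - 2 * a * gam * (x $ 3 * pd j (pd i (pd 3 (invr p q 1 a))) x) - cl * pd j (pd i (logr p q 1 a)) x"
proof -
  define g where "g = (\<lambda>x. pd i f x + gam * kap1 * pd i (invr p q 1 a) x)"
  note s = smooth_on_pd[OF f] smooth_on_pd[OF up_smooth(1)[OF S]]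
  note sg = smooth_on_add[OF S(1) s(1) smooth_on_mult[OF S(1) smooth_on_const s(2)], of i "gam * kap1" i, folded g_def]
  note d = smooth_on_differentiable[OF f assms] smooth_on_differentiable[OF s(1) assms] smooth_on_differentiable[OF s(2) assms]
    smooth_on_differentiable[OF smooth_on_pd[OF s(2)] assms] smooth_on_differentiable[OF smooth_on_pd[OF up_smooth(2)[OF S]] assms]
    smooth_on_differentiable[OF sg assms] smooth_on_differentiable[OF smooth_up(1)[OF S f] assms]
  have gd: "pd j g x = pd j (pd i f) x + gam * kap1 * pd j (pd i (invr p q 1 a)) x"
    unfolding g_def by (simp add: pd_add pd_cmult differentiable_mult d)
  have "pd j (pd i (Pup f)) x = pd j (\<lambda>x. (if i = 3 then 1 else 0) * Bup f x + (x $ 3 - a) * g x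
    - 2 * a * gam * ((x $ 3 - 0) * pd i (pd 3 (invr p q 1 a)) x) - cl * pd i (logr p q 1 a) x) x"
    by (rule pd_cong[OF S(1) assms]) (simp add: pd_Pup g_def)
  also have "\<dots> = (if i = 3 then 1 else 0) * pd j (Bup f) x + ((if j = 3 then g x else 0) + (x $ 3 - a) * pd j g x)
    - 2 * a * gam * ((if j = 3 then pd i (pd 3 (invr p q 1 a)) x else 0) + (x $ 3 - 0) * pd j (pd i (pd 3 (invr p q 1 a))) x)
    - cl * pd j (pd i (logr p q 1 a)) x"
    by (simp add: pd_x3_mult pd_x3_mult0 pd_add pd_diff pd_cmult differentiable_mult d del: diff_zero)
  finally show ?thesis unfolding gd unfolding g_def by (auto simp: pd_Bup[OF assms] algebra_simps)
qed

text \<open>All images are harmonic, and multiplying a harmonic function by x3 - c produces the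
  Laplacian 2 d_3 of that function, which \<open>pn_res\<close> subtracts. What remains is the
  deviation of \<open>f\<close> from being harmonic.\<close>

lemma lap_up:
  assumes "x \<in> S"
  shows "lap (Bup f) x = lap f x" "pn_res (Bup f) (Pup f) x = (x $ 3 - a) * lap f x"
proof -
  let ?b = "invr p q 1 a"
  have x: "0 < ht 1 a x" and x0: "0 < sqd p q 1 a x" using assms S(2) ht_sub by blast+
  have l3: "lap (pd 3 ?b) x = 0"
  proof -
    have "lap (pd 3 ?b) x = pd 3 (lap ?b) x" by (rule lap_pd[OF S(1) assms up_smooth(1)[OF S]])
    also have "\<dots> = pd 3 (\<lambda>x. 0) x"
      by (rule pd_cong[OF S(1) assms], rule lap_invr) (use S(2) ht_sub in auto)
    finally show ?thesis by simp
  qed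
  have lb: "lap ?b x = 0" by (rule lap_invr[OF _ x0]) simp
  have lL: "lap (logr p q 1 a) x = 0" by (rule lap_logr[OF _ x]) simp
  have 2: "pd i (pd i (Bup f)) x = pd i (pd i f) x + gam * kap1 * pd i (pd i ?b) x - 2 * a * gam * pd i (pd i (pd 3 ?b)) x" for i
  proof -
    note d = smooth_on_differentiable[OF smooth_on_pd[OF f] assms] smooth_on_differentiable[OF smooth_on_pd[OF up_smooth(1)[OF S]] assms]
      smooth_on_differentiable[OF smooth_on_pd[OF smooth_on_pd[OF up_smooth(1)[OF S]]] assms]
    have "pd i (pd i (Bup f)) x = pd i (\<lambda>x. pd i f x + gam * kap1 * pd i ?b x - 2 * a * gam * pd i (pd 3 ?b) x) x"
      by (rule pd_cong[OF S(1) assms]) (rule pd_Bup)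
    then show ?thesis by (simp add: pd_add pd_diff pd_cmult differentiable_mult d)
  qed
  have "lap (Bup f) x = lap f x + gam * kap1 * lap ?b x - 2 * a * gam * lap (pd 3 ?b) x"
    unfolding lap_def 2 by (simp add: algebra_simps)
  then show "lap (Bup f) x = lap f x" by (simp add: lb l3)
  have "lap (Pup f) x = 2 * pd 3 (Bup f) x + (x $ 3 - a) * (lap f x + gam * kap1 * lap ?b x)
     - 2 * a * gam * (x $ 3 * lap (pd 3 ?b) x) - cl * lap (logr p q 1 a) x"
    unfolding lap_def pd2_Pup[OF assms] by (simp add: algebra_simps)
  then show "pn_res (Bup f) (Pup f) x = (x $ 3 - a) * lap f x" by (simp add: pn_res_def lb l3 lL)
qed

end

context
  fixes S :: "(real^3) set"
  assumes S: "open S" "S \<subseteq> {x. 0 < ht (-1) a x}"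
begin

lemma dn_smooth: "smooth_on S (invr p q (-1) a)" "smooth_on S (logr p q (-1) a)"
  using smooth_on_invr[OF S(1) order_trans[OF S(2) ht_sub]] smooth_on_logr[OF S] by blast+

lemma pd_Bdn: "x \<in> S \<Longrightarrow> pd i Bdn x = pic * pd i (invr p q (-1) a) x"
  unfolding Bdn_def[abs_def] by (rule pd_cmult[OF smooth_on_differentiable[OF dn_smooth(1)]])

lemma pd_Pdn:
  assumes "x \<in> S"
  shows "pd i Pdn x = (if i = 3 then Bdn x else 0) + (pic * x $ 3 - k * a * (1 + gam * kap1)) * pd i (invr p q (-1) a) x
    - k * cl * pd i (logr p q (-1) a) x"
proof -
  note d = smooth_on_differentiable[OF dn_smooth(1) assms] smooth_on_differentiable[OF dn_smooth(2) assms]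
  show ?thesis unfolding Pdn_def[abs_def] Bdn_def
    by (simp add: pd_x3_mult pd_x3_mult0 pd_add pd_diff pd_cmult differentiable_mult d del: diff_zero)
       (simp add: algebra_simps)
qed

lemma pd2_Pdn:
  assumes "x \<in> S"
  shows "pd j (pd i Pdn) x = (if i = 3 then pd j Bdn x else 0) + (if j = 3 then pd i Bdn x else 0)
    + (pic * x $ 3 - k * a * (1 + gam * kap1)) * pd j (pd i (invr p q (-1) a)) x - k * cl * pd j (pd i (logr p q (-1) a)) x"
proof -
  let ?b = "invr p q (-1) a"
  note d = smooth_on_differentiable[OF smooth_dn(1)[OF S] assms] smooth_on_differentiable[OF smooth_on_pd[OF dn_smooth(1)] assms]
    smooth_on_differentiable[OF smooth_on_pd[OF dn_smooth(2)] assms]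
  have "pd j (pd i Pdn) x = pd j (\<lambda>x. (if i = 3 then 1 else 0) * Bdn x + (pic * ((x $ 3 - 0) * pd i ?b x) - k * a * (1 + gam * kap1) * pd i ?b x)
      - k * cl * pd i (logr p q (-1) a) x) x"
    by (rule pd_cong[OF S(1) assms]) (simp add: pd_Pdn algebra_simps)
  also have "\<dots> = (if i = 3 then 1 else 0) * pd j Bdn x + (pic * ((if j = 3 then pd i ?b x else 0) + (x $ 3 - 0) * pd j (pd i ?b) x) - k * a * (1 + gam * kap1) * pd j (pd i ?b) x)
      - k * cl * pd j (pd i (logr p q (-1) a)) x"
    by (simp add: pd_x3_mult pd_x3_mult0 pd_add pd_diff pd_cmult differentiable_mult d del: diff_zero)
  finally show ?thesis by (auto simp: pd_Bdn[OF assms] algebra_simps)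
qed

lemma lap_dn:
  assumes "x \<in> S"
  shows "lap Bdn x = 0" "pn_res Bdn Pdn x = 0"
proof -
  let ?b = "invr p q (-1) a"
  have x: "0 < ht (-1) a x" and x0: "0 < sqd p q (-1) a x" using assms S(2) ht_sub by blast+
  have lb: "lap ?b x = 0" by (rule lap_invr[OF _ x0]) simp
  have lL: "lap (logr p q (-1) a) x = 0" by (rule lap_logr[OF _ x]) simp
  show "lap Bdn x = 0" unfolding Bdn_def[abs_def]
    by (subst lap_cmult[OF S(1) assms dn_smooth(1)]) (simp add: lb)
  have "lap Pdn x = 2 * pd 3 Bdn x + (pic * x $ 3 - k * a * (1 + gam * kap1)) * lap ?b x - k * cl * lap (logr p q (-1) a) x"
    unfolding lap_def pd2_Pdn[OF assms] by (simp add: algebra_simps)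
  then show "pn_res Bdn Pdn x = 0" by (simp add: pn_res_def lb lL)
qed

end

end

section \<open>Matching of displacement and traction on the interface\<close>

context transmission
begin

text \<open>On x3 = 0 the source and its mirror image are equidistant, so all derivatives become
  polynomials in \<open>b\<close>, the common value of \<open>invs\<close> and the coordinates, and
  continuity reduces to identities between the constants. As \<open>f\<close> is the exact pole near
  \<open>x\<close>, its derivatives can be replaced by those of the pole.\<close>

lemma plane_matching:
  assumes S: "open S" "S \<subseteq> {x. 0 < ht 1 a x}" and f: "smooth_on S f" and x: "x \<in> S" "x $ 3 = 0"
    and T: "open T" "x \<in> T" "\<And>z. z \<in> T \<Longrightarrow> f z = invr p q (-1) a z"
  shows "pn_disp nu1 (Bup f) (Pup f) i x / mu1 = pn_disp nu2 Bdn Pdn i x / mu2"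
    and "pn_stress nu1 (Bup f) (Pup f) i 3 x = pn_stress nu2 Bdn Pdn i 3 x"
proof -
  let ?H = "{x. 0 < ht (-1) a x}"
  have xH: "x \<in> ?H" using x(2) a_pos by (simp add: ht_def)
  have h: "0 < ht (-1) a x" "0 < ht 1 a x" using x(2) a_pos by (simp_all add: ht_def)
  note sq = sqd_pos_of_ht[OF h(1), of p q] sqd_pos_of_ht[OF h(2), of p q]
  have lz: "lap f x = 0"
  proof -
    have "pd i (pd i f) x = pd i (pd i (invr p q (-1) a)) x" for i
      by (rule pd_cong[OF T(1,2)]) (rule pd_cong[OF T(1) _ T(3)])
    then show ?thesis using lap_invr[OF _ sq(1)] by (simp add: lap_def)
  qed
  have fx: "f x = invr p q (-1) a x" by (rule T(3)[OF T(2)])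
  have f1: "pd j f x = pd j (invr p q (-1) a) x" for j by (rule pd_cong[OF T])
  have f2: "pd j (pd i f) x = pd j (pd i (invr p q (-1) a)) x" for i j
    by (rule pd_cong[OF T(1,2)]) (rule pd_cong[OF T(1) _ T(3)])
  have sqeq: "sqd p q 1 a x = sqd p q (-1) a x" using x(2) by (simp add: sqd_def ht_def)
  define b where "b = invr p q (-1) a x"
  have b2: "invr p q 1 a x = b" using sqeq by (simp add: b_def invr_def)
  have E2: "invs p q 1 a x = invs p q (-1) a x" using sqeq x(2) by (simp add: invs_def ht_def)
  define E where "E = invs p q (-1) a x"
  define X where "X j = (if j = 1 then x $ 1 - p else x $ 2 - q)" for j :: 3
  have c: "coord p q 1 a 3 x = a" "coord p q (-1) a 3 x = - a" using x(2) by (simp_all add: coord_def)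
  have cX: "coord p q \<tau> a j x = X j" if "j \<noteq> 3" for j \<tau>
    using that exhaust_3[of j] by (auto simp: coord_def X_def)
  note P1 = pd_invr[of "-1", OF _ sq(1), simplified] pd_invr[of 1, OF _ sq(2), simplified]
  note P2 = pd2_invr[of "-1", OF _ sq(1), simplified] pd2_invr[of 1, OF _ sq(2), simplified]
  note PL = pd_logr[of "-1", OF _ h(1), simplified] pd_logr[of 1, OF _ h(2), simplified]
  note PL3 = pd_pd3_logr[of "-1", OF _ h(1), simplified] pd_pd3_logr[of 1, OF _ h(2), simplified]
  have k0: "k \<noteq> 0" and kk: "kap2 + k \<noteq> 0" "1 + k * kap1 \<noteq> 0"
    using kap_pos mult_pos_pos[OF kap_pos(3), of kap1] by linarith+
  note rel = relations
  \<comment> \<open>This is what continuity of the normal displacement requires; the factor kap2 + k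
    clears the denominators of \<open>del\<close> and \<open>pic\<close>.\<close>
  have r1: "k * (kap1 * (1 + gam * kap1) + 2 * cl) = kap2 * pic"
  proof -
    have "(kap2 + k) * (k * (kap1 * (1 + gam * kap1) + 2 * cl)) = (kap2 + k) * (kap2 * pic)"
      using rel(2,3,4) by algebra
    then show ?thesis using kk(1) by simp
  qed
  \<comment> \<open>Used together with \<open>r1\<close> for the traction. Here the denominator of
    \<open>gam\<close> has to be cleared as well, which is done on the difference \<open>D\<close>
    of the two sides.\<close>
  have r2: "(1 - kap1) * (1 + gam * kap1) - 2 * cl = (1 - kap2) * pic + 2 * (k * cl)"
  proof -
    have e: "(1 - kap1) * (1 + gam * kap1) - 2 * cl = 1 - kap1 + gam * kap1 - del"
      using rel(4) by algebra
    define D where "D = 1 - kap1 + gam * kap1 - del - (1 - kap2) * pic - k * (del - gam * kap1\<^sup>2)"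
    have "(kap2 + k) * (1 + k * kap1) * D = 0"
      unfolding D_def using rel(1,2,3) by algebra
    then have "D = 0" using kk by simp
    then show ?thesis using e rel(4) unfolding D_def by algebra
  qed
  show "pn_disp nu1 (Bup f) (Pup f) i x / mu1 = pn_disp nu2 Bdn Pdn i x / mu2"
  proof -
    have main: "k * pn_disp nu1 (Bup f) (Pup f) i x = pn_disp nu2 Bdn Pdn i x"
    proof (cases "i = 3")
      case True
      show ?thesis
        unfolding True pn_disp_def pd_Pup[OF S f x(1)] pd_Pdn[OF open_ht_pos order_refl xH] Bup_def Bdn_def
        by (simp add: f1 fx P1 P2 PL c b2 x(2) b_def[symmetric] power2_eq_square, insert r1 rel(5,6), algebra)
    next
      case False
      \<comment> \<open>The horizontal components agree term by term: the coefficients k a (1 + gam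
        kap1) and k cl in \<open>Pdn\<close> are chosen for this.\<close>
      show ?thesis
        unfolding pn_disp_def pd_Pup[OF S f x(1)] pd_Pdn[OF open_ht_pos order_refl xH]
        using False by (simp add: f1 fx P1 P2 PL c cX b2 E2 x(2) b_def[symmetric] algebra_simps)
    qed
    then show ?thesis using mu_pos k_def by (simp add: field_simps)
  qed
  show "pn_stress nu1 (Bup f) (Pup f) i 3 x = pn_stress nu2 Bdn Pdn i 3 x"
  proof (cases "i = 3")
    case True
    show ?thesis
      unfolding True pn_stress_def lap_up(2)[OF S f x(1)] lap_dn(2)[OF open_ht_pos order_refl xH]
        pd2_Pup[OF S f x(1)] pd2_Pdn[OF open_ht_pos order_refl xH] lz pd_Bup[OF S f x(1)] pd_Bdn[OF open_ht_pos order_refl xH]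
      by (simp add: f1 f2 fx P1 P2 PL3 c b2 x(2) b_def[symmetric], insert r1 r2 rel, algebra)
  next
    case False
    show ?thesis
      unfolding pn_stress_def lap_up(2)[OF S f x(1)] lap_dn(2)[OF open_ht_pos order_refl xH]
        pd2_Pup[OF S f x(1)] pd2_Pdn[OF open_ht_pos order_refl xH] lz pd_Bup[OF S f x(1)] pd_Bdn[OF open_ht_pos order_refl xH]
      by (simp add: False f1 f2 fx P1 P2 PL3 c cX b2 x(2) b_def[symmetric], insert r1 r2 rel, algebra)
  qed
qed

end

section \<open>Approximate identities\<close>

lemma locally_L1_one: "locally_L1 (\<lambda>x::real^3. 1 :: real)"
  unfolding locally_L1_def set_integrable_def
proof (intro allI impI)
  fix K :: "(real^3) set" assume "compact K"
  then have "integrable lebesgue (indicator K :: real^3 \<Rightarrow> real)"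
    by (intro lmeasurable_iff_integrable[THEN iffD1] lmeasurable_compact)
  then show "integrable lebesgue (\<lambda>x. indicator K x *\<^sub>R (1::real))" by simp
qed

lemma integrable_continuous_compact:
  fixes h :: "real^3 \<Rightarrow> real"
  assumes "continuous_on UNIV h" "compact K" "\<And>x. x \<notin> K \<Longrightarrow> h x = 0"
  shows "integrable lebesgue h"
  using integrable_locally_L1_mult_continuous[OF locally_L1_one assms] by simp

lemma integral_lebesgue_translation:
  fixes h :: "real^3 \<Rightarrow> real"
  assumes "h \<in> borel_measurable borel"
  shows "integral\<^sup>L lebesgue (\<lambda>x. h (c + x)) = integral\<^sup>L lebesgue h"
proof -
  have 1: "(\<lambda>x. h (c + x)) \<in> borel_measurable borel" using assms by measurable
  have "integral\<^sup>L lebesgue h = integral\<^sup>L lborel h"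
    using assms by (intro integral_completion) simp
  also have "\<dots> = integral\<^sup>L (distr lborel borel ((+) c)) h"
    by (simp only: lborel_distr_plus)
  also have "\<dots> = integral\<^sup>L lborel (\<lambda>x. h (c + x))"
    using assms by (intro integral_distr) auto
  also have "\<dots> = integral\<^sup>L lebesgue (\<lambda>x. h (c + x))"
    using 1 by (intro integral_completion[symmetric]) simp
  finally show ?thesis by simp
qed

text \<open>Difference quotients of a compactly supported function have integral 0 by translation
  invariance, and they converge boundedly to the partial derivative.\<close>

lemma integral_pd_eq_0:
  fixes h :: "real^3 \<Rightarrow> real"
  assumes h: "smooth_on UNIV h" and K: "compact K" "\<And>x. x \<notin> K \<Longrightarrow> h x = 0"
  shows "integral\<^sup>L lebesgue (pd i h) = 0"
proof -
  \<comment> \<open>Contains the supports of all x \<mapsto> h(x + t e_i) with 0 \<le> t \<le> 1,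
    giving the difference quotients a common compact support.\<close>
  define K2 where "K2 = (\<lambda>(x, t). x - t *\<^sub>R (axis i 1 :: real^3)) ` (K \<times> {0..1})"
  have K2: "compact K2"
    unfolding K2_def by (intro compact_continuous_image compact_Times K) (auto intro!: continuous_intros simp: case_prod_beta)
  have hc: "continuous_on UNIV h" and pc: "continuous_on UNIV (pd i h)"
    using smooth_on_continuous[OF h] smooth_on_continuous[OF smooth_on_pd[OF h]] by blast+
  have pz: "pd i h x = 0" if "x \<notin> K" for x
    by (rule pd_eq_0_outside[of K h x i, OF compact_imp_closed[OF K(1)] K(2) that])
  have K2I: "x \<in> K2" if "0 \<le> t" "t \<le> 1" "x + t *\<^sub>R axis i 1 \<in> K" for x t
    unfolding K2_def using that by (intro image_eqI[of _ _ "(x + t *\<^sub>R axis i 1, t)"]) auto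
  obtain C where C: "C > 0" "\<And>x. x \<in> K \<Longrightarrow> \<bar>pd i h x\<bar> \<le> C"
    using continuous_on_bounded_abs[OF K(1) continuous_on_subset[OF pc subset_UNIV]] by blast
  have C': "\<bar>pd i h x\<bar> \<le> C" for x using C pz[of x] by (cases "x \<in> K") auto
  have line: "((\<lambda>s. h (x + s *\<^sub>R axis i 1)) has_real_derivative pd i h (x + t *\<^sub>R axis i 1)) (at t)" for x t
    by (rule pd_line[OF smooth_on_differentiable[OF h UNIV_I]])
  define d where "d n = 1 / (real n + 2)" for n
  have d: "0 < d n" "d n \<le> 1" for n by (auto simp: d_def)
  have d0: "d \<longlonglongrightarrow> 0" unfolding d_def[abs_def] by (rule shrink_limit)
  define f where "f n x = (h (d n *\<^sub>R axis i 1 + x) - h x) / d n" for n x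
  have fc: "continuous_on UNIV (f n)" for n
    unfolding f_def[abs_def] divide_inverse
    by (intro continuous_intros continuous_on_compose2[OF hc]) auto
  have fz: "f n x = 0" if "x \<notin> K \<union> K2" for n x
    using that K(2)[of x] K(2)[of "d n *\<^sub>R axis i 1 + x"] K2I[of "d n" x] d[of n] by (auto simp: f_def add.commute)
  have fb: "\<bar>f n x\<bar> \<le> C" for n x
  proof -
    have "norm (h (x + d n *\<^sub>R axis i 1) - h (x + 0 *\<^sub>R axis i 1)) \<le> C * norm (d n - 0)"
    proof (rule field_differentiable_bound[of UNIV])
      show "((\<lambda>s. h (x + s *\<^sub>R axis i 1)) has_field_derivative pd i h (x + t *\<^sub>R axis i 1)) (at t within UNIV)" for t
        by (rule line)
      show "norm (pd i h (x + t *\<^sub>R axis i 1)) \<le> C" for t using C' by simp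
    qed auto
    then have "\<bar>h (d n *\<^sub>R axis i 1 + x) - h x\<bar> \<le> C * d n" using d[of n] by (simp add: add.commute)
    then show ?thesis using d(1)[of n] by (simp add: f_def abs_divide divide_le_eq)
  qed
  have fl: "(\<lambda>n. f n x) \<longlonglongrightarrow> pd i h x" for x
  proof -
    have "((\<lambda>s. (h (x + (0 + s) *\<^sub>R axis i 1) - h (x + 0 *\<^sub>R axis i 1)) / s) \<longlongrightarrow> pd i h (x + 0 *\<^sub>R axis i 1)) (at 0)"
      using line[of x 0] unfolding DERIV_def by simp
    moreover have "filterlim d (at 0) sequentially"
      using d0 d(1) by (simp add: filterlim_at less_imp_neq[OF d(1), symmetric])
    ultimately have "(\<lambda>n. (h (x + (0 + d n) *\<^sub>R axis i 1) - h (x + 0 *\<^sub>R axis i 1)) / d n) \<longlonglongrightarrow> pd i h (x + 0 *\<^sub>R axis i 1)"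
      by (rule filterlim_compose)
    then show ?thesis by (simp add: f_def add.commute)
  qed
  have "(\<lambda>n. integral\<^sup>L lebesgue (\<lambda>x. 1 * f n x)) \<longlonglongrightarrow> integral\<^sup>L lebesgue (\<lambda>x. 1 * pd i h x)"
  proof (rule locally_L1_dominated_convergence(1)[OF locally_L1_one _ fc fz fb fl])
    show "compact (K \<union> K2)" using K K2 by (simp add: compact_Un)
    show "pd i h \<in> borel_measurable lebesgue"
      using borel_measurable_continuous_onI[OF pc] by (simp add: measurable_completion)
  qed
  moreover have "integral\<^sup>L lebesgue (\<lambda>x. 1 * f n x) = 0" for n
  proof -
    have hb: "h \<in> borel_measurable borel" by (rule borel_measurable_continuous_onI[OF hc])
    have i1: "integrable lebesgue h" by (rule integrable_continuous_compact[OF hc K])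
    have i2: "integrable lebesgue (\<lambda>x. h (d n *\<^sub>R axis i 1 + x))"
    proof (rule integrable_continuous_compact[OF _ K2])
      show "continuous_on UNIV (\<lambda>x. h (d n *\<^sub>R axis i 1 + x))"
        by (intro continuous_on_compose2[OF hc] continuous_intros) auto
      show "h (d n *\<^sub>R axis i 1 + x) = 0" if "x \<notin> K2" for x
        using K2I[of "d n" x] d[of n] that K(2)[of "d n *\<^sub>R axis i 1 + x"] by (auto simp: add.commute)
    qed
    have "integral\<^sup>L lebesgue (\<lambda>x. 1 * f n x) = (integral\<^sup>L lebesgue (\<lambda>x. h (d n *\<^sub>R axis i 1 + x)) - integral\<^sup>L lebesgue h) / d n"
      unfolding f_def using Bochner_Integration.integral_diff[OF i2 i1] by simp
    then show ?thesis by (simp add: integral_lebesgue_translation[OF hb])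
  qed
  ultimately have "(\<lambda>n. 0) \<longlonglongrightarrow> integral\<^sup>L lebesgue (\<lambda>x. 1 * pd i h x)" by simp
  from LIMSEQ_unique[OF this tendsto_const] show ?thesis by simp
qed

text \<open>The kernels may change sign: the bound B / e^3 against the volume (2 e)^3 of a
  surrounding cube takes the place of positivity. The mass \<open>k\<close> may be 0, as it is for
  derivative kernels.\<close>

lemma approximate_identity:
  fixes w :: "real^3 \<Rightarrow> real" and h :: "nat \<Rightarrow> real^3 \<Rightarrow> real"
  assumes w: "locally_L1 w" "isCont w c"
    and e: "\<And>n. 0 < e n" "e \<longlonglongrightarrow> 0"
    and h: "\<And>n. continuous_on UNIV (h n)" "\<And>n x. e n < dist x c \<Longrightarrow> h n x = 0"
      "\<And>n x. \<bar>h n x\<bar> \<le> B / e n ^ 3" "\<And>n. integral\<^sup>L lebesgue (h n) = k"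
  shows "(\<lambda>n. integral\<^sup>L lebesgue (\<lambda>x. w x * h n x)) \<longlonglongrightarrow> w c * k"
proof (rule LIMSEQ_I)
  fix r :: real assume r: "0 < r"
  have B: "0 \<le> B" using order_trans[OF abs_ge_zero h(3)[of 0 c]] e(1)[of 0] by (simp add: zero_le_divide_iff)
  \<comment> \<open>Eight is the volume factor of a cube of side 2 e; the 1 covers B = 0.\<close>
  define r' where "r' = r / (8 * B + 1)"
  have r': "0 < r'" using r B by (simp add: r'_def)
  obtain s where s: "s > 0" "\<And>x. dist x c < s \<Longrightarrow> \<bar>w x - w c\<bar> < r'"
    using w(2) r' unfolding continuous_at_eps_delta dist_real_def by blast
  obtain N where N: "\<And>n. n \<ge> N \<Longrightarrow> e n < s"
    using order_tendstoD(2)[OF e(2) s(1)] unfolding eventually_sequentially by blast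
  have "\<bar>integral\<^sup>L lebesgue (\<lambda>x. w x * h n x) - w c * k\<bar> < r" if n: "n \<ge> N" for n
  proof -
    have hz: "h n x = 0" if "x \<notin> cball c (e n)" for x using that h(2)[of n x] by (simp add: dist_commute)
    have i1: "integrable lebesgue (\<lambda>x. w x * h n x)"
      by (rule integrable_locally_L1_mult_continuous[OF w(1) h(1) compact_cball hz])
    have i2: "integrable lebesgue (\<lambda>x. w c * h n x)"
      by (intro integrable_mult_right integrable_continuous_compact[OF h(1) compact_cball hz])
    have i3: "integrable lebesgue (\<lambda>x. (w x - w c) * h n x)"
      using Bochner_Integration.integrable_diff[OF i1 i2] by (simp add: algebra_simps)
    have "integral\<^sup>L lebesgue (\<lambda>x. w x * h n x) - w c * k = integral\<^sup>L lebesgue (\<lambda>x. (w x - w c) * h n x)"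
      using Bochner_Integration.integral_diff[OF i1 i2] by (simp add: algebra_simps h(4))
    also have "\<bar>\<dots>\<bar> \<le> (r' * (B / e n ^ 3)) *
      (((\<chi> i. c $ i + e n) $ 1 - (\<chi> i. c $ i - e n) $ 1) * ((\<chi> i. c $ i + e n) $ 2 - (\<chi> i. c $ i - e n) $ 2)
       * ((\<chi> i. c $ i + e n) $ 3 - (\<chi> i. c $ i - e n) $ 3))"
    proof (rule abs_integral_le_box[OF i3])
      show "0 \<le> r' * (B / e n ^ 3)" using r' B e(1)[of n] by simp
      show "(\<chi> i. c $ i - e n) $ i \<le> (\<chi> i. c $ i + e n) $ i" for i using e(1)[of n] by simp
      show "\<bar>(w x - w c) * h n x\<bar> \<le> r' * (B / e n ^ 3) * indicator (cbox (\<chi> i. c $ i - e n) (\<chi> i. c $ i + e n)) x" for x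
      proof (cases "dist x c \<le> e n")
        case True
        have "\<bar>x $ i - c $ i\<bar> \<le> e n" for i
          using component_le_norm_cart[of "x - c" i] True by (simp add: dist_norm)
        then have "x \<in> cbox (\<chi> i. c $ i - e n) (\<chi> i. c $ i + e n)"
          by (simp add: mem_box_cart abs_le_iff algebra_simps)
        moreover have "\<bar>w x - w c\<bar> * \<bar>h n x\<bar> \<le> r' * (B / e n ^ 3)"
          using s(2)[of x] True N[OF n] r' h(3)[of n x] by (intro mult_mono) auto
        ultimately show ?thesis by (simp add: abs_mult)
      next
        case False
        then have z: "h n x = 0" using h(2)[of n x] by simp
        show ?thesis unfolding z using r' B e(1)[of n] by simp
      qed
    qed
    also have "\<dots> = r' * (8 * B)" using e(1)[of n] by (simp add: power3_eq_cube field_simps)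
    also have "\<dots> < r" using r B by (simp add: r'_def field_simps)
    finally show ?thesis .
  qed
  then show "\<exists>N. \<forall>n\<ge>N. norm (integral\<^sup>L lebesgue (\<lambda>x. w x * h n x) - w c * k) < r"
    unfolding real_norm_def by blast
qed

section \<open>A regularised pole and its Laplacian\<close>

definition prof :: "real \<Rightarrow> real" where
  "prof t = (if t \<le> 1 / 4 then 0 else sstep (2 * t - 1) * inverse (sqrt t))"

lemma smooth_on_ident: "open S \<Longrightarrow> smooth_on S (\<lambda>x. x)"
  by (intro smooth_on_linear bounded_linear_ident)

text \<open>\<open>prof\<close> regularises t^(-1/2), where t is a squared distance, by a function
  that vanishes for t \<le> 1/2. The case split at 1/4 lies inside that range, so two overlapping
  open sets cover the line.\<close>

lemma smooth_on_prof: "smooth_on UNIV prof"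
proof -
  have 1: "smooth_on {1/4<..} prof"
  proof (rule smooth_on_cong)
    have id: "smooth_on {1/4<..} (\<lambda>t::real. t)" by (rule smooth_on_ident) simp
    have "smooth_on {1/4<..} (\<lambda>t. sstep (2 * t - 1))"
      by (rule smooth_on_compose[OF _ smooth_on_sstep]) (auto intro!: smooth_on_diff smooth_on_mult smooth_on_const id)
    moreover have "smooth_on {1/4<..} (\<lambda>t::real. inverse (sqrt t))"
      by (rule smooth_on_inverse_sqrt[OF _ id]) auto
    ultimately show "smooth_on {1/4<..} (\<lambda>t. sstep (2 * t - 1) * inverse (sqrt t))"
      by (intro smooth_on_mult) auto
  qed (auto simp: prof_def)
  have 2: "smooth_on {..<1/2} prof"
    by (rule smooth_on_cong[OF _ smooth_on_const[of _ 0]]) (auto simp: prof_def sstep_eq_0)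
  have "{1/4<..} \<union> {..<1/2} = (UNIV :: real set)" by auto
  then show ?thesis using smooth_on_Un[OF _ _ 1 2] by simp
qed

lemma prof_eq: "1 \<le> t \<Longrightarrow> prof t = inverse (sqrt t)"
  by (simp add: prof_def sstep_eq_1)

text \<open>The three-dimensional Laplacian of x \<mapsto> prof(|x|^2) as a function of t =
  |x|^2.\<close>

definition ker :: "real \<Rightarrow> real" where
  "ker t = 6 * deriv prof t + 4 * t * deriv (deriv prof) t"

lemma smooth_on_ker: "smooth_on UNIV ker"
  unfolding ker_def[abs_def]
  by (intro smooth_on_add smooth_on_mult smooth_on_const smooth_on_deriv smooth_on_prof smooth_on_ident open_UNIV)

text \<open>A regularisation of \<open>1 / |x - (p, q, a)|\<close> that is exact outside the ball of radius \<open>e\<close>: the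
  transmission conditions on the interface are therefore not perturbed.\<close>

definition poleq :: "real \<Rightarrow> real \<Rightarrow> real \<Rightarrow> real \<Rightarrow> real^3 \<Rightarrow> real" where
  "poleq p q a e x = prof (sqd p q (-1) a x / e\<^sup>2) / e"

lemma smooth_on_sqd_scaled: "smooth_on UNIV (\<lambda>x. sqd p q \<sigma> a x / c)"
  by (intro smooth_on_divide_const smooth_on_sqd open_UNIV)

lemma smooth_on_poleq: "smooth_on UNIV (poleq p q a e)"
  unfolding poleq_def[abs_def]
  by (intro smooth_on_divide_const smooth_on_compose[OF _ smooth_on_prof] smooth_on_sqd_scaled open_UNIV UNIV_I)

lemma poleq_eq: "0 < e \<Longrightarrow> e\<^sup>2 \<le> sqd p q (-1) a x \<Longrightarrow> poleq p q a e x = invr p q (-1) a x"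
  unfolding poleq_def invr_def by (subst prof_eq) (simp_all add: real_sqrt_divide inverse_eq_divide)

lemma pd_sqd_scaled: "pd i (\<lambda>x. sqd p q (-1) a x / c) x = 2 * coord p q (-1) a i x / c"
  by (subst pd_divide_const[OF smooth_on_differentiable[OF smooth_on_sqd[OF open_UNIV] UNIV_I]]) (simp add: pd_sqd)

lemma lap_poleq: "lap (poleq p q a e) x = ker (sqd p q (-1) a x / e\<^sup>2) / e ^ 3"
proof -
  let ?T = "\<lambda>x. sqd p q (-1) a x / e\<^sup>2" and ?c = "coord p q (-1) a"
  have dT: "?T differentiable (at x)" for x by (rule smooth_on_differentiable[OF smooth_on_sqd_scaled UNIV_I])
  have dc: "?c i differentiable (at x)" for i x by (rule smooth_on_differentiable[OF smooth_on_coord[OF open_UNIV] UNIV_I])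
  have dcd: "(\<lambda>x. 2 * ?c i x / e\<^sup>2) differentiable (at x)" for i x
    by (rule smooth_on_differentiable[OF _ UNIV_I]) (intro smooth_on_divide_const smooth_on_mult smooth_on_const smooth_on_coord open_UNIV)
  have D1: "(prof has_real_derivative deriv prof t) (at t)" for t by (rule smooth_on_real_DERIV[OF smooth_on_prof UNIV_I])
  have D2: "(deriv prof has_real_derivative deriv (deriv prof) t) (at t)" for t
    by (rule smooth_on_real_DERIV[OF smooth_on_deriv[OF open_UNIV smooth_on_prof] UNIV_I])
  have dP: "(\<lambda>x. prof (?T x)) differentiable (at x)" "(\<lambda>x. deriv prof (?T x)) differentiable (at x)" for x
    by (rule smooth_on_differentiable[OF smooth_on_compose[OF open_UNIV smooth_on_prof smooth_on_sqd_scaled UNIV_I] UNIV_I],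
        rule smooth_on_differentiable[OF smooth_on_compose[OF open_UNIV smooth_on_deriv[OF open_UNIV smooth_on_prof] smooth_on_sqd_scaled UNIV_I] UNIV_I])
  have 1: "pd i (poleq p q a e) = (\<lambda>x. deriv prof (?T x) * (2 * ?c i x / e\<^sup>2) / e)" for i
    unfolding poleq_def[abs_def]
    by (rule ext) (simp add: pd_divide_const[OF dP(1)] pd_compose[OF D1 dT] pd_sqd_scaled)
  have 2: "pd i (pd i (poleq p q a e)) x = (deriv (deriv prof) (?T x) * (2 * ?c i x / e\<^sup>2)\<^sup>2 + deriv prof (?T x) * 2 / e\<^sup>2) / e" for i
  proof -
    have "pd i (\<lambda>x. 2 * ?c i x / e\<^sup>2) x = 2 / e\<^sup>2"
      by (simp add: pd_divide_const pd_cmult dc differentiable_mult pd_coord)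
    then show ?thesis unfolding 1
      by (subst pd_divide_const[OF differentiable_mult[OF dP(2) dcd]], subst pd_mult[OF dP(2) dcd], subst pd_compose[OF D2 dT])
         (simp add: pd_sqd_scaled power2_eq_square algebra_simps)
  qed
  have s: "sqd p q (-1) a x = (?c 1 x)\<^sup>2 + (?c 2 x)\<^sup>2 + (?c 3 x)\<^sup>2" by (rule sqd_coord) simp
  have "lap (poleq p q a e) x = (4 * deriv (deriv prof) (?T x) * ?T x / e\<^sup>2 + 6 * deriv prof (?T x) / e\<^sup>2) / e"
    unfolding lap_def 2 by (cases "e = 0") (simp_all add: s field_simps power2_eq_square)
  then show ?thesis unfolding ker_def by (cases "e = 0") (simp_all add: field_simps power2_eq_square power3_eq_cube)
qed

lemma smooth_on_lap_poleq: "smooth_on UNIV (lap (poleq p q a e))"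
  by (rule smooth_on_lap[OF open_UNIV smooth_on_poleq])

lemma lap_poleq_eq_0:
  assumes "0 < e" "e\<^sup>2 < sqd p q (-1) a x"
  shows "lap (poleq p q a e) x = 0" "pd i (lap (poleq p q a e)) x = 0"
proof -
  let ?O = "{x. e\<^sup>2 < sqd p q (-1) a x}"
  have o: "open ?O" unfolding sqd_def ht_def by (intro open_Collect_less continuous_intros)
  have z: "lap (poleq p q a e) x = 0" if "x \<in> ?O" for x
  proof -
    have "pd i (pd i (poleq p q a e)) x = pd i (pd i (invr p q (-1) a)) x" for i
      by (rule pd_cong[OF o that], rule pd_cong[OF o]) (use assms(1) in \<open>auto intro: poleq_eq\<close>)
    moreover have "lap (invr p q (-1) a) x = 0" by (rule lap_invr) (use that in \<open>auto intro: le_less_trans[OF zero_le_power2]\<close>)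
    ultimately show ?thesis by (simp add: lap_def)
  qed
  show "lap (poleq p q a e) x = 0" by (rule z) (simp add: assms)
  have "pd i (lap (poleq p q a e)) x = pd i (\<lambda>x. 0) x" by (rule pd_cong[OF o]) (use assms z in auto)
  then show "pd i (lap (poleq p q a e)) x = 0" by simp
qed

lemma coord_le_sqd: "\<bar>coord p q (-1) a i x\<bar> \<le> sqrt (sqd p q (-1) a x)"
proof -
  have "(coord p q (-1) a i x)\<^sup>2 \<le> sqd p q (-1) a x"
    using exhaust_3[of i] sqd_coord[of "-1" p q a x] by auto
  then show ?thesis using real_sqrt_le_mono by fastforce
qed

text \<open>The constant is uniform in the radius e. Differentiating the kernel costs a further 1/e,
  compensated by the factor x3 - a, which is at most e in modulus on the support.\<close>

lemma poleq_kernel_bounds: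
  obtains B where "\<And>e x. 0 < e \<Longrightarrow> \<bar>lap (poleq p q a e) x\<bar> \<le> B / e ^ 3"
    "\<And>e x i. 0 < e \<Longrightarrow> \<bar>pd i (\<lambda>x. (x $ 3 - a) * lap (poleq p q a e) x) x\<bar> \<le> B / e ^ 3"
proof -
  note ck = smooth_on_continuous[OF smooth_on_ker] smooth_on_continuous[OF smooth_on_deriv[OF open_UNIV smooth_on_ker]]
  have cI: "compact {0..1::real}" by simp
  obtain B1 where B1: "B1 > 0" "\<And>t. t \<in> {0..1} \<Longrightarrow> \<bar>ker t\<bar> \<le> B1"
    using continuous_on_bounded_abs[OF cI continuous_on_subset[OF ck(1) subset_UNIV]] by blast
  obtain B2 where B2: "B2 > 0" "\<And>t. t \<in> {0..1} \<Longrightarrow> \<bar>deriv ker t\<bar> \<le> B2"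
    using continuous_on_bounded_abs[OF cI continuous_on_subset[OF ck(2) subset_UNIV]] by blast
  have sq0: "0 \<le> sqd p q (-1) a x" for x by (simp add: sqd_def)
  have T: "sqd p q (-1) a x / e\<^sup>2 \<in> {0..1}" if "0 < e" "sqd p q (-1) a x \<le> e\<^sup>2" for x e
    using that sq0[of x] by simp
  have b1: "\<bar>lap (poleq p q a e) x\<bar> \<le> B1 / e ^ 3" if e: "0 < e" for e x
  proof (cases "sqd p q (-1) a x \<le> e\<^sup>2")
    case True
    then show ?thesis unfolding lap_poleq abs_divide using B1(2)[OF T[OF e True]] e
      by (simp add: divide_right_mono)
  next
    case False
    then show ?thesis using lap_poleq_eq_0(1)[OF e, of p q a x] B1 e by simp
  qed
  have d: "lap (poleq p q a e) differentiable (at x)" for e x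
    by (rule smooth_on_differentiable[OF smooth_on_lap_poleq UNIV_I])
  have b2: "\<bar>pd i (\<lambda>x. (x $ 3 - a) * lap (poleq p q a e) x) x\<bar> \<le> (B1 + 2 * B2) / e ^ 3" if e: "0 < e" for e x i
  proof (cases "sqd p q (-1) a x \<le> e\<^sup>2")
    case True
    let ?c = "coord p q (-1) a" and ?T = "sqd p q (-1) a x / e\<^sup>2"
    have "pd i (lap (poleq p q a e)) x = deriv ker ?T * (2 * ?c i x / e\<^sup>2) / e ^ 3"
    proof -
      have dT: "(\<lambda>x. sqd p q (-1) a x / e\<^sup>2) differentiable (at x)" by (rule smooth_on_differentiable[OF smooth_on_sqd_scaled UNIV_I])
      have dk: "(\<lambda>x. ker (sqd p q (-1) a x / e\<^sup>2)) differentiable (at x)"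
        by (rule smooth_on_differentiable[OF smooth_on_compose[OF open_UNIV smooth_on_ker smooth_on_sqd_scaled UNIV_I] UNIV_I])
      show ?thesis unfolding lap_poleq[abs_def]
        by (subst pd_divide_const[OF dk], subst pd_compose[OF smooth_on_real_DERIV[OF smooth_on_ker UNIV_I] dT])
           (simp add: pd_sqd_scaled)
    qed
    have le: "sqrt (sqd p q (-1) a x) \<le> e" using True e by (simp add: real_le_lsqrt)
    have ci: "\<bar>?c j x\<bar> \<le> e" for j using coord_le_sqd[of p q a j x] le by linarith
    have c3: "x $ 3 - a = ?c 3 x" by (simp add: coord_def)
    have "\<bar>?c 3 x\<bar> * \<bar>?c i x\<bar> \<le> e * e" using ci e by (intro mult_mono) auto
    then have "\<bar>deriv ker ?T\<bar> * (\<bar>?c 3 x\<bar> * \<bar>?c i x\<bar>) \<le> B2 * (e * e)"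
      using B2(1) by (intro mult_mono[OF B2(2)[OF T[OF e True]]]) auto
    then have "\<bar>(x $ 3 - a) * pd i (lap (poleq p q a e)) x\<bar> \<le> 2 * B2 / e ^ 3"
      unfolding \<open>pd i (lap (poleq p q a e)) x = _\<close> c3 using e
      by (simp add: abs_mult power2_eq_square power3_eq_cube field_simps)
    moreover have "\<bar>if i = 3 then lap (poleq p q a e) x else 0\<bar> \<le> B1 / e ^ 3"
      using b1[OF e, of x] B1 e by simp
    ultimately show ?thesis unfolding pd_x3_mult[OF d] add_divide_distrib by linarith
  next
    case False
    then have "pd i (\<lambda>x. (x $ 3 - a) * lap (poleq p q a e) x) x = 0"
      unfolding pd_x3_mult[OF d] using lap_poleq_eq_0[OF e, of p q a x] by simp
    then show ?thesis using B1 B2 e by simp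
  qed
  show ?thesis
  proof (rule that[of "B1 + 2 * B2"])
    show "\<bar>lap (poleq p q a e) x\<bar> \<le> (B1 + 2 * B2) / e ^ 3" if "0 < e" for e x
      using order_trans[OF b1[OF that, of x] divide_right_mono[of B1 "B1 + 2 * B2" "e ^ 3"]] B2 that by simp
  qed (rule b2)
qed

text \<open>The inner product of grad \<psi> and grad (1/|x|) for the radial cutoff \<psi> = 1 -
  \<open>sstep\<close> (|x|^2 - 1); it lives where 1 \<le> |x|^2 \<le> 2.\<close>

definition kfun :: "real^3 \<Rightarrow> real" where
  "kfun x = 2 * deriv sstep (sqd 0 0 (-1) 0 x - 1) * invr 0 0 (-1) 0 x"

text \<open>The mass of \<open>- \<Delta>(1 / |x|)\<close>, that is \<open>4 \<pi>\<close>; only its positivity matters.\<close>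

definition kappa0 :: real where "kappa0 = integral\<^sup>L lebesgue kfun"

lemma compact_sqd_le: "compact {x. sqd p q (-1) a x \<le> c}"
proof -
  have "bounded {x. sqd p q (-1) a x \<le> c}"
  proof (rule boundedI)
    fix x assume "x \<in> {x. sqd p q (-1) a x \<le> c}"
    then have s: "sqrt (sqd p q (-1) a x) \<le> sqrt c" by simp
    have "\<bar>x $ i\<bar> \<le> \<bar>p\<bar> + \<bar>q\<bar> + \<bar>a\<bar> + sqrt c" for i
      using order_trans[OF coord_le_sqd s, of i] exhaust_3[of i] by (auto simp: coord_def)
    then have "(\<Sum>i\<in>UNIV. \<bar>x $ i\<bar>) \<le> (\<Sum>i\<in>(UNIV::3 set). \<bar>p\<bar> + \<bar>q\<bar> + \<bar>a\<bar> + sqrt c)" by (rule sum_mono)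
    then show "norm x \<le> (\<Sum>i\<in>(UNIV::3 set). \<bar>p\<bar> + \<bar>q\<bar> + \<bar>a\<bar> + sqrt c)"
      using norm_le_l1_cart[of x] by linarith
  qed
  moreover have "closed {x. sqd p q (-1) a x \<le> c}"
    unfolding sqd_def ht_def by (intro closed_Collect_le continuous_intros)
  ultimately show ?thesis by (simp add: compact_eq_bounded_closed)
qed

lemma kfun_continuous: "continuous_on UNIV kfun"
proof -
  let ?s = "sqd 0 0 (-1) 0"
  have o1: "open {x. ?s x < 1}" unfolding sqd_def ht_def by (intro open_Collect_less continuous_intros)
  have o2: "open {x. 0 < ?s x}" by (rule open_sqd_pos)
  have "continuous_on ({x. ?s x < 1} \<union> {x. 0 < ?s x}) kfun"
  proof (rule continuous_on_open_Un[OF o1 o2])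
    show "continuous_on {x. ?s x < 1} kfun"
      by (rule continuous_on_cong[THEN iffD1, OF refl _ continuous_on_const[of _ 0]])
         (simp add: kfun_def deriv_sstep_eq_0)
    show "continuous_on {x. 0 < ?s x} kfun"
      unfolding kfun_def[abs_def]
      by (intro continuous_intros continuous_on_compose2[OF continuous_on_deriv_sstep]
          smooth_on_continuous[OF smooth_on_invr[OF o2 order_refl]] smooth_on_continuous[OF smooth_on_sqd[OF o2]]) auto
  qed
  moreover have "{x. ?s x < 1} \<union> {x. 0 < ?s x} = UNIV" by auto
  ultimately show ?thesis by simp
qed

lemma kfun_nonneg: "0 \<le> kfun x"
  by (simp add: kfun_def deriv_sstep_nonneg invr_def sqd_def)

lemma kfun_outside: "x \<notin> {x. sqd 0 0 (-1) 0 x \<le> 2} \<Longrightarrow> kfun x = 0"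
  by (simp add: kfun_def deriv_sstep_eq_0)

text \<open>A nonnegative continuous integrand with one positive value has positive integral; that
  value sits where the derivative of \<open>sstep\<close> equals its mean slope 1.\<close>

lemma kappa0_pos: "0 < kappa0"
proof -
  have "\<exists>t>0. t < 1 \<and> sstep 1 - sstep 0 = (1 - 0) * deriv sstep t"
    by (rule MVT2) (auto intro: smooth_on_real_DERIV[OF smooth_on_sstep])
  then obtain t where t: "0 < t" "t < 1" "deriv sstep t = 1" by (auto simp: sstep_eq_0 sstep_eq_1)
  define x0 :: "real^3" where "x0 = vector [sqrt (1 + t), 0, 0]"
  have s0: "sqd 0 0 (-1) 0 x0 = 1 + t" using t by (simp add: x0_def sqd_def ht_def)
  have k0: "0 < kfun x0" using t by (simp add: kfun_def s0 invr_def)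
  have i: "integrable lebesgue kfun"
    by (rule integrable_continuous_compact[OF kfun_continuous compact_sqd_le kfun_outside])
  define c where "c = kfun x0 / 2"
  have c: "0 < c" using k0 by (simp add: c_def)
  have "open {x. c < kfun x}" by (intro open_Collect_less continuous_intros kfun_continuous)
  moreover have "x0 \<in> {x. c < kfun x}" using k0 by (simp add: c_def)
  ultimately obtain r where r: "0 < r" "cball x0 r \<subseteq> {x. c < kfun x}" using open_contains_cball by metis
  have m: "cball x0 r \<in> lmeasurable" by simp
  have ii: "integrable lebesgue (\<lambda>x. c * indicator (cball x0 r) x)"
    by (intro integrable_mult_right lmeasurable_iff_integrable[THEN iffD1] m)
  have "0 < c * measure lebesgue (cball x0 r)"
    using c content_cball_pos[OF r(1), of x0] by (simp add: measure_completion)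
  also have "\<dots> = integral\<^sup>L lebesgue (\<lambda>x. c * indicator (cball x0 r) x)" by simp
  also have "\<dots> \<le> kappa0" unfolding kappa0_def
  proof (rule integral_mono[OF ii i])
    fix x show "c * indicator (cball x0 r) x \<le> kfun x"
      using r(2) kfun_nonneg[of x] by (cases "x \<in> cball x0 r") (auto simp: subset_eq less_imp_le)
  qed
  finally show ?thesis .
qed

text \<open>\<psi> times the Laplacian of f is div (\<psi> grad f) minus the inner product of grad
  \<psi> and grad f, and the divergence integrates to 0. As e < 1, \<psi> is 1 where f is
  regularised, and f is the exact pole where grad \<psi> lives; so the mass is independent of
  e.\<close>

lemma integral_lap_poleq:
  assumes e: "0 < e" "e < 1"
  shows "integral\<^sup>L lebesgue (lap (poleq p q a e)) = - kappa0"
proof -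
  let ?s = "sqd p q (-1) a" and ?c = "coord p q (-1) a" and ?f = "poleq p q a e"
  define \<psi> where "\<psi> x = 1 - sstep (?s x - 1)" for x
  have s\<psi>: "smooth_on UNIV \<psi>"
    unfolding \<psi>_def[abs_def]
    by (intro smooth_on_diff smooth_on_const smooth_on_compose[OF _ smooth_on_sstep] smooth_on_sqd open_UNIV UNIV_I)
  have pd\<psi>: "pd i \<psi> x = - (deriv sstep (?s x - 1) * (2 * ?c i x))" for i x
  proof -
    have ds: "?s differentiable (at x)" by (rule smooth_on_differentiable[OF smooth_on_sqd[OF open_UNIV] UNIV_I])
    have d1: "(\<lambda>x. ?s x - 1) differentiable (at x)" by (intro differentiable_diff ds differentiable_const)
    have d2: "(\<lambda>x. sstep (?s x - 1)) differentiable (at x)"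
      by (rule smooth_on_differentiable[OF smooth_on_compose[OF open_UNIV smooth_on_sstep _ UNIV_I] UNIV_I])
         (intro smooth_on_diff smooth_on_const smooth_on_sqd open_UNIV)
    show ?thesis unfolding \<psi>_def[abs_def]
      by (subst pd_diff[OF differentiable_const d2], subst pd_compose[OF smooth_on_real_DERIV[OF smooth_on_sstep UNIV_I] d1],
          subst pd_diff[OF ds differentiable_const]) (simp add: pd_sqd)
  qed
  have \<psi>0: "\<psi> x = 0" if "x \<notin> {x. ?s x \<le> 2}" for x using that by (simp add: \<psi>_def sstep_eq_1)
  have \<psi>1: "\<psi> x * lap ?f x = lap ?f x" for x
  proof (cases "e\<^sup>2 < ?s x")
    case False
    have "e\<^sup>2 \<le> 1" using e by (simp add: power_le_one)
    then have "\<psi> x = 1" using False by (simp add: \<psi>_def sstep_eq_0)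
    then show ?thesis by simp
  qed (simp add: lap_poleq_eq_0[OF e(1)])
  have sf: "smooth_on UNIV (pd i ?f)" for i by (rule smooth_on_pd[OF smooth_on_poleq])
  have sm: "smooth_on UNIV (\<lambda>x. \<psi> x * pd i ?f x)" for i by (intro smooth_on_mult open_UNIV s\<psi> sf)
  have mz: "\<psi> x * pd i ?f x = 0" if "x \<notin> {x. ?s x \<le> 2}" for x i using \<psi>0[OF that] by simp
  have I0: "integral\<^sup>L lebesgue (pd i (\<lambda>x. \<psi> x * pd i ?f x)) = 0" for i
    by (rule integral_pd_eq_0[OF sm compact_sqd_le mz])
  have Ii: "integrable lebesgue (pd i (\<lambda>x. \<psi> x * pd i ?f x))" for i
    by (rule integrable_continuous_compact[OF smooth_on_continuous[OF smooth_on_pd[OF sm]] compact_sqd_le[of p q a 2]])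
       (rule pd_eq_0_outside[OF compact_imp_closed[OF compact_sqd_le[of p q a 2]]], use \<psi>0 in auto)
  define g where "g x = kfun (- vector [p, q, a] + x)" for x
  have sc: "sqd 0 0 (-1) 0 (- vector [p, q, a] + x) = ?s x" for x
    by (simp add: sqd_def ht_def power2_eq_square algebra_simps)
  have gx: "g x = 2 * deriv sstep (?s x - 1) * invr p q (-1) a x" for x
    unfolding g_def kfun_def invr_def sc ..
  have Ig: "integral\<^sup>L lebesgue g = kappa0"
    unfolding g_def[abs_def] kappa0_def
    by (rule integral_lebesgue_translation[OF borel_measurable_continuous_onI[OF kfun_continuous]])
  have ig: "integrable lebesgue g"
  proof (rule integrable_continuous_compact[OF _ compact_sqd_le[of p q a 2]])
    show "continuous_on UNIV g" unfolding g_def[abs_def]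
      by (intro continuous_on_compose2[OF kfun_continuous] continuous_intros) auto
    show "g x = 0" if "x \<notin> {x. ?s x \<le> 2}" for x using that by (simp add: gx deriv_sstep_eq_0)
  qed
  have pt: "lap ?f x = (pd 1 (\<lambda>x. \<psi> x * pd 1 ?f x) x + pd 2 (\<lambda>x. \<psi> x * pd 2 ?f x) x + pd 3 (\<lambda>x. \<psi> x * pd 3 ?f x) x) - g x" for x
  proof -
    have m: "pd i (\<lambda>x. \<psi> x * pd i ?f x) x = \<psi> x * pd i (pd i ?f) x + pd i \<psi> x * pd i ?f x" for i
      by (rule pd_mult[OF smooth_on_differentiable[OF s\<psi> UNIV_I] smooth_on_differentiable[OF sf UNIV_I]])
    have "pd 1 \<psi> x * pd 1 ?f x + pd 2 \<psi> x * pd 2 ?f x + pd 3 \<psi> x * pd 3 ?f x = g x"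
    proof (cases "?s x < 1")
      case True
      then show ?thesis by (simp add: pd\<psi> gx deriv_sstep_eq_0)
    next
      case False
      have e1: "e\<^sup>2 < 1" using e by (simp add: power_less_one_iff)
      have pos: "0 < ?s x" using False by linarith
      let ?O = "{x. e\<^sup>2 < ?s x}"
      have o: "open ?O" unfolding sqd_def ht_def by (intro open_Collect_less continuous_intros)
      have "pd i ?f x = pd i (invr p q (-1) a) x" for i
        by (rule pd_cong[OF o]) (use False e1 e in \<open>auto intro: poleq_eq\<close>)
      then have pf: "pd i ?f x = - (?c i x * invr p q (-1) a x ^ 3)" for i
        using pd_invr[OF _ pos] by simp
      have "pd 1 \<psi> x * pd 1 ?f x + pd 2 \<psi> x * pd 2 ?f x + pd 3 \<psi> x * pd 3 ?f x
        = 2 * deriv sstep (?s x - 1) * (((?c 1 x)\<^sup>2 + (?c 2 x)\<^sup>2 + (?c 3 x)\<^sup>2) * invr p q (-1) a x ^ 2) * invr p q (-1) a x"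
        unfolding pd\<psi> pf by (simp add: power2_eq_square power3_eq_cube algebra_simps)
      also have "\<dots> = g x" using sqd_coord[of "-1" p q a x] sqd_invr[OF pos] by (simp add: gx)
      finally show ?thesis .
    qed
    then show ?thesis using \<psi>1[of x] unfolding m lap_def by (simp add: algebra_simps)
  qed
  have "integral\<^sup>L lebesgue (lap ?f) = integral\<^sup>L lebesgue (\<lambda>x. (pd 1 (\<lambda>x. \<psi> x * pd 1 ?f x) x + pd 2 (\<lambda>x. \<psi> x * pd 2 ?f x) x + pd 3 (\<lambda>x. \<psi> x * pd 3 ?f x) x) - g x)"
    by (rule Bochner_Integration.integral_cong[OF refl pt])
  also have "\<dots> = - kappa0"
    using Ii ig by (simp add: I0 Ig)
  finally show ?thesis .
qed

section \<open>Cutoff at infinity\<close>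

text \<open>Built from the squared distance to the foot point, which keeps it smooth at the centre
  and symmetric about the interface. The transition takes place in \<open>shell\<close>.\<close>

definition cutoff :: "real \<Rightarrow> real \<Rightarrow> real \<Rightarrow> real^3 \<Rightarrow> real" where
  "cutoff p q R x = 1 - sstep (sqd p q (-1) 0 x / R\<^sup>2 - 1)"

definition shell :: "real \<Rightarrow> real \<Rightarrow> real \<Rightarrow> (real^3) set" where
  "shell p q R = {x. R\<^sup>2 \<le> sqd p q (-1) 0 x \<and> sqd p q (-1) 0 x \<le> 2 * R\<^sup>2}"

lemma sqd_rad: "sqd p q (-1) 0 x = (rad p q x)\<^sup>2"
  by (simp add: rad_sq sqd_def ht_def)

lemma smooth_on_cut_arg: "smooth_on UNIV (\<lambda>x. sqd p q (-1) 0 x / R\<^sup>2 - 1)"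
  by (intro smooth_on_diff smooth_on_const smooth_on_sqd_scaled open_UNIV)

lemma smooth_on_cutoff: "smooth_on UNIV (cutoff p q R)"
  unfolding cutoff_def[abs_def]
  by (intro smooth_on_diff smooth_on_const smooth_on_compose[OF _ smooth_on_sstep smooth_on_cut_arg] open_UNIV UNIV_I)

lemma cutoff_eq_1: "0 < R \<Longrightarrow> rad p q x \<le> R \<Longrightarrow> cutoff p q R x = 1"
proof -
  assume R: "0 < R" "rad p q x \<le> R"
  have "(rad p q x)\<^sup>2 \<le> R\<^sup>2" using R rad_nonneg by (intro power_mono) auto
  then show ?thesis using R by (simp add: cutoff_def sqd_rad sstep_eq_0)
qed

lemma cutoff_eq_0: "0 < R \<Longrightarrow> x \<notin> {x. sqd p q (-1) 0 x \<le> 2 * R\<^sup>2} \<Longrightarrow> cutoff p q R x = 0"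
  by (simp add: cutoff_def sstep_eq_1 field_simps)

lemma pd_cutoff: "pd i (cutoff p q R) x = - (deriv sstep (sqd p q (-1) 0 x / R\<^sup>2 - 1) * (2 * coord p q (-1) 0 i x / R\<^sup>2))"
proof -
  have d0: "(\<lambda>x. sqd p q (-1) 0 x / R\<^sup>2) differentiable (at x)" by (rule smooth_on_differentiable[OF smooth_on_sqd_scaled UNIV_I])
  have d1: "(\<lambda>x. sqd p q (-1) 0 x / R\<^sup>2 - 1) differentiable (at x)" by (rule smooth_on_differentiable[OF smooth_on_cut_arg UNIV_I])
  have d2: "(\<lambda>x. sstep (sqd p q (-1) 0 x / R\<^sup>2 - 1)) differentiable (at x)"
    by (rule smooth_on_differentiable[OF smooth_on_compose[OF open_UNIV smooth_on_sstep smooth_on_cut_arg UNIV_I] UNIV_I])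
  show ?thesis unfolding cutoff_def[abs_def]
    by (subst pd_diff[OF differentiable_const d2], subst pd_compose[OF smooth_on_real_DERIV[OF smooth_on_sstep UNIV_I] d1],
        subst pd_diff[OF d0 differentiable_const]) (simp add: pd_sqd_scaled)
qed

lemma pd_cutoff_outside: "0 < R \<Longrightarrow> x \<notin> shell p q R \<Longrightarrow> pd i (cutoff p q R) x = 0"
  unfolding pd_cutoff by (subst deriv_sstep_eq_0) (auto simp: shell_def field_simps)

lemma compact_shell: "compact (shell p q R)"
proof -
  have "shell p q R = {x. sqd p q (-1) 0 x \<le> 2 * R\<^sup>2} \<inter> {x. R\<^sup>2 \<le> sqd p q (-1) 0 x}" by (auto simp: shell_def)
  moreover have "closed {x. R\<^sup>2 \<le> sqd p q (-1) 0 x}" unfolding sqd_def ht_def by (intro closed_Collect_le continuous_intros)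
  ultimately show ?thesis using compact_sqd_le by (simp add: compact_Int_closed)
qed

lemma shell_rad: "0 < R \<Longrightarrow> x \<in> shell p q R \<Longrightarrow> R \<le> rad p q x \<and> rad p q x \<le> 2 * R"
proof -
  assume R: "0 < R" "x \<in> shell p q R"
  have 1: "R\<^sup>2 \<le> (rad p q x)\<^sup>2" "(rad p q x)\<^sup>2 \<le> 2 * R\<^sup>2" using R by (simp_all add: shell_def sqd_rad)
  have "2 * R\<^sup>2 \<le> (2 * R)\<^sup>2" using R by (simp add: power2_eq_square)
  then have "(rad p q x)\<^sup>2 \<le> (2 * R)\<^sup>2" using 1 by linarith
  then show ?thesis using 1 R by (auto intro: power2_le_imp_le rad_nonneg)
qed

lemma cutoff_bounds:
  obtains M where "0 \<le> M" "\<And>R x i. 0 < R \<Longrightarrow> \<bar>pd i (cutoff p q R) x\<bar> \<le> M / R"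
    "\<And>R x i j. 0 < R \<Longrightarrow> \<bar>pd j (pd i (cutoff p q R)) x\<bar> \<le> M / R\<^sup>2"
proof -
  obtain M1 where M1: "M1 > 0" "\<And>t. \<bar>deriv sstep t\<bar> \<le> M1" using deriv_sstep_bounded by blast
  have s2: "smooth_on UNIV (deriv sstep)" by (rule smooth_on_deriv[OF open_UNIV smooth_on_sstep])
  have c2: "continuous_on UNIV (deriv (deriv sstep))" by (rule smooth_on_continuous[OF smooth_on_deriv[OF open_UNIV s2]])
  obtain M2 where M2: "M2 > 0" "\<And>t. t \<in> {0..1::real} \<Longrightarrow> \<bar>deriv (deriv sstep) t\<bar> \<le> M2"
    using continuous_on_bounded_abs[OF compact_Icc continuous_on_subset[OF c2 subset_UNIV]] by blast
  define M where "M = 4 * M1 + 16 * M2"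
  have M0: "0 \<le> M" using M1 M2 by (simp add: M_def)
  have cb: "\<bar>coord p q (-1) 0 i x\<bar> \<le> 2 * R" if "0 < R" "x \<in> shell p q R" for i x R
    using coord_le_sqd[of p q 0 i x] shell_rad[OF that] by (simp add: sqd_rad rad_nonneg)
  have b1: "\<bar>pd i (cutoff p q R) x\<bar> \<le> M / R" if R: "0 < R" for R x i
  proof (cases "x \<in> shell p q R")
    case True
    have "\<bar>deriv sstep (sqd p q (-1) 0 x / R\<^sup>2 - 1)\<bar> * \<bar>coord p q (-1) 0 i x\<bar> \<le> M1 * (2 * R)"
      using M1(1) by (intro mult_mono[OF M1(2) cb[OF R True]]) auto
    then have "\<bar>pd i (cutoff p q R) x\<bar> \<le> 4 * M1 / R"
      using R unfolding pd_cutoff by (simp add: abs_mult power2_eq_square field_simps)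
    also have "\<dots> \<le> M / R" using R M2 by (intro divide_right_mono) (auto simp: M_def)
    finally show ?thesis .
  qed (use R M0 in \<open>simp add: pd_cutoff_outside\<close>)
  have b2: "\<bar>pd j (pd i (cutoff p q R)) x\<bar> \<le> M / R\<^sup>2" if R: "0 < R" for R x i j
  proof (cases "x \<in> shell p q R")
    case True
    let ?T = "\<lambda>x. sqd p q (-1) 0 x / R\<^sup>2 - 1" and ?c = "coord p q (-1) 0"
    have T01: "?T x \<in> {0..1}" using True R by (auto simp: shell_def field_simps)
    have dT: "?T differentiable (at x)" by (rule smooth_on_differentiable[OF smooth_on_cut_arg UNIV_I])
    have d0: "(\<lambda>x. sqd p q (-1) 0 x / R\<^sup>2) differentiable (at x)" by (rule smooth_on_differentiable[OF smooth_on_sqd_scaled UNIV_I])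
    have dd: "(\<lambda>x. deriv sstep (?T x)) differentiable (at x)"
      by (rule smooth_on_differentiable[OF smooth_on_compose[OF open_UNIV s2 smooth_on_cut_arg UNIV_I] UNIV_I])
    have dc: "?c i differentiable (at x)" by (rule smooth_on_differentiable[OF smooth_on_coord[OF open_UNIV] UNIV_I])
    have dcd: "(\<lambda>x. 2 * ?c i x / R\<^sup>2) differentiable (at x)"
      by (rule smooth_on_differentiable[OF _ UNIV_I]) (intro smooth_on_divide_const smooth_on_mult smooth_on_const smooth_on_coord open_UNIV)
    have pT: "pd j ?T x = 2 * ?c j x / R\<^sup>2" by (subst pd_diff[OF d0 differentiable_const]) (simp add: pd_sqd_scaled)
    have pc: "pd j (\<lambda>x. 2 * ?c i x / R\<^sup>2) x = 2 * (if i = j then 1 else 0) / R\<^sup>2"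
      by (simp add: pd_divide_const pd_cmult dc differentiable_mult pd_coord)
    have e: "pd j (pd i (cutoff p q R)) x = - (deriv sstep (?T x) * (2 * (if i = j then 1 else 0) / R\<^sup>2)
        + (deriv (deriv sstep) (?T x) * (2 * ?c j x / R\<^sup>2)) * (2 * ?c i x / R\<^sup>2))"
      unfolding pd_cutoff[abs_def]
      by (subst pd_minus[OF differentiable_mult[OF dd dcd]], subst pd_mult[OF dd dcd],
          subst pd_compose[OF smooth_on_real_DERIV[OF s2 UNIV_I] dT]) (simp only: pT pc)
    have "\<bar>deriv (deriv sstep) (?T x)\<bar> * (\<bar>?c j x\<bar> * \<bar>?c i x\<bar>) \<le> M2 * ((2 * R) * (2 * R))"
      using M2 R by (intro mult_mono M2(2)[OF T01] cb[OF R True]) auto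
    then have t2: "\<bar>(deriv (deriv sstep) (?T x) * (2 * ?c j x / R\<^sup>2)) * (2 * ?c i x / R\<^sup>2)\<bar> \<le> 16 * M2 / R\<^sup>2"
      using R by (simp add: abs_mult power2_eq_square field_simps)
    have t1: "\<bar>deriv sstep (?T x) * (2 * (if i = j then 1 else 0) / R\<^sup>2)\<bar> \<le> 4 * M1 / R\<^sup>2"
      using R M1(1) M1(2)[of "?T x"] by (simp add: abs_mult field_simps)
    have "\<bar>pd j (pd i (cutoff p q R)) x\<bar> \<le> 4 * M1 / R\<^sup>2 + 16 * M2 / R\<^sup>2"
      unfolding e abs_minus_cancel using t1 t2 by (rule order_trans[OF abs_triangle_ineq add_mono])
    then show ?thesis by (simp add: M_def add_divide_distrib)
  next
    case False
    have "pd j (pd i (cutoff p q R)) x = 0"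
      by (rule pd_eq_0_outside[of "shell p q R", OF compact_imp_closed[OF compact_shell] _ False]) (rule pd_cutoff_outside[OF R])
    then show ?thesis using R M0 by simp
  qed
  show ?thesis by (rule that[OF M0 b1 b2])
qed

section \<open>Estimates on the cutoff shell\<close>

lemma hooke_abs_le:
  assumes "\<And>i j. \<bar>h i j\<bar> \<le> B" shows "\<bar>hooke mu lam h i j\<bar> \<le> (2 * \<bar>mu\<bar> + 3 * \<bar>lam\<bar>) * B"
proof -
  have B: "0 \<le> B" using order_trans[OF abs_ge_zero assms[of 1 1]] .
  have "\<bar>h i j + h j i\<bar> \<le> 2 * B" using assms[of i j] assms[of j i] by linarith
  then have 1: "\<bar>mu * (h i j + h j i)\<bar> \<le> \<bar>mu\<bar> * (2 * B)" unfolding abs_mult by (intro mult_left_mono) auto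
  have "\<bar>h 1 1 + h 2 2 + h 3 3\<bar> \<le> 3 * B" using assms[of 1 1] assms[of 2 2] assms[of 3 3] by linarith
  then have "\<bar>lam * (h 1 1 + h 2 2 + h 3 3)\<bar> \<le> \<bar>lam\<bar> * (3 * B)" unfolding abs_mult by (intro mult_left_mono) auto
  then have 2: "\<bar>if i = j then lam * (h 1 1 + h 2 2 + h 3 3) else 0\<bar> \<le> \<bar>lam\<bar> * (3 * B)" using B by simp
  show ?thesis unfolding hooke_def using abs_triangle_ineq[THEN order_trans, OF add_mono[OF 1 2]] by (simp add: algebra_simps)
qed

lemma pd_hooke:
  assumes "\<And>i j. h i j differentiable (at x)"
  shows "pd n (\<lambda>x. hooke mu lam (\<lambda>i j. h i j x) i j) x = hooke mu lam (\<lambda>i j. pd n (h i j) x) i j"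
  unfolding hooke_def by (cases "i = j") (simp_all add: pd_add pd_cmult differentiable_mult assms)

context weak_solution
begin

text \<open>Power count: v times grad \<eta> is O(R^-2) and its derivatives are O(R^-3), against an
  area of order R^2 and a volume of order R^3. No power of R survives, and the bound is
  \<open>m\<close> times a constant.\<close>

lemma shell_estimates:
  fixes v :: "3 \<Rightarrow> real^3 \<Rightarrow> real" and S :: "3 \<Rightarrow> 3 \<Rightarrow> real^3 \<Rightarrow> real"
  assumes s: "\<sigma> = 1 \<or> \<sigma> = -1" and d: "d > 0"
    and v: "\<And>i. smooth_on (hs \<sigma> d) (v i)" and S: "\<And>i j. smooth_on (hs \<sigma> d) (S i j)"
    and C: "0 \<le> C" "\<And>x i. x \<in> hs \<sigma> d \<Longrightarrow> R0 \<le> rad p q x \<Longrightarrow> \<bar>v i x\<bar> \<le> C / rad p q x"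
      "\<And>x i j. x \<in> hs \<sigma> d \<Longrightarrow> R0 \<le> rad p q x \<Longrightarrow> \<bar>pd j (v i) x\<bar> \<le> C / (rad p q x)\<^sup>2"
      "\<And>x i j. x \<in> hs \<sigma> d \<Longrightarrow> R0 \<le> rad p q x \<Longrightarrow> \<bar>S i j x\<bar> \<le> C / (rad p q x)\<^sup>2"
    and R: "0 < R" "R0 \<le> R"
    and m: "0 \<le> m" "\<And>i x. R \<le> rad p q x \<Longrightarrow> \<bar>u i x\<bar> \<le> m"
    and M: "0 \<le> M" "\<And>x i. \<bar>pd i (cutoff p q R) x\<bar> \<le> M / R" "\<And>x i j. \<bar>pd j (pd i (cutoff p q R)) x\<bar> \<le> M / R\<^sup>2"
    and M1: "\<And>t. \<bar>deriv sstep t\<bar> \<le> M1"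
  shows "\<bar>HI \<sigma> (G i j) (\<lambda>x. hooke mu lam (\<lambda>i j. v i x * pd j (cutoff p q R) x) i j)\<bar>
      \<le> m * ((2 * \<bar>mu\<bar> + 3 * \<bar>lam\<bar>) * C * M * (128 + 16 * M1))"
    and "\<bar>HI \<sigma> (u i) (\<lambda>x. pd j (cutoff p q R) x * S i j x)\<bar> \<le> m * (64 * C * M)"
proof -
  let ?K = "shell p q R" and ?x = "cutoff p q R"
  have M10: "0 \<le> M1" using M1[of 0] by simp
  have box: "\<bar>x $ 1 - p\<bar> \<le> 2 * R \<and> \<bar>x $ 2 - q\<bar> \<le> 2 * R \<and> \<bar>x $ 3\<bar> \<le> 2 * R" if "x \<in> ?K" for x
    using coord_le_rad[of x] shell_rad[OF R(1) that] by (meson order_trans)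
  have mK: "\<bar>u i x\<bar> \<le> m" if "x \<in> ?K" for x i using m(2) shell_rad[OF R(1) that] by blast
  have le1: "C / rad p q x \<le> C / R" "C / (rad p q x)\<^sup>2 \<le> C / R\<^sup>2" if "x \<in> ?K" for x
  proof -
    have r: "R \<le> rad p q x" using shell_rad[OF R(1) that] by blast
    show "C / rad p q x \<le> C / R" using r R C(1) by (intro divide_left_mono mult_pos_pos) auto
    show "C / (rad p q x)\<^sup>2 \<le> C / R\<^sup>2" using r R C(1) by (intro divide_left_mono power_mono mult_pos_pos zero_less_power) auto
  qed
  have R0: "R0 \<le> rad p q x" if "x \<in> ?K" for x using shell_rad[OF R(1) that] R(2) by linarith
  have vb: "\<bar>v i x\<bar> \<le> C / R" "\<bar>pd j (v i) x\<bar> \<le> C / R\<^sup>2" "\<bar>S i j x\<bar> \<le> C / R\<^sup>2" if "x \<in> ?K" "x \<in> hs \<sigma> d" for x i j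
    using C(2-4)[OF that(2) R0[OF that(1)]] le1[OF that(1)] by (meson order_trans)+
  have sx: "smooth_on (hs \<sigma> d) (pd j ?x)" for j by (rule smooth_on_subset[OF smooth_on_pd[OF smooth_on_cutoff]]) simp
  let ?h = "\<lambda>x. hooke mu lam (\<lambda>i j. v i x * pd j ?x x) i j"
  let ?L = "2 * \<bar>mu\<bar> + 3 * \<bar>lam\<bar>"
  have sv: "smooth_on (hs \<sigma> d) (\<lambda>x. v i x * pd j ?x x)" for i j by (intro smooth_on_mult open_hs v sx)
  have "\<bar>HI \<sigma> (G i j) ?h\<bar> \<le> m * (64 * R ^ 3 * (?L * (2 * C * M / R ^ 3)) + 16 * R\<^sup>2 * M1 * (?L * (C * M / R\<^sup>2)))"
  proof (rule HI_bound[OF s _ compact_shell _ d box mK m(1) R(1) _ _ _ _ M1])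
    show "smooth_on (hs \<sigma> d) ?h" by (rule smooth_on_hooke[OF open_hs sv])
    show "?h x = 0" if "x \<notin> ?K" for x by (simp add: hooke_def pd_cutoff_outside[OF R(1) that])
    show "0 \<le> ?L * (C * M / R\<^sup>2)" "0 \<le> ?L * (2 * C * M / R ^ 3)" using C(1) M(1) R(1) by simp_all
    show "\<bar>?h x\<bar> \<le> ?L * (C * M / R\<^sup>2)" if x: "x \<in> ?K" "x \<in> hs \<sigma> d" for x
    proof (rule hooke_abs_le)
      fix i j
      have "\<bar>v i x\<bar> * \<bar>pd j ?x x\<bar> \<le> (C / R) * (M / R)"
        using C(1) R(1) by (intro mult_mono vb(1)[OF x] M(2)) auto
      then show "\<bar>v i x * pd j ?x x\<bar> \<le> C * M / R\<^sup>2" by (simp add: abs_mult power2_eq_square)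
    qed
    show "\<bar>pd j ?h x\<bar> \<le> ?L * (2 * C * M / R ^ 3)" if x: "x \<in> ?K" "x \<in> hs \<sigma> d" for x
    proof -
      have df: "(\<lambda>x. v i x * pd j ?x x) differentiable (at x)" for i j by (rule smooth_on_differentiable[OF sv x(2)])
      have b: "\<bar>pd n (\<lambda>x. v i x * pd j ?x x) x\<bar> \<le> 2 * C * M / R ^ 3" for n i j
      proof -
        have e: "pd n (\<lambda>x. v i x * pd j ?x x) x = v i x * pd n (pd j ?x) x + pd n (v i) x * pd j ?x x"
          by (rule pd_mult[OF smooth_on_differentiable[OF v x(2)] smooth_on_differentiable[OF sx x(2)]])
        have "\<bar>v i x\<bar> * \<bar>pd n (pd j ?x) x\<bar> \<le> (C / R) * (M / R\<^sup>2)"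
          using C(1) R(1) by (intro mult_mono vb(1)[OF x] M(3)) auto
        moreover have "\<bar>pd n (v i) x\<bar> * \<bar>pd j ?x x\<bar> \<le> (C / R\<^sup>2) * (M / R)"
          using C(1) R(1) by (intro mult_mono vb(2)[OF x] M(2)) auto
        moreover have "(C / R) * (M / R\<^sup>2) + (C / R\<^sup>2) * (M / R) = 2 * C * M / R ^ 3"
          by (simp add: power2_eq_square power3_eq_cube)
        ultimately have "\<bar>v i x * pd n (pd j ?x) x\<bar> + \<bar>pd n (v i) x * pd j ?x x\<bar> \<le> 2 * C * M / R ^ 3"
          unfolding abs_mult by linarith
        then show ?thesis unfolding e using abs_triangle_ineq by (rule order_trans[rotated])
      qed
      show ?thesis unfolding pd_hooke[where h = "\<lambda>i j x. v i x * pd j ?x x", OF df] by (rule hooke_abs_le[OF b])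
    qed
  qed
  also have "\<dots> = m * (?L * C * M * (128 + 16 * M1))"
    using R(1) by (simp add: field_simps)
  finally show "\<bar>HI \<sigma> (G i j) ?h\<bar> \<le> m * (?L * C * M * (128 + 16 * M1))" .
  have "\<bar>HI \<sigma> (u i) (\<lambda>x. pd j ?x x * S i j x)\<bar> \<le> m * (64 * R ^ 3 * ((M / R) * (C / R\<^sup>2)))"
  proof (rule HI_bound0[OF s _ compact_shell _ d box mK m(1) R(1)])
    show "continuous_on (hs \<sigma> d) (\<lambda>x. pd j ?x x * S i j x)"
      by (intro smooth_on_continuous smooth_on_mult open_hs sx S)
    show "pd j ?x x * S i j x = 0" if "x \<notin> ?K" for x by (simp add: pd_cutoff_outside[OF R(1) that])
    show "0 \<le> (M / R) * (C / R\<^sup>2)" using C(1) M(1) R(1) by simp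
    show "\<bar>pd j ?x x * S i j x\<bar> \<le> (M / R) * (C / R\<^sup>2)" if x: "x \<in> ?K" "x \<in> hs \<sigma> d" for x
      unfolding abs_mult using C(1) R(1) M(1) by (intro mult_mono vb(3)[OF x] M(2)) auto
  qed
  also have "\<dots> = m * (64 * C * M)" using R(1) by (simp add: power2_eq_square power3_eq_cube)
  finally show "\<bar>HI \<sigma> (u i) (\<lambda>x. pd j ?x x * S i j x)\<bar> \<le> m * (64 * C * M)" .
qed

end

lemma uniform_constant:
  fixes f :: "'i::finite \<Rightarrow> 'x \<Rightarrow> real"
  assumes "\<And>i. \<exists>C. \<forall>x\<in>A. \<bar>f i x\<bar> \<le> C * g x" "\<And>x. x \<in> A \<Longrightarrow> 0 \<le> g x"
  shows "\<exists>C\<ge>0. \<forall>i. \<forall>x\<in>A. \<bar>f i x\<bar> \<le> C * g x"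
proof -
  obtain C where C: "\<And>i. \<forall>x\<in>A. \<bar>f i x\<bar> \<le> C i * g x" using assms(1) by metis
  show ?thesis
  proof (intro exI conjI allI ballI)
    show "0 \<le> (\<Sum>i\<in>UNIV. \<bar>C i\<bar>)" by (intro sum_nonneg) auto
    fix i x assume x: "x \<in> A"
    have "C i \<le> \<bar>C i\<bar>" by simp
    also have "\<dots> \<le> (\<Sum>i\<in>UNIV. \<bar>C i\<bar>)" by (intro member_le_sum) auto
    finally show "\<bar>f i x\<bar> \<le> (\<Sum>i\<in>UNIV. \<bar>C i\<bar>) * g x"
      using C[of i] x assms(2)[OF x] by (meson mult_right_mono order_trans)
  qed
qed

context decay
begin

lemma decays_uniform:
  fixes v :: "3 \<Rightarrow> real^3 \<Rightarrow> real" and T :: "3 \<Rightarrow> 3 \<Rightarrow> real^3 \<Rightarrow> real"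
  assumes "\<And>i. decays A N 1 (-1) (v i)" "\<And>i j. decays A N 0 (-2) (T i j)"
  shows "\<exists>C\<ge>0. \<forall>x\<in>A. \<forall>i j. \<bar>v i x\<bar> \<le> C / N x \<and> \<bar>pd j (v i) x\<bar> \<le> C / (N x)\<^sup>2 \<and> \<bar>T i j x\<bar> \<le> C / (N x)\<^sup>2"
proof -
  have n: "0 < N x" if "x \<in> A" for x using N1[OF that] by linarith
  have 1: "\<exists>C. \<forall>x\<in>A. \<bar>v i x\<bar> \<le> C * N x powi (- 1)" for i by (rule decays_0D[OF assms(1)])
  have 2: "\<exists>C. \<forall>x\<in>A. \<bar>pd (snd ij) (v (fst ij)) x\<bar> \<le> C * N x powi (- 2)" for ij
    using assms(1)[of "fst ij"] by (simp only: One_nat_def decays.simps) auto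
  have 3: "\<exists>C. \<forall>x\<in>A. \<bar>T (fst ij) (snd ij) x\<bar> \<le> C * N x powi (- 2)" for ij by (rule decays_0D[OF assms(2)])
  have nn: "0 \<le> N x powi k" if "x \<in> A" for x k using n[OF that] by (simp add: less_imp_le zero_less_power_int)
  obtain C1 where C1: "C1 \<ge> 0" "\<And>i x. x \<in> A \<Longrightarrow> \<bar>v i x\<bar> \<le> C1 * N x powi (- 1)"
    using uniform_constant[of A v "\<lambda>x. N x powi (- 1)", OF 1 nn] by blast
  obtain C2 where C2: "C2 \<ge> 0" "\<And>ij x. x \<in> A \<Longrightarrow> \<bar>pd (snd ij) (v (fst ij)) x\<bar> \<le> C2 * N x powi (- 2)"
    using uniform_constant[of A "\<lambda>ij. pd (snd ij) (v (fst ij))" "\<lambda>x. N x powi (- 2)", OF 2 nn] by blast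
  obtain C3 where C3: "C3 \<ge> 0" "\<And>ij x. x \<in> A \<Longrightarrow> \<bar>T (fst ij) (snd ij) x\<bar> \<le> C3 * N x powi (- 2)"
    using uniform_constant[of A "\<lambda>ij. T (fst ij) (snd ij)" "\<lambda>x. N x powi (- 2)", OF 3 nn] by blast
  define C where "C = C1 + C2 + C3"
  have p: "t * N x powi (- 1) \<le> C / N x" "t * N x powi (- 2) \<le> C / (N x)\<^sup>2" if "x \<in> A" "t \<le> C" for x t
    using n[OF that(1)] that(2) by (simp_all add: power_int_minus divide_inverse mult_right_mono)
  have le: "C1 \<le> C" "C2 \<le> C" "C3 \<le> C" using C1 C2 C3 by (simp_all add: C_def)
  show ?thesis
  proof (intro exI[of _ C] conjI ballI allI)
    show "0 \<le> C" using C1 C2 C3 by (simp add: C_def)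
    fix x i j assume x: "x \<in> A"
    show "\<bar>v i x\<bar> \<le> C / N x" using C1(2)[OF x, of i] p(1)[OF x le(1)] by linarith
    show "\<bar>pd j (v i) x\<bar> \<le> C / (N x)\<^sup>2" using C2(2)[OF x, of "(i, j)"] p(2)[OF x le(2)] by simp
    show "\<bar>T i j x\<bar> \<le> C / (N x)\<^sup>2" using C3(2)[OF x, of "(i, j)"] p(2)[OF x le(3)] by simp
  qed
qed

end

lemma decays_eq: "decays A N n m f \<Longrightarrow> m = k \<Longrightarrow> decays A N n k f" by simp

section \<open>The transmission field far from its poles\<close>

context transmission
begin

definition "v1 f i x = pn_disp nu1 (Bup f) (Pup f) i x / mu1"
definition "v2 i x = pn_disp nu2 Bdn Pdn i x / mu2"
definition "S1 f = pn_stress nu1 (Bup f) (Pup f)"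
definition "S2 = pn_stress nu2 Bdn Pdn"

lemma far_sqd:
  assumes "2 * a + 1 \<le> rad p q x" "\<sigma>\<^sup>2 = 1" shows "a + 1 / 2 \<le> sqrt (sqd p q \<sigma> a x)"
  using sqd_ge_rad[OF assms(2), of a p q x] assms(1) a_pos by linarith

text \<open>Stated for the exact pole, with which the regularised fields coincide outside a small
  ball. Enlarging the half-space by a / 2 keeps it at distance a / 2 from the mirror pole at height
  -a, so the bounds also hold slightly below the interface.\<close>

lemma far_upper:
  "\<exists>C\<ge>0. \<forall>x\<in>{x \<in> hs 1 (a / 2). 2 * a + 1 \<le> rad p q x}. \<forall>i j. \<bar>v1 (invr p q (-1) a) i x\<bar> \<le> C / rad p q x
     \<and> \<bar>pd j (v1 (invr p q (-1) a) i) x\<bar> \<le> C / (rad p q x)\<^sup>2 \<and> \<bar>S1 (invr p q (-1) a) i j x\<bar> \<le> C / (rad p q x)\<^sup>2"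
proof -
  let ?A = "{x \<in> hs 1 (a / 2). 2 * a + 1 \<le> rad p q x}"
  let ?S = "{x. 0 < ht 1 a x} \<inter> {x. 0 < sqd p q (-1) a x}"
  let ?f = "invr p q (-1) a" and ?b = "invr p q 1 a" and ?L = "logr p q 1 a"
  interpret far_region p q a 1 ?S ?A
  proof
    show "?A \<subseteq> ?S"
    proof
      fix x assume x: "x \<in> ?A"
      then have "0 < ht 1 a x" using a_pos by (simp add: hs_def ht_def)
      moreover have "0 < sqrt (sqd p q (-1) a x)"
        by (rule less_le_trans[OF _ far_sqd[of x "-1"]]) (use x a_pos in auto)
      ultimately show "x \<in> ?S" by simp
    qed
  qed (auto intro: open_Int open_ht_pos open_sqd_pos simp: a_pos)
  note Sh = open_far S_ht
  have sf: "smooth_on ?S ?f" by (rule smooth_on_invr[OF open_far S_sqd])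
  note sb = up_smooth[OF Sh]
  have df: "decays ?A (rad p q) n (-1) ?f" for n by (rule decays_invr) (auto simp: S_sqd)
  have db: "decays ?A (rad p q) n (-1) ?b" for n by (rule decays_invr) (auto simp: S_sqd')
  have dpf: "decays ?A (rad p q) n (-2) (pd i ?f)" for n i using decays_pd[OF df[of "Suc n"]] by simp
  have dpb: "decays ?A (rad p q) n (-2) (pd i ?b)" for n i using decays_pd[OF db[of "Suc n"]] by simp
  have dppb: "decays ?A (rad p q) n (-3) (pd j (pd i ?b))" for n i j using decays_pd[OF dpb[of "Suc n"]] by simp
  have dpb1: "decays ?A (rad p q) n (-1) (pd i ?b)" for n i using decays_weaken[OF dpb[of n i]] by simp
  have dBup: "decays ?A (rad p q) n (-1) (Bup ?f)" for n
    unfolding Bup_def[abs_def]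
    by (intro decays_diff decays_add decays_cmult df db dpb1 smooth_on_intros smooth_on_const open_far sf sb smooth_on_pd)
  have sx3: "smooth_on ?S (\<lambda>x. x $ 3 - c)" for c by (intro smooth_on_intros smooth_on_const open_far)
  have sBup: "smooth_on ?S (Bup ?f)" by (rule smooth_up(1)[OF Sh sf])
  have dP: "decays ?A (rad p q) n (-1) (pd i (Pup ?f))" for n i
  proof -
    have s1: "smooth_on ?S (\<lambda>x. pd i ?f x + gam * kap1 * pd i ?b x)"
      by (intro smooth_on_intros smooth_on_const open_far smooth_on_pd sf sb)
    have s2: "smooth_on ?S (pd i (pd 3 ?b))" by (intro smooth_on_pd sb)
    have t1: "decays ?A (rad p q) n (-1) (\<lambda>x. (x $ 3 - a) * (pd i ?f x + gam * kap1 * pd i ?b x))"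
    proof (rule decays_eq[OF decays_mult[OF sx3 s1 decays_x3]])
      show "decays ?A (rad p q) n (-2) (\<lambda>x. pd i ?f x + gam * kap1 * pd i ?b x)"
        by (intro decays_add decays_cmult dpf dpb smooth_on_intros smooth_on_const open_far smooth_on_pd sf sb)
    qed (use a_pos in auto)
    have "decays ?A (rad p q) n (-2) (\<lambda>x. (x $ 3 - 0) * pd i (pd 3 ?b) x)"
      by (rule decays_eq[OF decays_mult[OF sx3 s2 decays_x3 dppb]]) (use a_pos in auto)
    from decays_weaken[OF this] have t2: "decays ?A (rad p q) n (-1) (\<lambda>x. (x $ 3 - 0) * pd i (pd 3 ?b) x)" by simp
    have t3: "decays ?A (rad p q) n (-1) (pd i ?L)" by (rule decays_pd_logr_invs(2))
    have sm2: "smooth_on ?S (\<lambda>x. (x $ 3 - 0) * pd i (pd 3 ?b) x)" by (intro smooth_on_mult open_far sx3 s2)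
    have sm1: "smooth_on ?S (\<lambda>x. (x $ 3 - a) * (pd i ?f x + gam * kap1 * pd i ?b x))" by (intro smooth_on_mult open_far sx3 s1)
    \<comment> \<open>Every summand of the derivative of \<open>Pup\<close> has order at most -1: a
      factor of order 1 meets derivatives of order -2 or -3, and the logarithm appears only
      differentiated.\<close>
    have "decays ?A (rad p q) n (-1) (\<lambda>x. (if i = 3 then 1 else 0) * Bup ?f x + (x $ 3 - a) * (pd i ?f x + gam * kap1 * pd i ?b x)
        - 2 * a * gam * ((x $ 3 - 0) * pd i (pd 3 ?b) x) - cl * pd i ?L x)"
      by (intro decays_diff decays_add decays_cmult dBup t1 t2 t3 smooth_on_diff smooth_on_add
          smooth_on_mult[OF open_far smooth_on_const] smooth_on_const open_far smooth_on_pd sBup sb sm1 sm2)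
    then show ?thesis
      by (rule decays_cong[rotated]) (simp add: pd_Pup[OF Sh sf])
  qed
  note PN = decays_pn[OF sBup smooth_up(2)[OF Sh sf] dBup dP]
  have "decays ?A (rad p q) 1 (-1) (\<lambda>x. (1 / mu1) * pn_disp nu1 (Bup ?f) (Pup ?f) i x)" for i
    by (rule decays_cmult[OF smooth_on_pn_disp[OF open_far sBup smooth_up(2)[OF Sh sf]]]) (simp only: One_nat_def PN(1))
  then have "decays ?A (rad p q) 1 (-1) (v1 ?f i)" for i by (simp add: v1_def[abs_def])
  then show ?thesis by (rule decays_uniform) (simp only: S1_def PN(2))
qed

lemma far_lower:
  "\<exists>C\<ge>0. \<forall>x\<in>{x \<in> hs (-1) (a / 2). 2 * a + 1 \<le> rad p q x}. \<forall>i j. \<bar>v2 i x\<bar> \<le> C / rad p q x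
     \<and> \<bar>pd j (v2 i) x\<bar> \<le> C / (rad p q x)\<^sup>2 \<and> \<bar>S2 i j x\<bar> \<le> C / (rad p q x)\<^sup>2"
proof -
  let ?A = "{x \<in> hs (-1) (a / 2). 2 * a + 1 \<le> rad p q x}"
  let ?S = "{x. 0 < ht (-1) a x}"
  let ?b = "invr p q (-1) a" and ?L = "logr p q (-1) a"
  interpret far_region p q a "-1" ?S ?A
  proof
    show "?A \<subseteq> ?S" using a_pos by (auto simp: hs_def ht_def)
    show "?S \<subseteq> {x. 0 < sqd p q (-1) a x}" by (rule ht_sub)
  qed (auto intro: open_ht_pos simp: a_pos)
  note Sh = open_far S_ht
  note sb = dn_smooth[OF Sh]
  note sm = smooth_dn[OF Sh]
  have db: "decays ?A (rad p q) n (-1) ?b" for n by (rule decays_invr[OF _ S_sqd]) simp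
  have dpb: "decays ?A (rad p q) n (-2) (pd i ?b)" for n i using decays_pd[OF db[of "Suc n"]] by simp
  have dpb1: "decays ?A (rad p q) n (-1) (pd i ?b)" for n i using decays_weaken[OF dpb[of n i]] by simp
  have dB: "decays ?A (rad p q) n (-1) Bdn" for n
    unfolding Bdn_def[abs_def] by (intro decays_cmult db sb)
  have sx3: "smooth_on ?S (\<lambda>x. x $ 3 - 0)" by (intro smooth_on_intros smooth_on_const open_far)
  have dP: "decays ?A (rad p q) n (-1) (pd i Pdn)" for n i
  proof -
    have t1: "decays ?A (rad p q) n (-1) (\<lambda>x. (x $ 3 - 0) * pd i ?b x)"
      by (rule decays_eq[OF decays_mult[OF sx3 smooth_on_pd[OF sb(1)] decays_x3 dpb]]) (use a_pos in auto)
    have t3: "decays ?A (rad p q) n (-1) (pd i ?L)" by (rule decays_pd_logr_invs(2))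
    have sm1: "smooth_on ?S (\<lambda>x. (x $ 3 - 0) * pd i ?b x)" by (intro smooth_on_mult open_far sx3 smooth_on_pd sb)
    have "decays ?A (rad p q) n (-1) (\<lambda>x. (if i = 3 then 1 else 0) * Bdn x + (pic * ((x $ 3 - 0) * pd i ?b x)
        - (k * a * (1 + gam * kap1)) * pd i ?b x) - (k * cl) * pd i ?L x)"
      by (intro decays_diff decays_add decays_cmult dB t1 t3 dpb1 smooth_on_diff smooth_on_add
          smooth_on_mult[OF open_far smooth_on_const] smooth_on_const open_far smooth_on_pd sm sb sm1)
    then show ?thesis
      by (rule decays_cong[rotated]) (simp add: pd_Pdn[OF Sh] algebra_simps)
  qed
  note PN = decays_pn[OF sm dB dP]
  have "decays ?A (rad p q) 1 (-1) (\<lambda>x. (1 / mu2) * pn_disp nu2 Bdn Pdn i x)" for i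
    by (rule decays_cmult[OF smooth_on_pn_disp[OF open_far sm]]) (simp only: One_nat_def PN(1))
  then have "decays ?A (rad p q) 1 (-1) (v2 i)" for i by (simp add: v2_def[abs_def])
  then show ?thesis by (rule decays_uniform) (simp only: S2_def PN(2))
qed

text \<open>The construction is local in \<open>f\<close>: outside the regularisation ball the
  fields may be computed with the exact pole.\<close>

lemma fields_cong:
  assumes "open T" "x \<in> T" "\<And>z. z \<in> T \<Longrightarrow> f z = g z"
  shows "v1 f i x = v1 g i x" "pd j (v1 f i) x = pd j (v1 g i) x" "S1 f i j x = S1 g i j x"
proof -
  have B: "Bup f z = Bup g z" and P: "Pup f z = Pup g z" if "z \<in> T" for z
    using assms(3)[OF that] by (simp_all add: Bup_def Pup_def)
  have pB: "pd i (Bup f) z = pd i (Bup g) z" and pP: "pd i (Pup f) z = pd i (Pup g) z" if "z \<in> T" for z i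
    using pd_cong[OF assms(1) that, of "Bup f" "Bup g"] pd_cong[OF assms(1) that, of "Pup f" "Pup g"] B P by auto
  have ppP: "pd j (pd i (Pup f)) z = pd j (pd i (Pup g)) z" if "z \<in> T" for z i j
    by (rule pd_cong[OF assms(1) that]) (rule pP)
  have v: "v1 f i z = v1 g i z" if "z \<in> T" for z i
    using that by (simp add: v1_def pn_disp_def B pP)
  show "v1 f i x = v1 g i x" by (rule v[OF assms(2)])
  show "pd j (v1 f i) x = pd j (v1 g i) x" by (rule pd_cong[OF assms(1,2) v])
  show "S1 f i j x = S1 g i j x"
    using assms(2) by (simp add: S1_def pn_stress_def pn_res_def lap_def pB ppP)
qed

end

section \<open>The representation formula\<close>

lemma norm_vec3: "(norm (x - vector [p, q, r] :: real^3))\<^sup>2 = (x $ 1 - p)\<^sup>2 + (x $ 2 - q)\<^sup>2 + (x $ 3 - r)\<^sup>2"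
  unfolding power2_norm_eq_inner inner_vec_def sum_3 by (simp add: power2_eq_square)

lemma sqd_dist: "sqd p q (-1) a x = (dist x (vector [p, q, a]))\<^sup>2"
  unfolding dist_norm norm_vec3 by (simp add: sqd_def ht_def power2_eq_square algebra_simps)

lemma rad_dist: "rad p q x = norm (x - vector [p, q, 0])"
proof -
  have "(rad p q x)\<^sup>2 = (norm (x - vector [p, q, 0]))\<^sup>2" unfolding norm_vec3 rad_sq by simp
  then show ?thesis using rad_nonneg by (simp add: power2_eq_iff_nonneg)
qed

context weak_solution
begin

lemma HI_sum:
  fixes T :: "3 \<Rightarrow> real^3 \<Rightarrow> real"
  assumes s: "\<sigma> = 1 \<or> \<sigma> = -1" and d: "d > 0" and T: "\<And>j. smooth_on (hs \<sigma> d) (T j)"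
    and eta: "smooth_on UNIV \<eta>" and K: "compact K" "\<And>x. x \<notin> K \<Longrightarrow> \<eta> x = 0"
  shows "(\<Sum>j\<in>UNIV. HI \<sigma> (u i) (\<lambda>x. \<eta> x * T j x)) = integral\<^sup>L lebesgue (\<lambda>x. u i x * (indicator (hs \<sigma> 0) x * (\<eta> x * (\<Sum>j\<in>UNIV. T j x))))"
proof -
  have i: "integrable lebesgue (\<lambda>x. u i x * (indicator (hs \<sigma> 0) x * (\<eta> x * T j x)))" for j
  proof (rule cut_limit(2)[OF s Lu _ K(1) _ d])
    show "continuous_on (hs \<sigma> d) (\<lambda>x. \<eta> x * T j x)"
      by (intro smooth_on_continuous smooth_on_mult open_hs T smooth_on_subset[OF eta]) simp
  qed (simp add: K(2))
  have "(\<Sum>j\<in>UNIV. HI \<sigma> (u i) (\<lambda>x. \<eta> x * T j x)) = integral\<^sup>L lebesgue (\<lambda>x. \<Sum>j\<in>UNIV. u i x * (indicator (hs \<sigma> 0) x * (\<eta> x * T j x)))"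
    unfolding HI_def by (rule Bochner_Integration.integral_sum[symmetric]) (rule i)
  then show ?thesis by (simp only: sum_distrib_left)
qed

end

lemma abs_double_sum_le:
  fixes f :: "3 \<Rightarrow> 3 \<Rightarrow> real"
  assumes "\<And>i j. \<bar>f i j\<bar> \<le> B" shows "\<bar>\<Sum>i\<in>UNIV. \<Sum>j\<in>UNIV. f i j\<bar> \<le> 9 * B"
proof -
  have "\<bar>\<Sum>i\<in>UNIV. \<Sum>j\<in>UNIV. f i j\<bar> \<le> (\<Sum>i\<in>(UNIV::3 set). \<bar>\<Sum>j\<in>UNIV. f i j\<bar>)" by (rule sum_abs)
  also have "\<dots> \<le> (\<Sum>i\<in>(UNIV::3 set). \<Sum>j\<in>(UNIV::3 set). \<bar>f i j\<bar>)" by (intro sum_mono sum_abs)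
  also have "\<dots> \<le> (\<Sum>i\<in>(UNIV::3 set). \<Sum>j\<in>(UNIV::3 set). B)" by (intro sum_mono assms)
  also have "\<dots> = 9 * B" by (simp add: sum_3)
  finally show ?thesis .
qed

text \<open>Couples the explicit field with source (p, q, a) to the weak solution with pole
  \<open>y\<close> and force \<open>l\<close>; index 1 is the material above the plane. Point values
  of \<open>u\<close> enter through continuity at the source and decay at infinity.\<close>

locale transmission_weak = transmission p q a mu1 mu2 nu1 nu2 + weak_solution u G W l y
  for p q a mu1 mu2 nu1 nu2 u G W l y +
  fixes lam1 lam2 :: real
  assumes lam1: "lam1 = mu1 * (2 * nu1 / (1 - 2 * nu1))" and lam2: "lam2 = mu2 * (2 * nu2 / (1 - 2 * nu2))"
    and W1: "\<And>x i j. x $ 3 > 0 \<Longrightarrow> W i j x = hooke mu1 lam1 (\<lambda>i j. G i j x) i j"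
    and W2: "\<And>x i j. x $ 3 < 0 \<Longrightarrow> W i j x = hooke mu2 lam2 (\<lambda>i j. G i j x) i j"
    and y_pos: "y $ 3 > 0" and y_ne: "y \<noteq> vector [p, q, a]"
    and u_cont: "\<And>i. isCont (u i) (vector [p, q, a])"
    and u_decay: "\<And>e. 0 < e \<Longrightarrow> \<exists>R. \<forall>x i. R \<le> norm x \<longrightarrow> \<bar>u i x\<bar> \<le> e"
begin

lemma hs_sub: "hs 1 (a / 2) \<subseteq> {x. 0 < ht 1 a x}" "hs (-1) (a / 2) \<subseteq> {x. 0 < ht (-1) a x}"
  using a_pos by (auto simp: hs_def ht_def)

lemma smooth_up_hs:
  assumes "smooth_on UNIV f" shows "smooth_on (hs 1 (a / 2)) (Bup f)" "smooth_on (hs 1 (a / 2)) (Pup f)"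
  by (rule smooth_up[OF open_hs hs_sub(1) smooth_on_subset[OF assms subset_UNIV]])+

lemma smooth_v1: "smooth_on UNIV f \<Longrightarrow> smooth_on (hs 1 (a / 2)) (v1 f i)"
  unfolding v1_def[abs_def]
  by (intro smooth_on_divide_const smooth_on_pn_disp smooth_up_hs open_hs)

lemma smooth_v2: "smooth_on (hs (-1) (a / 2)) (v2 i)"
  unfolding v2_def[abs_def] by (intro smooth_on_divide_const smooth_on_pn_disp smooth_dn open_hs hs_sub)

lemma smooth_S1: "smooth_on UNIV f \<Longrightarrow> smooth_on (hs 1 (a / 2)) (S1 f i j)"
  unfolding S1_def by (intro smooth_on_pn_stress smooth_up_hs open_hs)

lemma smooth_S2: "smooth_on (hs (-1) (a / 2)) (S2 i j)"
  unfolding S2_def by (intro smooth_on_pn_stress smooth_dn open_hs hs_sub)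

text \<open>The body force of the regularised field is 4 (1 - nu1) e_3 times the Laplacian of
  \<open>f\<close>, minus a multiple of the gradient of (x3 - a) times that Laplacian. The first
  part concentrates at the source with mass -4 (1 - nu1) kappa0; the second has integral 0, and its
  limit vanishes because \<open>u\<close> is continuous there.\<close>

lemma interior_term:
  assumes e: "\<And>n. 0 < e n" "\<And>n. e n < 1" "\<And>n. e n \<le> a / 2" "e \<longlonglongrightarrow> 0" and R: "2 * a \<le> R" "rad p q (vector [p, q, a]) + 1 \<le> R"
  shows "(\<lambda>n. \<Sum>i\<in>UNIV. \<Sum>j\<in>UNIV. HI 1 (u i) (\<lambda>x. cutoff p q R x * pd j (S1 (poleq p q a (e n)) i j) x)
        + HI (-1) (u i) (\<lambda>x. cutoff p q R x * pd j (S2 i j) x)) \<longlonglongrightarrow> - (4 * (1 - nu1) * kappa0 * u 3 (vector [p, q, a]))"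
proof -
  let ?x0 = "vector [p, q, a] :: real^3"
  let ?eta = "cutoff p q R" and ?f = "\<lambda>n. poleq p q a (e n)"
  define K where "K = {x. sqd p q (-1) 0 x \<le> 2 * R\<^sup>2}"
  have R0: "0 < R" using R(1) a_pos by linarith
  have K: "compact K" "\<And>x. x \<notin> K \<Longrightarrow> ?eta x = 0"
    unfolding K_def by (rule compact_sqd_le, rule cutoff_eq_0[OF R0])
  have d: "0 < a / 2" using a_pos by simp
  define c where "c = 2 * (1 - nu1) / (1 - 2 * nu1)"
  define h where "h i n x = (if i = 3 then 4 * (1 - nu1) else 0) * lap (?f n) x - c * pd i (\<lambda>x. (x $ 3 - a) * lap (?f n) x) x" for i n x
  have sD: "smooth_on UNIV (\<lambda>x. (x $ 3 - a) * lap (?f n) x)" for n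
    by (intro smooth_on_intros smooth_on_const smooth_on_lap_poleq open_UNIV)
  have dD: "lap (?f n) differentiable (at x)" for n x by (rule smooth_on_differentiable[OF smooth_on_lap_poleq UNIV_I])
  have far0: "lap (?f n) x = 0" "pd i (\<lambda>x. (x $ 3 - a) * lap (?f n) x) x = 0" if "e n < dist x ?x0" for n x i
  proof -
    have "(e n)\<^sup>2 < sqd p q (-1) a x" unfolding sqd_dist using that e(1)[of n] by (intro power_strict_mono) auto
    note z = lap_poleq_eq_0[OF e(1) this]
    show "lap (?f n) x = 0" by (rule z)
    show "pd i (\<lambda>x. (x $ 3 - a) * lap (?f n) x) x = 0" unfolding pd_x3_mult[OF dD] z by simp
  qed
  have div_up: "(\<Sum>j\<in>UNIV. pd j (S1 (?f n) i j) x) = h i n x" if x: "x \<in> hs 1 (a / 2)" for i n x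
  proof -
    have fs: "smooth_on (hs 1 (a / 2)) (?f n)" by (rule smooth_on_subset[OF smooth_on_poleq]) simp
    have nu: "nu1 \<noteq> 1 / 2" using nu1 by simp
    have "pd i (pn_res (Bup (?f n)) (Pup (?f n))) x = pd i (\<lambda>x. (x $ 3 - a) * lap (?f n) x) x"
      by (rule pd_cong[OF open_hs x]) (rule lap_up(2)[OF open_hs hs_sub(1) fs])
    then show ?thesis
      unfolding S1_def pn_div[OF open_hs x smooth_up[OF open_hs hs_sub(1) fs] nu] lap_up(1)[OF open_hs hs_sub(1) fs x] h_def c_def
      by simp
  qed
  have div_dn: "(\<Sum>j\<in>UNIV. pd j (S2 i j) x) = 0" if x: "x \<in> hs (-1) (a / 2)" for i x
  proof -
    have nu: "nu2 \<noteq> 1 / 2" using nu2 by simp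
    have "pd i (pn_res Bdn Pdn) x = pd i (\<lambda>x. 0) x"
      by (rule pd_cong[OF open_hs x]) (rule lap_dn(2)[OF open_hs hs_sub(2)])
    then show ?thesis
      unfolding S2_def pn_div[OF open_hs x smooth_dn[OF open_hs hs_sub(2)] nu] lap_dn(1)[OF open_hs hs_sub(2) x]
      by simp
  qed
  \<comment> \<open>Below the plane the divergence is 0. Above it the force lives in a ball that
    avoids the plane and on which the cutoff is 1, so half-space and cutoff disappear from the
    integral.\<close>
  have collapse: "(\<Sum>j\<in>UNIV. HI 1 (u i) (\<lambda>x. ?eta x * pd j (S1 (?f n) i j) x) + HI (-1) (u i) (\<lambda>x. ?eta x * pd j (S2 i j) x))
     = integral\<^sup>L lebesgue (\<lambda>x. u i x * h i n x)" for i n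
  proof -
    have up: "u i x * (indicator (hs 1 0) x * (?eta x * (\<Sum>j\<in>UNIV. pd j (S1 (?f n) i j) x))) = u i x * h i n x" for x
    proof (cases "e n < dist x ?x0")
      case True
      have h0: "h i n x = 0" unfolding h_def by (simp add: far0[OF True])
      then show ?thesis using div_up[of x n i] a_pos by (cases "x \<in> hs 1 0") (auto simp: hs_def)
    next
      case False
      have "\<bar>x $ 3 - a\<bar> \<le> dist x ?x0" using component_le_norm_cart[of "x - ?x0" 3] by (simp add: dist_norm)
      then have "x $ 3 > 0" using False e(3)[of n] a_pos by linarith
      then have x: "x \<in> hs 1 0" "x \<in> hs 1 (a / 2)" using a_pos by (simp_all add: hs_def)
      have "rad p q x \<le> rad p q ?x0 + dist x ?x0"
        unfolding rad_dist dist_norm using norm_triangle_ineq[of "?x0 - vector [p, q, 0]" "x - ?x0"] by simp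
      then have "rad p q x \<le> R" using False e(2)[of n] R(2) by linarith
      then have "?eta x = 1" by (rule cutoff_eq_1[OF R0])
      then show ?thesis using x div_up[OF x(2)] by simp
    qed
    have dn: "u i x * (indicator (hs (-1) 0) x * (?eta x * (\<Sum>j\<in>UNIV. pd j (S2 i j) x))) = 0" for x
      using div_dn[of x i] a_pos by (cases "x \<in> hs (-1) 0") (auto simp: hs_def)
    have "(\<Sum>j\<in>UNIV. HI 1 (u i) (\<lambda>x. ?eta x * pd j (S1 (?f n) i j) x)) = integral\<^sup>L lebesgue (\<lambda>x. u i x * h i n x)"
      by (subst HI_sum[OF _ d _ smooth_on_cutoff K]) (auto intro!: smooth_on_pd smooth_S1 smooth_on_poleq simp: up)
    moreover have "(\<Sum>j\<in>UNIV. HI (-1) (u i) (\<lambda>x. ?eta x * pd j (S2 i j) x)) = 0"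
      by (subst HI_sum[OF _ d _ smooth_on_cutoff K]) (auto intro!: smooth_on_pd smooth_S2 simp: dn)
    ultimately show ?thesis by (simp add: sum.distrib)
  qed
  obtain B where B: "\<And>e x. 0 < e \<Longrightarrow> \<bar>lap (poleq p q a e) x\<bar> \<le> B / e ^ 3"
    "\<And>e x i. 0 < e \<Longrightarrow> \<bar>pd i (\<lambda>x. (x $ 3 - a) * lap (poleq p q a e) x) x\<bar> \<le> B / e ^ 3"
    using poleq_kernel_bounds[of p q a] by blast
  define k where "k i = (if i = 3 then 4 * (1 - nu1) else 0) * - kappa0" for i :: 3
  have lim: "(\<lambda>n. integral\<^sup>L lebesgue (\<lambda>x. u i x * h i n x)) \<longlonglongrightarrow> u i ?x0 * k i" for i
  proof (rule approximate_identity[OF Lu u_cont e(1,4)])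
    show "continuous_on UNIV (h i n)" for n
      unfolding h_def[abs_def]
      by (intro smooth_on_continuous smooth_on_diff smooth_on_mult smooth_on_const smooth_on_lap_poleq smooth_on_pd[OF sD] open_UNIV)
    show "h i n x = 0" if "e n < dist x ?x0" for n x unfolding h_def by (simp add: far0[OF that])
    let ?c = "\<bar>4 * (1 - nu1)\<bar> + \<bar>c\<bar>"
    show "\<bar>h i n x\<bar> \<le> (?c * B) / e n ^ 3" for n x
    proof -
      have b0: "0 \<le> B / e n ^ 3" using order_trans[OF abs_ge_zero B(1)[OF e(1)]] .
      have "\<bar>(if i = 3 then 4 * (1 - nu1) else 0) * lap (?f n) x\<bar> \<le> \<bar>4 * (1 - nu1)\<bar> * (B / e n ^ 3)"
        unfolding abs_mult[of "if i = 3 then _ else _"]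
      proof (rule mult_mono[OF _ B(1)[OF e(1)]])
        show "\<bar>if i = 3 then 4 * (1 - nu1) else 0\<bar> \<le> \<bar>4 * (1 - nu1)\<bar>"
          by (rule if_split[THEN iffD2]) simp
      qed simp_all
      moreover have "\<bar>c * pd i (\<lambda>x. (x $ 3 - a) * lap (?f n) x) x\<bar> \<le> \<bar>c\<bar> * (B / e n ^ 3)"
        unfolding abs_mult by (intro mult_left_mono B(2)[OF e(1)]) auto
      moreover have "?c * B / e n ^ 3 = \<bar>4 * (1 - nu1)\<bar> * (B / e n ^ 3) + \<bar>c\<bar> * (B / e n ^ 3)"
        by (simp add: add_divide_distrib distrib_right)
      ultimately show ?thesis unfolding h_def
        using abs_triangle_ineq4[of "(if i = 3 then 4 * (1 - nu1) else 0) * lap (?f n) x" "c * pd i (\<lambda>x. (x $ 3 - a) * lap (?f n) x) x"]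
        by linarith
    qed
    show "integral\<^sup>L lebesgue (h i n) = k i" for n
    proof -
      have zz: "lap (?f n) x = 0" "(x $ 3 - a) * lap (?f n) x = 0" "pd j (\<lambda>x. (x $ 3 - a) * lap (?f n) x) x = 0" if "x \<notin> cball ?x0 (e n)" for x j
        using that far0[of n x] by (simp_all add: dist_commute)
      have i1: "integrable lebesgue (lap (?f n))"
        by (rule integrable_continuous_compact[OF smooth_on_continuous[OF smooth_on_lap_poleq] compact_cball zz(1)])
      have i2: "integrable lebesgue (pd i (\<lambda>x. (x $ 3 - a) * lap (?f n) x))"
        by (rule integrable_continuous_compact[OF smooth_on_continuous[OF smooth_on_pd[OF sD]] compact_cball zz(3)])
      have "integral\<^sup>L lebesgue (pd i (\<lambda>x. (x $ 3 - a) * lap (?f n) x)) = 0"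
        by (rule integral_pd_eq_0[OF sD compact_cball zz(2)])
      moreover have "integral\<^sup>L lebesgue (lap (?f n)) = - kappa0" by (rule integral_lap_poleq[OF e(1,2)])
      ultimately show ?thesis
        unfolding h_def[abs_def] k_def
        by (subst Bochner_Integration.integral_diff[OF integrable_mult_right[OF i1] integrable_mult_right[OF i2]]) simp
    qed
  qed
  have "(\<lambda>n. \<Sum>i\<in>UNIV. integral\<^sup>L lebesgue (\<lambda>x. u i x * h i n x)) \<longlonglongrightarrow> (\<Sum>i\<in>UNIV. u i ?x0 * k i)"
    by (intro tendsto_sum lim)
  moreover have "(\<Sum>i\<in>UNIV. u i ?x0 * k i) = - (4 * (1 - nu1) * kappa0 * u 3 ?x0)"
    by (simp add: sum_3 k_def)
  ultimately show ?thesis by (simp add: collapse)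
qed

end

context transmission_weak
begin

text \<open>\<open>V\<close> is the defect of the formula. Green's identity bounds it by a constant
  times the supremum of |u| outside radius R, and the constant is fixed before R; letting R grow
  forces V = 0.\<close>

theorem representation:
  assumes l: "l = axis 3 1"
  shows "v1 (invr p q (-1) a) 3 y = 4 * (1 - nu1) * kappa0 * u 3 (vector [p, q, a])"
proof -
  let ?x0 = "vector [p, q, a] :: real^3" and ?b = "invr p q (-1) a"
  define V where "V = v1 ?b 3 y - 4 * (1 - nu1) * kappa0 * u 3 ?x0"
  have d: "0 < a / 2" using a_pos by simp
  \<comment> \<open>The regularisation ball must stay off the interface, miss \<open>y\<close> so
    that the field there is exact, and have radius below 1 for the mass computation.\<close>
  define e0 where "e0 = min 1 (min (a / 2) (dist y ?x0))"
  have e0: "0 < e0" "e0 \<le> 1" "e0 \<le> a / 2" "e0 \<le> dist y ?x0" using a_pos y_ne by (auto simp: e0_def)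
  define e where "e n = e0 / (real n + 2)" for n
  have e: "0 < e n" "e n < 1" "e n \<le> a / 2" "e n < dist y ?x0" for n
    using shrink_bounds[OF e0(1), of n] e0 unfolding e_def by linarith+
  have elim: "e \<longlonglongrightarrow> 0" unfolding e_def[abs_def] by (rule shrink_limit)
  let ?f = "\<lambda>n. poleq p q a (e n)"
  obtain C1 where C1: "0 \<le> C1" "\<And>x i j. x \<in> hs 1 (a / 2) \<Longrightarrow> 2 * a + 1 \<le> rad p q x \<Longrightarrow> \<bar>v1 ?b i x\<bar> \<le> C1 / rad p q x
     \<and> \<bar>pd j (v1 ?b i) x\<bar> \<le> C1 / (rad p q x)\<^sup>2 \<and> \<bar>S1 ?b i j x\<bar> \<le> C1 / (rad p q x)\<^sup>2"
    using far_upper by auto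
  obtain C2 where C2: "0 \<le> C2" "\<And>x i j. x \<in> hs (-1) (a / 2) \<Longrightarrow> 2 * a + 1 \<le> rad p q x \<Longrightarrow> \<bar>v2 i x\<bar> \<le> C2 / rad p q x
     \<and> \<bar>pd j (v2 i) x\<bar> \<le> C2 / (rad p q x)\<^sup>2 \<and> \<bar>S2 i j x\<bar> \<le> C2 / (rad p q x)\<^sup>2"
    using far_lower by auto
  obtain M where M: "0 \<le> M" "\<And>R x i. 0 < R \<Longrightarrow> \<bar>pd i (cutoff p q R) x\<bar> \<le> M / R"
    "\<And>R x i j. 0 < R \<Longrightarrow> \<bar>pd j (pd i (cutoff p q R)) x\<bar> \<le> M / R\<^sup>2"
    using cutoff_bounds[of p q] by blast
  obtain M1 where M1: "M1 > 0" "\<And>t. \<bar>deriv sstep t\<bar> \<le> M1" using deriv_sstep_bounded by blast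
  have agree: "\<exists>T. open T \<and> x \<in> T \<and> (\<forall>z\<in>T. ?f n z = ?b z)" if "(e n)\<^sup>2 < sqd p q (-1) a x" for x n
  proof (intro exI conjI)
    show "open {x. (e n)\<^sup>2 < sqd p q (-1) a x}" unfolding sqd_def ht_def by (intro open_Collect_less continuous_intros)
    show "x \<in> {x. (e n)\<^sup>2 < sqd p q (-1) a x}" using that by simp
    show "\<forall>z\<in>{x. (e n)\<^sup>2 < sqd p q (-1) a x}. ?f n z = ?b z"
      using poleq_eq[OF e(1)] by (simp add: less_imp_le)
  qed
  have near: "v1 (?f n) i x = v1 ?b i x" "pd j (v1 (?f n) i) x = pd j (v1 ?b i) x" "S1 (?f n) i j x = S1 ?b i j x"
    if "(e n)\<^sup>2 < sqd p q (-1) a x" for x n i j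
    using agree[OF that] fields_cong[of _ x "?f n" ?b] by metis+
  have C1': "\<bar>v1 (?f n) i x\<bar> \<le> C1 / rad p q x" "\<bar>pd j (v1 (?f n) i) x\<bar> \<le> C1 / (rad p q x)\<^sup>2" "\<bar>S1 (?f n) i j x\<bar> \<le> C1 / (rad p q x)\<^sup>2"
    if x: "x \<in> hs 1 (a / 2)" "2 * a + 1 \<le> rad p q x" for x n i j
  proof -
    have "e n < sqrt (sqd p q (-1) a x)" using far_sqd[OF x(2), of "-1"] e(3)[of n] a_pos by simp
    then have "(e n)\<^sup>2 < sqd p q (-1) a x"
      using power_strict_mono[of "e n" "sqrt (sqd p q (-1) a x)" 2] e(1)[of n] by (simp add: sqd_dist)
    note nr = near[OF this]
    show "\<bar>v1 (?f n) i x\<bar> \<le> C1 / rad p q x" "\<bar>pd j (v1 (?f n) i) x\<bar> \<le> C1 / (rad p q x)\<^sup>2" "\<bar>S1 (?f n) i j x\<bar> \<le> C1 / (rad p q x)\<^sup>2"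
      unfolding nr using C1(2)[OF x] by blast+
  qed
  have bound: "\<exists>Q\<ge>0. \<forall>R m. 2 * a + 1 \<le> R \<longrightarrow> rad p q ?x0 + 1 \<le> R \<longrightarrow> rad p q y \<le> R \<longrightarrow> 0 \<le> m \<longrightarrow>
      (\<forall>i x. R \<le> rad p q x \<longrightarrow> \<bar>u i x\<bar> \<le> m) \<longrightarrow> \<bar>V\<bar> \<le> m * Q"
  proof (intro exI[of _ "9 * ((2 * \<bar>mu1\<bar> + 3 * \<bar>lam1\<bar>) * C1 * M * (128 + 16 * M1) + (2 * \<bar>mu2\<bar> + 3 * \<bar>lam2\<bar>) * C2 * M * (128 + 16 * M1))
      + 9 * (64 * C1 * M + 64 * C2 * M)"] conjI allI impI)
    let ?Q1 = "(2 * \<bar>mu1\<bar> + 3 * \<bar>lam1\<bar>) * C1 * M * (128 + 16 * M1)" and ?Q2 = "(2 * \<bar>mu2\<bar> + 3 * \<bar>lam2\<bar>) * C2 * M * (128 + 16 * M1)"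
    show "0 \<le> 9 * (?Q1 + ?Q2) + 9 * (64 * C1 * M + 64 * C2 * M)"
      using C1(1) C2(1) M(1) M1(1) by simp
    fix R m assume R: "2 * a + 1 \<le> R" "rad p q ?x0 + 1 \<le> R" "rad p q y \<le> R" and m: "0 \<le> m" "\<forall>i x. R \<le> rad p q x \<longrightarrow> \<bar>u i x\<bar> \<le> m"
    let ?eta = "cutoff p q R"
    have R0: "0 < R" using R(1) a_pos by linarith
    have m': "\<bar>u i x\<bar> \<le> m" if "R \<le> rad p q x" for i x using m(2) that by blast
    define T1 where "T1 n = (\<Sum>i\<in>UNIV. \<Sum>j\<in>UNIV. HI 1 (G i j) (\<lambda>x. hooke mu1 lam1 (\<lambda>i j. v1 (?f n) i x * pd j ?eta x) i j)
        + HI (-1) (G i j) (\<lambda>x. hooke mu2 lam2 (\<lambda>i j. v2 i x * pd j ?eta x) i j))" for n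
    define T2 where "T2 n = (\<Sum>i\<in>UNIV. \<Sum>j\<in>UNIV. HI 1 (u i) (\<lambda>x. pd j ?eta x * S1 (?f n) i j x) + HI (-1) (u i) (\<lambda>x. pd j ?eta x * S2 i j x))" for n
    define T3 where "T3 n = (\<Sum>i\<in>UNIV. \<Sum>j\<in>UNIV. HI 1 (u i) (\<lambda>x. ?eta x * pd j (S1 (?f n) i j) x) + HI (-1) (u i) (\<lambda>x. ?eta x * pd j (S2 i j) x))" for n
    \<comment> \<open>The left side is the same for every \<open>n\<close>: at \<open>y\<close> the
      cutoff is 1 and the regularisation is invisible.\<close>
    have green: "v1 ?b 3 y = T1 n - T2 n - T3 n" for n
    proof -
      have "(\<Sum>i\<in>UNIV. l $ i * (?eta y * v1 (?f n) i y)) = T1 n - T2 n - T3 n"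
        unfolding T1_def T2_def T3_def
      proof (rule green_identity[OF W1 W2 smooth_v1[OF smooth_on_poleq] smooth_v2 _ _ _ _ smooth_on_cutoff compact_sqd_le[of p q 0 "2 * R\<^sup>2"] cutoff_eq_0[OF R0] d y_pos])
        show "S1 (?f n) i j x = hooke mu1 lam1 (\<lambda>i j. pd j (v1 (?f n) i) x) i j" if "x \<in> hs 1 (a / 2)" for i j x
          unfolding S1_def v1_def[abs_def]
          by (rule pn_hooke[symmetric, OF open_hs that smooth_up_hs[OF smooth_on_poleq] _ _ lam1]) (use nu1 mu_pos in auto)
        show "S2 i j x = hooke mu2 lam2 (\<lambda>i j. pd j (v2 i) x) i j" if "x \<in> hs (-1) (a / 2)" for i j x
          unfolding S2_def v2_def[abs_def]
          by (rule pn_hooke[symmetric, OF open_hs that smooth_dn[OF open_hs hs_sub(2)] _ _ lam2]) (use nu2 mu_pos in auto)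
        fix i and x :: "real^3" assume x: "x $ 3 = 0"
        have xh: "x \<in> hs 1 (a / 2)" using x a_pos by (simp add: hs_def)
        have "(e n)\<^sup>2 < a\<^sup>2" using e(1,3)[of n] a_pos by (intro power_strict_mono) auto
        also have "\<dots> \<le> sqd p q (-1) a x" using x by (simp add: sqd_def ht_def)
        finally obtain T where T: "open T" "x \<in> T" "\<And>z. z \<in> T \<Longrightarrow> ?f n z = ?b z" using agree by metis
        have fs: "smooth_on (hs 1 (a / 2)) (?f n)" by (rule smooth_on_subset[OF smooth_on_poleq]) simp
        show "v1 (?f n) i x = v2 i x" unfolding v1_def v2_def
          by (rule plane_matching(1)[OF open_hs hs_sub(1) fs xh x T])
        show "S1 (?f n) i 3 x = S2 i 3 x" unfolding S1_def S2_def
          by (rule plane_matching(2)[OF open_hs hs_sub(1) fs xh x T])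
      qed
      moreover have "(\<Sum>i\<in>UNIV. l $ i * (?eta y * v1 (?f n) i y)) = v1 ?b 3 y"
      proof -
        have "?eta y = 1" by (rule cutoff_eq_1[OF R0 R(3)])
        moreover have "v1 (?f n) 3 y = v1 ?b 3 y"
          by (rule near(1)) (unfold sqd_dist, use e(1,4)[of n] in \<open>intro power_strict_mono, auto\<close>)
        ultimately show ?thesis by (simp add: l sum_3 axis_def)
      qed
      ultimately show ?thesis by simp
    qed
    note est = shell_estimates[where R = R and m = m and M = M and ?M1.0 = M1 and ?R0.0 = "2 * a + 1" and p = p and q = q,
      OF _ d _ _ _ _ _ _ R0 R(1) m(1) m' M(1) M(2)[OF R0] M(3)[OF R0] M1(2)]
    note eu = est[of 1 "v1 (?f n)" "S1 (?f n)" C1 for n, OF _ smooth_v1[OF smooth_on_poleq] smooth_S1[OF smooth_on_poleq] C1(1) C1', simplified]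
    have C2': "\<bar>v2 i x\<bar> \<le> C2 / rad p q x" "\<bar>pd j (v2 i) x\<bar> \<le> C2 / (rad p q x)\<^sup>2" "\<bar>S2 i j x\<bar> \<le> C2 / (rad p q x)\<^sup>2"
      if x: "x \<in> hs (-1) (a / 2)" "2 * a + 1 \<le> rad p q x" for x i j using C2(2)[OF x] by blast+
    note el = est[of "-1" v2 S2 C2, OF _ smooth_v2 smooth_S2 C2(1) C2', simplified]
    have t1: "\<bar>T1 n\<bar> \<le> 9 * (m * ?Q1 + m * ?Q2)" for n
      unfolding T1_def by (rule abs_double_sum_le) (rule order_trans[OF abs_triangle_ineq add_mono[OF eu(1) el(1)]])
    have t2: "\<bar>T2 n\<bar> \<le> 9 * (m * (64 * C1 * M) + m * (64 * C2 * M))" for n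
      unfolding T2_def by (rule abs_double_sum_le) (rule order_trans[OF abs_triangle_ineq add_mono[OF eu(2) el(2)]])
    have t3: "T3 \<longlonglongrightarrow> - (4 * (1 - nu1) * kappa0 * u 3 ?x0)"
      unfolding T3_def[abs_def] by (rule interior_term[OF e(1,2,3) elim]) (use R in auto)
    have "(\<lambda>n. \<bar>v1 ?b 3 y + T3 n\<bar>) \<longlonglongrightarrow> \<bar>v1 ?b 3 y + - (4 * (1 - nu1) * kappa0 * u 3 ?x0)\<bar>"
      by (intro tendsto_rabs tendsto_add tendsto_const t3)
    moreover have "\<bar>v1 ?b 3 y + T3 n\<bar> \<le> m * (9 * (?Q1 + ?Q2) + 9 * (64 * C1 * M + 64 * C2 * M))" for n
    proof -
      have "\<bar>v1 ?b 3 y + T3 n\<bar> \<le> \<bar>T1 n\<bar> + \<bar>T2 n\<bar>" using green[of n] by linarith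
      then show ?thesis using t1[of n] t2[of n] unfolding distrib_left by linarith
    qed
    ultimately have "\<bar>v1 ?b 3 y + - (4 * (1 - nu1) * kappa0 * u 3 ?x0)\<bar> \<le> m * (9 * (?Q1 + ?Q2) + 9 * (64 * C1 * M + 64 * C2 * M))"
      by (intro LIMSEQ_le_const2) auto
    then show "\<bar>V\<bar> \<le> m * (9 * (?Q1 + ?Q2) + 9 * (64 * C1 * M + 64 * C2 * M))" by (simp add: V_def)
  qed
  then obtain Q where Q: "0 \<le> Q" "\<And>R m. 2 * a + 1 \<le> R \<Longrightarrow> rad p q ?x0 + 1 \<le> R \<Longrightarrow> rad p q y \<le> R \<Longrightarrow> 0 \<le> m \<Longrightarrow>
      (\<forall>i x. R \<le> rad p q x \<longrightarrow> \<bar>u i x\<bar> \<le> m) \<Longrightarrow> \<bar>V\<bar> \<le> m * Q" by blast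
  have small: "\<bar>V\<bar> \<le> m * Q" if m: "0 < m" for m
  proof -
    obtain R1 where R1: "\<And>x i. R1 \<le> norm x \<Longrightarrow> \<bar>u i x\<bar> \<le> m" using u_decay[OF m] by blast
    let ?c = "vector [p, q, 0] :: real^3"
    \<comment> \<open>A crude sum dominating every lower bound required of R; the norm of
      \<open>?c\<close> accounts for the shift of centre from 0 to the foot point.\<close>
    define R where "R = (R1 + norm ?c) + (2 * a + 1) + (rad p q ?x0 + 1) + rad p q y + \<bar>R1\<bar>"
    have nn: "0 \<le> rad p q y" "0 \<le> rad p q ?x0" "0 \<le> norm ?c" by (simp_all add: rad_nonneg)
    show ?thesis
    proof (rule Q(2)[of R])
      show "2 * a + 1 \<le> R" "rad p q ?x0 + 1 \<le> R" "rad p q y \<le> R" unfolding R_def using nn a_pos by linarith+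
      show "\<forall>i x. R \<le> rad p q x \<longrightarrow> \<bar>u i x\<bar> \<le> m"
      proof (intro allI impI)
        fix i x assume "R \<le> rad p q x"
        moreover have "rad p q x \<le> norm x + norm ?c" unfolding rad_dist by (rule norm_triangle_ineq4)
        ultimately have "R1 \<le> norm x" using nn a_pos by (simp add: R_def)
        then show "\<bar>u i x\<bar> \<le> m" by (rule R1)
      qed
    qed (use m in simp)
  qed
  have "V = 0"
  proof (rule ccontr)
    assume "V \<noteq> 0"
    \<comment> \<open>This choice of m gives |V| \<le> |V| Q / (2 (Q + 1)), where the factor of |V|
      is less than 1.\<close>
    then have "0 < \<bar>V\<bar> / (2 * (Q + 1))" using Q(1) by simp
    from small[OF this] have "\<bar>V\<bar> \<le> \<bar>V\<bar> * (Q / (2 * (Q + 1)))" by simp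
    moreover have "Q / (2 * (Q + 1)) < 1" using Q(1) by (simp add: divide_less_eq)
    ultimately show False using \<open>V \<noteq> 0\<close> mult_strict_left_mono[of "Q / (2 * (Q + 1))" 1 "\<bar>V\<bar>"] by simp
  qed
  then show ?thesis by (simp add: V_def)
qed

end

section \<open>The derivative at the interface\<close>

context transmission
begin

text \<open>Since 4 (1 - nu1) = 1 + kap1 and the vertical derivative of \<open>Pup\<close> removes
  one copy of \<open>Bup\<close>, the coefficient \<open>kap1\<close> remains. \<open>g1\<close> and
  \<open>g2\<close> are the reciprocal distances from (0, 0, r) to the source and to its mirror
  image.\<close>

lemma v1_axis:
  assumes r: "0 < r" "a < r"
  defines "g1 \<equiv> inverse (sqrt (p\<^sup>2 + q\<^sup>2 + (r - a)\<^sup>2))" and "g2 \<equiv> inverse (sqrt (p\<^sup>2 + q\<^sup>2 + (r + a)\<^sup>2))"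
  shows "mu1 * v1 (invr p q (-1) a) 3 (vector [0, 0, r]) =
    kap1 * (g1 + gam * kap1 * g2 + 2 * a * gam * ((r + a) * g2 ^ 3)) + (r - a)\<^sup>2 * g1 ^ 3
    + gam * kap1 * ((r - a) * (r + a) * g2 ^ 3) + 2 * a * gam * r * (- (g2 ^ 3) + 3 * (r + a)\<^sup>2 * g2 ^ 5) + cl * g2"
proof -
  let ?y = "vector [0, 0, r] :: real^3"
  let ?S = "{x. 0 < ht 1 a x} \<inter> {x. 0 < sqd p q (-1) a x}"
  have y: "?y $ 1 = 0" "?y $ 2 = 0" "?y $ 3 = r" by simp_all
  have s: "sqd p q (-1) a ?y = p\<^sup>2 + q\<^sup>2 + (r - a)\<^sup>2" "sqd p q 1 a ?y = p\<^sup>2 + q\<^sup>2 + (r + a)\<^sup>2"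
    by (simp_all add: sqd_def ht_def power2_eq_square algebra_simps)
  have h: "0 < ht 1 a ?y" using r a_pos by (simp add: ht_def)
  have sp: "0 < sqd p q (-1) a ?y" "0 < sqd p q 1 a ?y"
    unfolding s using r a_pos by (auto intro!: add_nonneg_pos)
  have S: "open ?S" "?S \<subseteq> {x. 0 < ht 1 a x}" "?y \<in> ?S" using h sp by (auto intro: open_Int open_ht_pos open_sqd_pos)
  have f: "smooth_on ?S (invr p q (-1) a)" by (rule smooth_on_invr[OF S(1)]) auto
  have g: "invr p q (-1) a ?y = g1" "invr p q 1 a ?y = g2" by (simp_all add: invr_def s g1_def g2_def)
  have c: "coord p q (-1) a 3 ?y = r - a" "coord p q 1 a 3 ?y = r + a" by (simp_all add: coord_def)
  note P = pd_invr[of "-1", OF _ sp(1), simplified] pd_invr[of 1, OF _ sp(2), simplified]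
  note P2 = pd2_invr[of 1, OF _ sp(2), simplified]
  note PL = pd_logr[of 1, OF _ h, simplified]
  have "mu1 * v1 (invr p q (-1) a) 3 ?y = pn_disp nu1 (Bup (invr p q (-1) a)) (Pup (invr p q (-1) a)) 3 ?y"
    using mu_pos by (simp add: v1_def)
  also have "\<dots> = (1 + kap1) * Bup (invr p q (-1) a) ?y - pd 3 (Pup (invr p q (-1) a)) ?y"
  proof -
    have "4 * (1 - nu1) = 1 + kap1" using relations(5) by algebra
    then show ?thesis by (simp only: pn_disp_def if_True simp_thms)
  qed
  finally show ?thesis
    unfolding pd_Pup[OF S(1,2) f S(3)] Bup_def
    by (simp add: P P2 PL c g y power2_eq_square algebra_simps)
qed

end

text \<open>The numerator obtained from \<open>2 Q (3 + k) (1 + k \<kappa>)\<close>, where \<open>Q\<close> is the bracket multiplying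
  \<open>r / |x - y|\<^sup>3\<close> in the derivative at the interface, at the extreme values \<open>\<kappa>\<^sup>i = 3\<close>, \<open>|x'|\<^sup>2 = r\<^sup>2 / 2\<close>.\<close>

definition qnum :: "real \<Rightarrow> real \<Rightarrow> real" where
  "qnum K k = 3 * (3 - K) * (K + 1) + 8 * (K\<^sup>2 - 1) * k + 4 * (K\<^sup>2 - 1) * k\<^sup>2"

lemma qnum_pos: "1 < K \<Longrightarrow> K \<le> 3 \<Longrightarrow> 0 < k \<Longrightarrow> 0 < qnum K k"
proof -
  assume a: "1 < K" "K \<le> 3" "0 < k"
  have "1 < K\<^sup>2" using a by (simp add: one_less_power)
  then have "0 < 8 * (K\<^sup>2 - 1) * k" "0 < 4 * (K\<^sup>2 - 1) * k\<^sup>2" using a by simp_all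
  moreover have "0 \<le> 3 * (3 - K) * (K + 1)" using a by simp
  ultimately show ?thesis unfolding qnum_def by linarith
qed

text \<open>\<open>w\<close> stands for r^2 / |x - y|^2, and w \<ge> 2/3 is the disc condition. Its
  coefficient is positive, so the smallest \<open>w\<close> is the worst case. \<open>K'\<close>
  enters through \<open>del\<close>, which increases with it, and \<open>cl\<close> has a minus
  sign, so K' = 3 is the worst case.\<close>

lemma bracket_lower_bound:
  fixes K K' k gam del cl w :: real
  assumes K: "1 < K" "K \<le> 3" and K': "1 < K'" "K' \<le> 3" and k: "0 < k"
    and gam: "gam * (1 + k * K) = 1 - k" and del: "del * (K' + k) = K' - k * K" and cl: "2 * cl = del - gam * K\<^sup>2"
    and w: "2 / 3 \<le> w"
  shows "qnum K k / (2 * (3 + k) * (1 + k * K)) \<le> K - gam * K\<^sup>2 + 2 * gam * K - 2 - 2 * gam - cl + w * (3 - 3 * gam * K + 6 * gam)"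
proof -
  have p: "0 < 1 + k * K" "0 < K' + k" "0 < 3 + k" using assms by (auto intro!: add_pos_pos)
  have g: "gam = (1 - k) / (1 + k * K)" using gam p by (simp add: field_simps)
  have "0 < 1 - gam * (K - 2)"
  proof -
    \<comment> \<open>Clearing the denominator of \<open>gam\<close> exhibits the sign, as 1 < K
      \<le> 3.\<close>
    have "(1 - gam * (K - 2)) * (1 + k * K) = 3 - K + 2 * k * (K - 1)" using gam by algebra
    also have "0 < \<dots>" using K k by (intro add_nonneg_pos) auto
    finally show ?thesis using p(1) by (simp add: zero_less_mult_iff)
  qed
  then have "2 / 3 * (3 * (1 - gam * (K - 2))) \<le> w * (3 * (1 - gam * (K - 2)))" using w by (intro mult_right_mono) auto
  then have 1: "2 - 2 * gam * K + 4 * gam \<le> w * (3 - 3 * gam * K + 6 * gam)" by (simp add: algebra_simps)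
  have 2: "del \<le> (3 - k * K) / (3 + k)"
  proof -
    \<comment> \<open>In this form the monotonicity in K' is visible.\<close>
    have d: "del = 1 - k * (1 + K) / (K' + k)" using del p by (simp add: field_simps)
    have "k * (1 + K) / (3 + k) \<le> k * (1 + K) / (K' + k)"
      using K k K' p by (intro divide_left_mono mult_pos_pos) auto
    moreover have "(3 - k * K) / (3 + k) = 1 - k * (1 + K) / (3 + k)" using p by (simp add: field_simps)
    ultimately show ?thesis unfolding d by (simp only: diff_left_mono)
  qed
  define d0 where "d0 = (3 - k * K) / (3 + k)"
  have "qnum K k / (2 * (3 + k) * (1 + k * K)) = (2 * K - (3 - k * K) / (3 + k) - gam * (K\<^sup>2 - 4)) / 2"
    unfolding g qnum_def using p by (simp add: divide_simps) (simp add: power2_eq_square algebra_simps)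
  also have "\<dots> \<le> K - gam * K\<^sup>2 + 2 * gam * K - 2 - 2 * gam - cl + (2 - 2 * gam * K + 4 * gam)"
  proof -
    have "2 * (K - gam * K\<^sup>2 + 2 * gam * K - 2 - 2 * gam - cl + (2 - 2 * gam * K + 4 * gam)) = 2 * K - del - gam * (K\<^sup>2 - 4)"
      using cl by algebra
    then show ?thesis using 2 unfolding d0_def[symmetric] by simp
  qed
  finally show ?thesis using 1 by linarith
qed

text \<open>A derivative formula on [0, r) together with continuity at 0 provides the trace from
  above. At a = 0 the source and its mirror image coincide, so \<open>g1\<close> and
  \<open>g2\<close> agree and the value factors.\<close>

lemma profile_DERIV:
  fixes r t rho K gam cl :: real
  assumes r: "0 < r" "0 \<le> t" "t < r" and rho: "0 \<le> rho"
  defines "g1 \<equiv> \<lambda>a. inverse (sqrt (rho + (r - a)\<^sup>2))" and "g2 \<equiv> \<lambda>a. inverse (sqrt (rho + (r + a)\<^sup>2))"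
  defines "F \<equiv> \<lambda>a. K * (g1 a + gam * K * g2 a + 2 * a * gam * ((r + a) * g2 a ^ 3)) + (r - a)\<^sup>2 * g1 a ^ 3
    + gam * K * ((r - a) * (r + a) * g2 a ^ 3) + 2 * a * gam * r * (- (g2 a ^ 3) + 3 * (r + a)\<^sup>2 * g2 a ^ 5) + cl * g2 a"
  shows "\<exists>F'. (\<forall>t. 0 \<le> t \<and> t < r \<longrightarrow> (F has_real_derivative F' t) (at t)) \<and> isCont F' 0
     \<and> F' 0 = r * g1 0 ^ 3 * (K - gam * K\<^sup>2 + 2 * gam * K - 2 - 2 * gam - cl + (r\<^sup>2 * (g1 0)\<^sup>2) * (3 - 3 * gam * K + 6 * gam))"
proof -
  have p1: "0 < rho + (r - t)\<^sup>2" if "t < r" for t using that rho by (intro add_nonneg_pos) auto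
  have p2: "0 < rho + (r + t)\<^sup>2" if "0 \<le> t" for t using that r rho by (intro add_nonneg_pos) auto
  have d1: "(g1 has_real_derivative (r - t) * g1 t ^ 3) (at t)" if "t < r" for t
  proof -
    have "((\<lambda>a. rho + (r - a)\<^sup>2) has_real_derivative (- 2 * (r - t))) (at t)"
      by (auto intro!: derivative_eq_intros)
    note DERIV_chain2[OF DERIV_inverse_sqrt[OF p1[OF that]] this]
    moreover have "- (X ^ 3) / 2 * (- 2 * (r - t)) = (r - t) * X ^ 3" for X :: real by (simp add: algebra_simps)
    ultimately show ?thesis unfolding g1_def by (simp only:)
  qed
  have d2: "(g2 has_real_derivative - ((r + t) * g2 t ^ 3)) (at t)" if "0 \<le> t" for t
  proof -
    have "((\<lambda>a. rho + (r + a)\<^sup>2) has_real_derivative (2 * (r + t))) (at t)"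
      by (auto intro!: derivative_eq_intros)
    from DERIV_chain2[OF DERIV_inverse_sqrt[OF p2[OF that]] this]
    show ?thesis unfolding g2_def by (rule DERIV_cong) simp
  qed
  define h1 h2 where "h1 t = (r - t) * g1 t ^ 3" and "h2 t = - ((r + t) * g2 t ^ 3)" for t
  note D = d1[folded h1_def] d2[folded h2_def]
  define F' where "F' t = K * (h1 t + gam * K * h2 t + 2 * gam * ((r + t) * g2 t ^ 3) + 2 * t * gam * (g2 t ^ 3 + (r + t) * (3 * g2 t ^ 2 * h2 t)))
     + (- 2 * (r - t) * g1 t ^ 3 + (r - t)\<^sup>2 * (3 * g1 t ^ 2 * h1 t))
     + gam * K * ((- 2 * t) * g2 t ^ 3 + (r - t) * (r + t) * (3 * g2 t ^ 2 * h2 t))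
     + 2 * gam * r * (- (g2 t ^ 3) + 3 * (r + t)\<^sup>2 * g2 t ^ 5)
     + 2 * t * gam * r * (- (3 * g2 t ^ 2 * h2 t) + 6 * (r + t) * g2 t ^ 5 + 3 * (r + t)\<^sup>2 * (5 * g2 t ^ 4 * h2 t)) + cl * h2 t" for t
  have "(F has_real_derivative F' t) (at t)" if "0 \<le> t" "t < r" for t
    unfolding F_def
    by (rule derivative_eq_intros D that refl)+ (simp add: F'_def power2_eq_square algebra_simps)
  moreover have "isCont F' 0"
  proof -
    have "isCont g1 0" "isCont g2 0" using DERIV_isCont D r by blast+
    then show ?thesis unfolding F'_def[abs_def] h1_def[abs_def] h2_def[abs_def] by (intro continuous_intros)
  qed
  moreover have "F' 0 = r * g1 0 ^ 3 * (K - gam * K\<^sup>2 + 2 * gam * K - 2 - 2 * gam - cl + (r\<^sup>2 * (g1 0)\<^sup>2) * (3 - 3 * gam * K + 6 * gam))"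
  proof -
    have "g2 0 = g1 0" by (simp add: g1_def g2_def)
    then show ?thesis unfolding F'_def h1_def h2_def
      by (simp add: power2_eq_square power3_eq_cube power_numeral_reduce algebra_simps)
  qed
  ultimately show ?thesis by blast
qed

section \<open>Application to the Rongved matrix and the explicit constant\<close>

lemma lame_poisson:
  assumes "0 < mu" "0 \<le> lam"
  shows "lam = mu * (2 * poisson_ratio mu lam / (1 - 2 * poisson_ratio mu lam))"
proof -
  have s: "0 < lam + mu" using assms by linarith
  have n: "2 * poisson_ratio mu lam = lam / (lam + mu)" using s by (simp add: poisson_ratio_def field_simps)
  have "1 - lam / (lam + mu) = mu / (lam + mu)" using s by (simp add: field_simps)
  then show ?thesis unfolding n using s assms by simp
qed

text \<open>The exterior material occupies the upper half-space and becomes material 1 of the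
  representation formula. \<open>U\<close> is continuous at the source because that point lies off
  the plane and, as a < r, differs from the pole.\<close>

lemma rongved_component:
  fixes mu_i lam_i mu_e lam_e :: real
  assumes mu: "0 < mu_i" "0 < mu_e" and lam: "0 \<le> lam_i" "0 \<le> lam_e"
    and U: "rongved_solution mu_i lam_i mu_e lam_e (vector [0, 0, r]) (axis 3 1) U"
    and a: "0 < a" "a < r"
  defines "nu1 \<equiv> poisson_ratio mu_e lam_e" and "nu2 \<equiv> poisson_ratio mu_i lam_i"
  shows "transmission.v1 p q a mu_e mu_i nu1 nu2 (invr p q (-1) a) 3 (vector [0, 0, r])
    = 4 * (1 - nu1) * kappa0 * U (vector [p, q, a]) $ 3"
proof -
  let ?y = "vector [0, 0, r] :: real^3" and ?x0 = "vector [p, q, a] :: real^3"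
  have nu: "0 \<le> nu1" "nu1 < 1 / 2" "0 \<le> nu2" "nu2 < 1 / 2"
    using mu lam by (auto simp: nu1_def nu2_def poisson_ratio_def divide_less_eq)
  have xy: "?y \<noteq> ?x0" using a by (auto simp: vec_eq_iff forall_3)
  have dU: "U differentiable (at ?x0)"
  proof -
    have "\<forall>x. x $ 3 \<noteq> 0 \<and> x \<noteq> ?y \<longrightarrow> U differentiable (at x)"
      using U unfolding rongved_solution_def by blast
    then show ?thesis using xy a by auto
  qed
  have lim: "(U \<longlongrightarrow> 0) at_infinity" using U unfolding rongved_solution_def by blast
  interpret weak_solution "\<lambda>i x. U x $ i" "\<lambda>i j x. grad U x $ i $ j"
    "\<lambda>i j x. biphase mu_i lam_i mu_e lam_e x (grad U x) $ i $ j" "axis 3 1" ?y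
    by (rule weak_solution_rongved[OF U])
  interpret transmission_weak p q a mu_e mu_i nu1 nu2 "\<lambda>i x. U x $ i" "\<lambda>i j x. grad U x $ i $ j"
    "\<lambda>i j x. biphase mu_i lam_i mu_e lam_e x (grad U x) $ i $ j" "axis 3 1" ?y lam_e lam_i
  proof
    show "0 < a" "0 < mu_e" "0 < mu_i" "0 \<le> nu1" "nu1 < 1 / 2" "0 \<le> nu2" "nu2 < 1 / 2"
      using a mu nu by blast+
    show "lam_e = mu_e * (2 * nu1 / (1 - 2 * nu1))" "lam_i = mu_i * (2 * nu2 / (1 - 2 * nu2))"
      unfolding nu1_def nu2_def using lame_poisson mu lam by blast+
    show "biphase mu_i lam_i mu_e lam_e x (grad U x) $ i $ j = hooke mu_e lam_e (\<lambda>i j. grad U x $ i $ j) i j"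
      if "0 < x $ 3" for x i j using that by (simp add: biphase_nth elastic_nth hooke_def)
    show "biphase mu_i lam_i mu_e lam_e x (grad U x) $ i $ j = hooke mu_i lam_i (\<lambda>i j. grad U x $ i $ j) i j"
      if "x $ 3 < 0" for x i j using that by (simp add: biphase_nth elastic_nth hooke_def)
    show "0 < ?y $ 3" using a by simp
    show "?y \<noteq> ?x0" by (rule xy)
    show "isCont (\<lambda>x. U x $ i) ?x0" for i
      by (rule bounded_linear.isCont[OF bounded_linear_vec_nth differentiable_imp_continuous_within[OF dU]])
    show "\<exists>R. \<forall>x i. R \<le> norm x \<longrightarrow> \<bar>U x $ i\<bar> \<le> e" if "0 < e" for e
    proof -
      have "\<forall>\<^sub>F x in at_infinity. dist (U x) 0 < e" using lim that by (rule tendstoD)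
      then obtain b where b: "\<And>x. b \<le> norm x \<Longrightarrow> norm (U x) < e" unfolding eventually_at_infinity by auto
      have "\<bar>U x $ i\<bar> \<le> e" if "b \<le> norm x" for x i
        using component_le_norm_cart[of "U x" i] b[OF that] by linarith
      then show ?thesis by blast
    qed
  qed
  show ?thesis by (rule representation) (rule refl)
qed

text \<open>(2/3)^(3/2) bounds r^3 / |x - y|^3 from below on the disc, the middle factor bounds the
  bracket, and the denominator undoes the factors of \<open>v1_axis\<close> and of the
  representation formula. \<open>lam_e\<close> enters through the Poisson ratio, while
  \<open>lam_i\<close> has been eliminated by the worst case.\<close>

definition normal_derivative_constant :: "real \<Rightarrow> real \<Rightarrow> real \<Rightarrow> real" where
  "normal_derivative_constant mu_e mu_i lam_e =
    (let K = 3 - 4 * poisson_ratio mu_e lam_e; k = mu_i / mu_e in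
      (sqrt (2 / 3)) ^ 3 * (qnum K k / (2 * (3 + k) * (1 + k * K)))
        / (mu_e * (4 * (1 - poisson_ratio mu_e lam_e) * kappa0)))"

lemma normal_derivative:
  fixes mu_i lam_i mu_e lam_e :: real
  assumes mu: "0 < mu_i" "0 < mu_e" and lam: "0 \<le> lam_i" "0 \<le> lam_e"
    and U: "rongved_solution mu_i lam_i mu_e lam_e (vector [0, 0, r]) (axis 3 1) U"
    and r: "0 < r" "sqrt (p\<^sup>2 + q\<^sup>2) \<le> r / sqrt 2"
  shows "\<exists>D. has_upper_normal_derivative (\<lambda>x. U x $ 3) p q D \<and> normal_derivative_constant mu_e mu_i lam_e / r\<^sup>2 \<le> D"
proof -
  define nu1 nu2 where "nu1 = poisson_ratio mu_e lam_e" and "nu2 = poisson_ratio mu_i lam_i"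
  define rho where "rho = p\<^sup>2 + q\<^sup>2"
  have nu: "0 \<le> nu1" "nu1 < 1 / 2" "0 \<le> nu2" "nu2 < 1 / 2"
    using mu lam by (auto simp: nu1_def nu2_def poisson_ratio_def divide_less_eq)
  have tr: "transmission a mu_e mu_i nu1 nu2" if "0 < a" for a
    using that mu nu by unfold_locales auto
  \<comment> \<open>The constants do not involve \<open>a\<close>, so the value 1 merely serves to
    name them.\<close>
  interpret T: transmission p q 1 mu_e mu_i nu1 nu2 by (rule tr) simp
  define K where "K = T.kap1"
  define gam where "gam = T.gam"
  define cl where "cl = T.cl"
  have Kdef: "K = 3 - 4 * nu1" by (simp add: K_def T.kap1_def)
  define w where "w = mu_e * (4 * (1 - nu1) * kappa0)"
  have w: "0 < w" using mu nu kappa0_pos by (simp add: w_def)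
  define g1 g2 where "g1 a = inverse (sqrt (rho + (r - a)\<^sup>2))" and "g2 a = inverse (sqrt (rho + (r + a)\<^sup>2))" for a
  define F where "F a = K * (g1 a + gam * K * g2 a + 2 * a * gam * ((r + a) * g2 a ^ 3)) + (r - a)\<^sup>2 * g1 a ^ 3
    + gam * K * ((r - a) * (r + a) * g2 a ^ 3) + 2 * a * gam * r * (- (g2 a ^ 3) + 3 * (r + a)\<^sup>2 * g2 a ^ 5) + cl * g2 a" for a
  have UF: "U (vector [p, q, a]) $ 3 = F a / w" if a: "0 < a" "a < r" for a
  proof -
    interpret A: transmission p q a mu_e mu_i nu1 nu2 by (rule tr[OF a(1)])
    have "mu_e * (4 * (1 - nu1) * kappa0 * U (vector [p, q, a]) $ 3) = F a"
      using A.v1_axis[OF r(1) a(2)] rongved_component[OF mu lam U a, of p q]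
      by (simp add: F_def g1_def g2_def rho_def K_def gam_def cl_def nu1_def nu2_def)
    then have "w * U (vector [p, q, a]) $ 3 = F a" by (simp add: w_def mult.assoc)
    then show ?thesis using w by (simp add: field_simps)
  qed
  have rho: "0 \<le> rho" by (simp add: rho_def)
  obtain F' where F': "\<And>t. 0 \<le> t \<Longrightarrow> t < r \<Longrightarrow> (F has_real_derivative F' t) (at t)" "isCont F' 0"
    "F' 0 = r * g1 0 ^ 3 * (K - gam * K\<^sup>2 + 2 * gam * K - 2 - 2 * gam - cl + (r\<^sup>2 * (g1 0)\<^sup>2) * (3 - 3 * gam * K + 6 * gam))"
    using profile_DERIV[OF r(1) order_refl r(1) rho, of K gam cl]
    unfolding F_def[abs_def] g1_def[abs_def] g2_def[abs_def] by blast
  have dU: "((\<lambda>s. U (vector [p, q, s]) $ 3) has_real_derivative F' t / w) (at t)" if "0 < t" "t < r" for t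
  proof (rule has_field_derivative_transform_within_open)
    show "((\<lambda>s. F s / w) has_real_derivative F' t / w) (at t)"
      using F'(1)[of t] that by (intro DERIV_cdivide) auto
    show "open {0<..<r}" "t \<in> {0<..<r}" using that by auto
    show "F s / w = U (vector [p, q, s]) $ 3" if "s \<in> {0<..<r}" for s using UF[of s] that by simp
  qed
  have ev: "\<forall>\<^sub>F t in at_right 0. 0 < t \<and> t < r"
    using r(1) by (auto simp: eventually_at_right intro!: exI[of _ r])
  have has: "has_upper_normal_derivative (\<lambda>x. U x $ 3) p q (F' 0 / w)"
    unfolding has_upper_normal_derivative_def
  proof (intro conjI)
    show "\<forall>\<^sub>F t in at_right 0. (\<lambda>s. U (vector [p, q, s]) $ 3) field_differentiable at t"
      using ev by eventually_elim (use dU in \<open>auto simp: field_differentiable_def\<close>)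
    have "(F' \<longlongrightarrow> F' 0) (at_right 0)"
      using F'(2) unfolding isCont_def by (rule tendsto_within_subset) auto
    then have "((\<lambda>t. F' t / w) \<longlongrightarrow> F' 0 / w) (at_right 0)" using w by (intro tendsto_divide tendsto_const) auto
    then show "((\<lambda>t. deriv (\<lambda>s. U (vector [p, q, s]) $ 3) t) \<longlongrightarrow> F' 0 / w) (at_right 0)"
    proof (rule Lim_transform_eventually)
      show "\<forall>\<^sub>F t in at_right 0. F' t / w = deriv (\<lambda>s. U (vector [p, q, s]) $ 3) t"
        using ev by eventually_elim (use DERIV_imp_deriv[OF dU] in auto)
    qed
  qed
  define k where "k = mu_i / mu_e"
  define Q where "Q = qnum K k / (2 * (3 + k) * (1 + k * K))"
  note kp = T.kap_pos
  have kT: "T.k = k" by (simp add: T.k_def k_def)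
  have Qp: "0 < Q"
    using qnum_pos[of K k] kp kT by (auto simp: Q_def K_def intro!: divide_pos_pos mult_pos_pos add_pos_pos)
  have rho_le: "rho \<le> r\<^sup>2 / 2"
  proof -
    have "(sqrt rho)\<^sup>2 \<le> (r / sqrt 2)\<^sup>2" using r by (intro power_mono) (auto simp: rho_def)
    then show ?thesis using rho by (simp add: power_divide)
  qed
  have g0: "g1 0 = inverse (sqrt (rho + r\<^sup>2))" by (simp add: g1_def)
  have gsq: "2 / 3 \<le> r\<^sup>2 * (g1 0)\<^sup>2"
  proof -
    have "0 < rho + r\<^sup>2" using rho r by (intro add_nonneg_pos) auto
    then have "r\<^sup>2 * (g1 0)\<^sup>2 = r\<^sup>2 / (rho + r\<^sup>2)" by (simp add: g0 power_inverse divide_inverse)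
    also have "2 / 3 \<le> \<dots>" using rho_le \<open>0 < rho + r\<^sup>2\<close> by (simp add: le_divide_eq)
    finally show ?thesis .
  qed
  have gpos: "0 < g1 0" unfolding g0 using rho r by (auto intro!: add_nonneg_pos)
  have "sqrt (2 / 3) \<le> r * g1 0"
    by (rule real_le_lsqrt) (use gsq gpos r in \<open>auto simp: power_mult_distrib\<close>)
  then have "sqrt (2 / 3) ^ 3 \<le> (r * g1 0) ^ 3" by (intro power_mono) auto
  then have g3: "sqrt (2 / 3) ^ 3 / r\<^sup>2 \<le> r * g1 0 ^ 3"
    using r(1) by (simp add: divide_le_eq power_mult_distrib power2_eq_square power3_eq_cube algebra_simps)
  have br: "Q \<le> K - gam * K\<^sup>2 + 2 * gam * K - 2 - 2 * gam - cl + (r\<^sup>2 * (g1 0)\<^sup>2) * (3 - 3 * gam * K + 6 * gam)"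
    unfolding Q_def
    by (rule bracket_lower_bound[of K "T.kap2" k gam "T.del"])
       (use kp T.relations gsq kT in \<open>simp_all add: K_def gam_def cl_def\<close>)
  have "(sqrt (2 / 3) ^ 3 / r\<^sup>2) * Q \<le> F' 0"
    unfolding F'(3) using r(1) gpos Qp by (intro mult_mono g3 br) auto
  then have "(sqrt (2 / 3) ^ 3 / r\<^sup>2) * Q / w \<le> F' 0 / w" using w by (intro divide_right_mono) auto
  moreover have "normal_derivative_constant mu_e mu_i lam_e = sqrt (2 / 3) ^ 3 * Q / w"
    unfolding normal_derivative_constant_def Let_def Q_def Kdef k_def w_def nu1_def ..
  ultimately show ?thesis using has by (intro exI[of _ "F' 0 / w"]) (simp add: mult.commute)
qed

lemma normal_derivative_constant_pos:
  assumes "0 < mu_i" "0 < mu_e" "0 \<le> lam_e"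
  shows "0 < normal_derivative_constant mu_e mu_i lam_e"
proof -
  define nu where "nu = poisson_ratio mu_e lam_e"
  have nu: "0 \<le> nu" "nu < 1 / 2" using assms by (auto simp: nu_def poisson_ratio_def divide_less_eq)
  have k: "0 < mu_i / mu_e" using assms by simp
  have q: "0 < qnum (3 - 4 * nu) (mu_i / mu_e)" using nu k by (intro qnum_pos) auto
  have "0 < 1 + mu_i / mu_e * (3 - 4 * nu)" using nu k by (intro add_pos_pos mult_pos_pos) auto
  then show ?thesis
    unfolding normal_derivative_constant_def Let_def nu_def[symmetric]
    using q k nu kappa0_pos assms by (intro divide_pos_pos mult_pos_pos zero_less_power add_pos_pos[of 3]) auto
qed

text \<open>The sign of \<lambda> can be read off the Poisson ratio once \<lambda> + \<mu> > 0,
  which follows from 3 (\<lambda> + \<mu>) = (2 \<mu> + 3 \<lambda>) + \<mu>.\<close>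

lemma admissible_lameD:
  assumes "admissible_lame \<alpha> \<gamma> mu lam" "0 < \<alpha>" "0 < \<gamma>" shows "0 < mu" "0 \<le> lam"
proof -
  show mu: "0 < mu" using assms by (simp add: admissible_lame_def)
  have "0 < 2 * mu + 3 * lam" using assms by (simp add: admissible_lame_def)
  then have "0 < 2 * (lam + mu)" using mu unfolding distrib_left by linarith
  then show "0 \<le> lam" using assms(1) by (simp add: admissible_lame_def poisson_ratio_def zero_le_divide_iff)
qed

text \<open>\<open>C\<close> is quantified as a function of three moduli before everything else,
  which expresses that the constant depends only on \<open>mu_e\<close>, \<open>mu_i\<close> and
  \<open>lam_e\<close>.\<close>

theorem lemma6p19:
  shows "\<exists>C :: real \<Rightarrow> real \<Rightarrow> real \<Rightarrow> real.
    \<forall>\<alpha> \<gamma> mu_i lam_i mu_e lam_e :: real.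
      0 < \<alpha> \<and> 0 < \<gamma> \<and> admissible_lame \<alpha> \<gamma> mu_i lam_i \<and> admissible_lame \<alpha> \<gamma> mu_e lam_e \<longrightarrow>
      0 < C mu_e mu_i lam_e \<and>
      (\<forall>\<Gamma> :: real^3 \<Rightarrow> real^3 \<Rightarrow> real^3^3. rongved_fundamental_matrix mu_i lam_i mu_e lam_e \<Gamma> \<longrightarrow>
        (\<forall>r x1 x2 :: real. 0 < r \<and> sqrt (x1\<^sup>2 + x2\<^sup>2) \<le> r / sqrt 2 \<longrightarrow>
          (\<exists>D. has_upper_normal_derivative (\<lambda>x. (\<Gamma> x (vector [0, 0, r]) *v axis 3 1) \<bullet> axis 3 1) x1 x2 D \<and>
               C mu_e mu_i lam_e / r\<^sup>2 \<le> D)))"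
proof (intro exI[of _ normal_derivative_constant] allI impI conjI)
  fix \<alpha> \<gamma> mu_i lam_i mu_e lam_e :: real
  assume "0 < \<alpha> \<and> 0 < \<gamma> \<and> admissible_lame \<alpha> \<gamma> mu_i lam_i \<and> admissible_lame \<alpha> \<gamma> mu_e lam_e"
  then have pos: "0 < mu_i" "0 < mu_e" "0 \<le> lam_i" "0 \<le> lam_e" using admissible_lameD by blast+
  show "0 < normal_derivative_constant mu_e mu_i lam_e"
    by (rule normal_derivative_constant_pos[OF pos(1,2,4)])
  fix \<Gamma> :: "real^3 \<Rightarrow> real^3 \<Rightarrow> real^3^3" and r x1 x2 :: real
  assume G: "rongved_fundamental_matrix mu_i lam_i mu_e lam_e \<Gamma>" and r: "0 < r \<and> sqrt (x1\<^sup>2 + x2\<^sup>2) \<le> r / sqrt 2"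
  have "rongved_solution mu_i lam_i mu_e lam_e (vector [0, 0, r]) (axis 3 1) (\<lambda>x. \<Gamma> x (vector [0, 0, r]) *v axis 3 1)"
    using G unfolding rongved_fundamental_matrix_def by (simp add: norm_axis_1)
  from normal_derivative[OF pos this conjunct1[OF r] conjunct2[OF r]]
  show "\<exists>D. has_upper_normal_derivative (\<lambda>x. (\<Gamma> x (vector [0, 0, r]) *v axis 3 1) \<bullet> axis 3 1) x1 x2 D \<and>
      normal_derivative_constant mu_e mu_i lam_e / r\<^sup>2 \<le> D"
    by (simp add: inner_axis)
qed

end
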